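(* Let $G$ be a graph with $|V_G|\geq 5$ having a $4$-valent vertex, with incident edges $e_1,e_2,e_3,e_4$. Then for every prime power $q$, $$[\Psi_G]_q\equiv -q^2\Big( [\Psi_G^{13,24},\Psi_G^{14,23}]_q + \sum_{i=1}^4 c_2(G\backslash i)_q\Big) \mod q^3 .$$ Here $[\Psi_G]_q$ is counted in $\mathbb{A}^{N_G}$ (all edge variables), and $[\Psi_G^{13,24},\Psi_G^{14,23}]_q$ is counted in $\mathbb{A}^{N_G-4}$ with coordinates $\alpha_5,\ldots,\alpha_{N_G}$.
   Context: Graphs are finite, multiple edges allowed; $V_G$ is the vertex set, $N=N_G$ the number of edges $e_1,\ldots,e_N$, and $\alpha_i$ is a variable attached to $e_i$. The graph polynomial is $\Psi_G=\sum_T\prod_{e_i\notin T}\alpha_i\in\mathbb{Z}[\alpha_1,\ldots,\alpha_N]$, the sum over all spanning trees $T$ of $G$. Equivalently $\Psi_G=\det M_G$, where $$M_G=\begin{pmatrix}\Delta(\alpha)&\mathcal{E}_G\\-\mathcal{E}_G^{T}&0\end{pmatrix},$$ $\Delta(\alpha)=\mathrm{diag}(\alpha_1,\ldots,\alpha_N)$ and $\mathcal{E}_G$ is the $N\times(|V_G|-1)$ (oriented) edge-vertex incidence matrix of $G$ (for any choice of orientation) with the last column deleted; the first $N$ rows and columns of $M_G$ are indexed by edges. For sets of edges $I,J,K$ with $|I|=|J|$ and $K\cap(I\cup J)=\emptyset$, the Dodgson polynomial $\Psi^{I,J}_{G,K}$ is the determinant of the matrix obtained from $M_G$ by removing the rows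 indexed by $I$ and the columns indexed by $J$ and putting $\alpha_t=0$ for $t\in K$ (defined up to an overall sign depending on choices, which is irrelevant for zero loci). Sets of edges are abbreviated by strings of indices, e.g. $\Psi_G^{13,24}=\Psi_G^{\{e_1,e_3\},\{e_2,e_4\}}$. $G\backslash i$ is the graph obtained from $G$ by deleting the edge $e_i$ (keeping all vertices). For polynomials $f_1,\ldots,f_k$ with integer coefficients, $[f_1,\ldots,f_k]_q$ is the number of common zeros over $\mathbb{F}_q$ (coefficients reduced to $\mathbb{F}_q$) in the affine space specified. For a graph $H$ with at least $3$ vertices, $[\Psi_H]_q$ is divisible by $q^2$, and $c_2(H)_q:=[\Psi_H]_q/q^2 \bmod q$, where $[\Psi_H]_q$ is counted in $\mathbb{A}^{N_H}$.
   Formalization: The graph G is additionally assumed to have at least 5 edges (N_G ≥ 5); for N_G = 4 the congruence always fails, e.g. for the star K_{1,4} it would read 0 ≡ -q² mod q³. *)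

theory Defs
  imports
    "HOL-Library.Poly_Mapping"
    "HOL-Library.FuncSet"
    "HOL-Library.Cardinality"
    "HOL-Number_Theory.Cong"
    "Graph_Theory.Digraph_Component"
    "Jordan_Normal_Form.Determinant"
    "Jordan_Normal_Form.DL_Submatrix"
begin

section \<open>Multivariate integer polynomials and point counts\<close>

type_synonym 'e intpoly = "('e \<Rightarrow>\<^sub>0 nat) \<Rightarrow>\<^sub>0 int"

definition Var :: "'e \<Rightarrow> 'e intpoly" where
  "Var e = Poly_Mapping.single (Poly_Mapping.single e 1) 1"

definition eval_poly :: "('e \<Rightarrow> 'k::comm_ring_1) \<Rightarrow> 'e intpoly \<Rightarrow> 'k" where
  "eval_poly a p =
     (\<Sum>m\<in>Poly_Mapping.keys p. of_int (Poly_Mapping.lookup p m) *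
        (\<Prod>e\<in>Poly_Mapping.keys m. a e ^ Poly_Mapping.lookup m e))"

text \<open>
  The finite field is the type \<open>'k\<close>. The set \<open>X\<close> lists the coordinates of the affine space;
  it has to contain every variable that occurs in \<open>F\<close>.
\<close>

definition zero_count :: "'k::{finite,field} itself \<Rightarrow> 'e set \<Rightarrow> 'e intpoly set \<Rightarrow> nat" where
  "zero_count _ X F = card {a \<in> X \<rightarrow>\<^sub>E (UNIV :: 'k set). \<forall>f\<in>F. eval_poly a f = 0}"


section \<open>Graphs\<close>

text \<open>
  A finite undirected multigraph is represented by a \<open>fin_digraph\<close>, that is, together with an
  orientation of its edges. The orientation only matters for the incidence matrix. Walks,
  trees and valencies ignore it. In particular \<open>forest\<close> and \<open>spanning_tree\<close> of the
  library are not usable here, because they refer to directed cycles.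
\<close>

definition joins :: "('v,'e) pre_digraph \<Rightarrow> 'e \<Rightarrow> 'v \<Rightarrow> 'v \<Rightarrow> bool" where
  "joins G e u v \<longleftrightarrow> (tail G e = u \<and> head G e = v) \<or> (tail G e = v \<and> head G e = u)"

text \<open>Loops are cycles of length one, pairs of parallel edges are cycles of length two.\<close>

definition undirected_cycle :: "('v,'e) pre_digraph \<Rightarrow> 'v list \<Rightarrow> 'e list \<Rightarrow> bool" where
  "undirected_cycle G us ps \<longleftrightarrow>
     ps \<noteq> [] \<and> length us = length ps \<and> distinct us \<and> distinct ps \<and>
     set us \<subseteq> verts G \<and> set ps \<subseteq> arcs G \<and>
     (\<forall>i<length ps. joins G (ps ! i) (us ! i) (us ! (Suc i mod length ps)))"

definition undirected_tree :: "('v,'e) pre_digraph \<Rightarrow> bool" where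
  "undirected_tree G \<longleftrightarrow>
     Digraph_Component.connected G \<and> \<not> (\<exists>us ps. undirected_cycle G us ps)"

definition spanning_trees :: "('v,'e) pre_digraph \<Rightarrow> 'e set set" where
  "spanning_trees G = {T. T \<subseteq> arcs G \<and> undirected_tree (G\<lparr>arcs := T\<rparr>)}"

definition incident_edges :: "('v,'e) pre_digraph \<Rightarrow> 'v \<Rightarrow> 'e set" where
  "incident_edges G v = {e \<in> arcs G. tail G e = v \<or> head G e = v}"

text \<open>A loop contributes two to the valency.\<close>

definition valency :: "('v,'e) pre_digraph \<Rightarrow> 'v \<Rightarrow> nat" where
  "valency G v = card {e \<in> arcs G. tail G e = v} + card {e \<in> arcs G. head G e = v}"


section \<open>Graph polynomial, Dodgson polynomials and the $c_2$-invariant\<close>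

definition graph_poly :: "('v,'e) pre_digraph \<Rightarrow> 'e intpoly" where
  "graph_poly G = (\<Sum>T\<in>spanning_trees G. \<Prod>e\<in>arcs G - T. Var e)"

text \<open>
  The lists \<open>es\<close> and \<open>vs\<close> enumerate the edges and the vertices. They fix the order of rows and
  columns, and hence the sign of the Dodgson polynomials. The last vertex of \<open>vs\<close> is the one
  whose column is deleted.
\<close>

definition incidence_matrix ::
    "('v,'e) pre_digraph \<Rightarrow> 'e list \<Rightarrow> 'v list \<Rightarrow> 'e intpoly mat" where
  "incidence_matrix G es vs = mat (length es) (length vs - 1)
     (\<lambda>(i,j). of_bool (head G (es ! i) = vs ! j) - of_bool (tail G (es ! i) = vs ! j))"

text \<open>The variables of the edges in \<open>K\<close> are put to zero.\<close>

definition graph_matrix ::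
    "('v,'e) pre_digraph \<Rightarrow> 'e list \<Rightarrow> 'v list \<Rightarrow> 'e set \<Rightarrow> 'e intpoly mat" where
  "graph_matrix G es vs K = four_block_mat
     (mat_diag (length es) (\<lambda>i. if es ! i \<in> K then 0 else Var (es ! i)))
     (incidence_matrix G es vs)
     (- transpose_mat (incidence_matrix G es vs))
     (0\<^sub>m (length vs - 1) (length vs - 1))"

text \<open>
  Note that \<open>submatrix\<close> takes the sets of the rows and columns that are kept.
\<close>

definition dodgson_poly ::
    "('v,'e) pre_digraph \<Rightarrow> 'e list \<Rightarrow> 'v list \<Rightarrow> 'e set \<Rightarrow> 'e set \<Rightarrow> 'e set \<Rightarrow> 'e intpoly" where
  "dodgson_poly G es vs I J K = det (submatrix (graph_matrix G es vs K)
     (- {i. i < length es \<and> es ! i \<in> I}) (- {j. j < length es \<and> es ! j \<in> J}))"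

text \<open>
  The residue class modulo \<open>q\<close> is given by its representative in \<open>{0..<q}\<close>. The division is
  exact whenever \<open>q\<^sup>2\<close> divides the point count.
\<close>

definition c2_invariant :: "'k::{finite,field} itself \<Rightarrow> ('v,'e) pre_digraph \<Rightarrow> nat" where
  "c2_invariant k H =
     (zero_count k (arcs H) {graph_poly H} div CARD('k) ^ 2) mod CARD('k)"

end

theory Submission
  imports Defs "HOL-Library.Function_Algebras"
begin

text \<open>
  Everything is evaluated over a finite field with \<open>q\<close> elements. There the graph polynomial is, up to
  a constant sign, the determinant of a symmetric matrix \<open>M\<close> with the edge variables on the diagonal
  (the matrix-tree theorem, \<open>det_tree\<close> and \<open>eval_graph_poly_fdet\<close>). Rows and columns are never
  removed: deleting the edge \<open>l\<close> amounts to replacing row \<open>l\<close> of \<open>M\<close> by the unit row at \<open>l\<close>, contracting it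
  to putting its variable to zero, and a Dodgson polynomial arises by replacing the removed rows by
  the unit rows at the removed columns.

  Let \<open>h\<close> be a choice of values for the edges outside the star of the 4-valent vertex \<open>v\<close>. For fixed
  \<open>h\<close> let \<open>A\<close> be the value of the graph polynomial of \<open>G\<close> without \<open>v\<close>, let \<open>f_ij\<close> be the coefficient
  of \<open>\<alpha>_k \<alpha>_l\<close> in the graph polynomial of \<open>G\<close>, where \<open>{i, j, k, l} = {1, 2, 3, 4}\<close>, and let \<open>p_1\<close>, \<open>p_2\<close>, \<open>p_3\<close> be the values of
  the Dodgson polynomials for \<open>13,24\<close>, \<open>14,23\<close> and \<open>12,34\<close>. If \<open>N_4\<close> is the number of zeros of the
  graph polynomial of \<open>G\<close> in \<open>\<alpha>_1, \<dots>, \<alpha>_4\<close>, and \<open>N_3(i)\<close> that of the graph polynomial of \<open>G\<close> without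
  \<open>e_i\<close> in the other three variables, then, with brackets for indicator functions, modulo \<open>q\<^sup>3\<close>

    \<open>N_4 + \<Sum>_i N_3(i) + q\<^sup>2 [p_1 = p_2 = 0]
      \<equiv> - 2 q [A \<noteq> 0] + q\<^sup>2 (4 + \<Sum>_i [p_i = 0] - \<Sum>_{i<j} [A = f_ij = 0])\<close>

  (\<open>star_cong_all\<close>). The proof is an explicit count. For \<open>A \<noteq> 0\<close> the graph polynomial is \<open>A\<close> times the
  determinant of a symmetric \<open>3 \<times> 3\<close> matrix whose diagonal entries are translates of free variables
  (\<open>generic\<close>). For \<open>A = 0\<close> and \<open>f_12 \<noteq> 0\<close> it is \<open>f_12\<close> times such a \<open>2 \<times> 2\<close> determinant (\<open>rank1\<close>). If
  \<open>A\<close> and all \<open>f_ij\<close> vanish, it is affine linear in \<open>\<alpha>_1, \<dots>, \<alpha>_4\<close>.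

  Summing over \<open>h\<close> gives the theorem, because every term on the right sums to a multiple of \<open>q\<^sup>3\<close>: the
  number of \<open>h\<close> with \<open>A \<noteq> 0\<close> is divisible by \<open>q\<^sup>2\<close>, and the numbers of \<open>h\<close> with \<open>p_i \<noteq> 0\<close>, or with
  \<open>A \<noteq> 0\<close> or \<open>f_ij \<noteq> 0\<close>, are divisible by \<open>q\<close> (\<open>square_dvd_card_fdet_nonzero\<close>,
  \<open>dvd_card_fdet_nonzero\<close>, \<open>dvd_card_fdet_pair_nonzero\<close>). These divisibilities are proved by
  eliminating one edge variable at a time. A single determinant is affine in it, and the resultant of
  a pair \<open>det M[l := unit row]\<close>, \<open>det M\<close> is a square by the Dodgson identity
  (\<open>fdet_plucker\<close>). In the end a matrix with too large a zero block remains.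
\<close>

section \<open>Determinants of matrices given by functions\<close>

text \<open>
  The determinant of the \<open>m \<times> m\<close> matrix with rows \<open>f 0, \<dots>, f (m - 1)\<close>. Matrices are functions of
  two indices, so that a row is replaced by a function update. Values at indices \<open>\<ge> m\<close> are irrelevant.
\<close>

definition fdet :: "nat \<Rightarrow> (nat \<Rightarrow> nat \<Rightarrow> 'a::comm_ring_1) \<Rightarrow> 'a" where
  "fdet m f = (\<Sum>p | p permutes {..<m}. signof p * (\<Prod>i<m. f i (p i)))"

text \<open>
  The unit row at \<open>i\<close>.
\<close>

definition urow :: "nat \<Rightarrow> nat \<Rightarrow> 'a::comm_ring_1" where
  "urow i = (\<lambda>j. of_bool (i = j))"

text \<open>
  Scalar multiplication of rows. Their addition is the pointwise addition of functions.
\<close>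

definition smul :: "'a::comm_ring_1 \<Rightarrow> (nat \<Rightarrow> 'a) \<Rightarrow> nat \<Rightarrow> 'a" where
  "smul c x = (\<lambda>j. c * x j)"

lemma fdet_det: "fdet m f = det (mat m m (\<lambda>(i, j). f i j))"
proof -
  have "det (mat m m (\<lambda>(i, j). f i j)) = (\<Sum>p | p permutes {..<m}. signof p * (\<Prod>i<m. (mat m m (\<lambda>(i, j). f i j)) $$ (i, p i)))"
    by (subst det_def') (auto simp: atLeast0LessThan)
  also have "\<dots> = fdet m f"
    unfolding fdet_def
  proof (intro sum.cong refl arg_cong2[of _ _ _ _ "(*)"] prod.cong)
    fix p i assume "p \<in> {p. p permutes {..<m}}" "i \<in> {..<m}"
    then have "p i < m" by (metis lessThan_iff mem_Collect_eq permutes_in_image)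
    with \<open>i \<in> {..<m}\<close> show "mat m m (\<lambda>(i, j). f i j) $$ (i, p i) = f i (p i)" by simp
  qed
  finally show ?thesis by simp
qed

lemma fdet_cong_prod:
  assumes "\<And>p. p permutes {..<m} \<Longrightarrow> (\<Prod>i<m. f i (p i)) = (\<Prod>i<m. g i (p i))"
  shows "fdet m f = fdet m g"
  unfolding fdet_def by (intro sum.cong) (auto simp: assms)

lemma permutes_lessThan: "p permutes {..<m} \<Longrightarrow> i < m \<Longrightarrow> p i < m"
  by (metis lessThan_iff permutes_in_image)

lemma fdet_cong:
  assumes "\<And>i j. i < m \<Longrightarrow> j < m \<Longrightarrow> f i j = g i j"
  shows "fdet m f = fdet m g"
  by (rule fdet_cong_prod) (simp add: assms permutes_lessThan)

lemma fdet_upd_split: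
  assumes "i < m"
  shows "fdet m (f(i := x)) = (\<Sum>p | p permutes {..<m}. x (p i) * (signof p * (\<Prod>k\<in>{..<m} - {i}. f k (p k))))"
  unfolding fdet_def
proof (intro sum.cong refl)
  fix p
  have "(\<Prod>k<m. (f(i := x)) k (p k)) = x (p i) * (\<Prod>k\<in>{..<m} - {i}. (f(i := x)) k (p k))"
    using assms by (subst prod.remove[of _ i]) auto
  also have "(\<Prod>k\<in>{..<m} - {i}. (f(i := x)) k (p k)) = (\<Prod>k\<in>{..<m} - {i}. f k (p k))"
    by (intro prod.cong) auto
  finally show "signof p * (\<Prod>k<m. (f(i := x)) k (p k)) = x (p i) * (signof p * (\<Prod>k\<in>{..<m} - {i}. f k (p k)))"
    by (simp add: mult_ac)
qed

lemma fdet_row_add: "i < m \<Longrightarrow> fdet m (f(i := x + y)) = fdet m (f(i := x)) + fdet m (f(i := y))"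
  by (simp add: fdet_upd_split sum.distrib[symmetric] algebra_simps)

lemma fdet_row_smul: "i < m \<Longrightarrow> fdet m (f(i := smul c x)) = c * fdet m (f(i := x))"
  by (simp add: fdet_upd_split sum_distrib_left smul_def mult_ac)

lemma fdet_row_sum: "i < m \<Longrightarrow> fdet m (f(i := (\<lambda>j. \<Sum>k\<in>K. x k j))) = (\<Sum>k\<in>K. fdet m (f(i := x k)))"
  by (simp add: fdet_upd_split sum_distrib_right sum.swap[of _ K])

lemma fdet_row_zero:
  assumes "i < m" "\<And>j. j < m \<Longrightarrow> f i j = 0"
  shows "fdet m f = 0"
  unfolding fdet_def
proof (intro sum.neutral ballI)
  fix p assume "p \<in> {p. p permutes {..<m}}"
  then have "f i (p i) = 0" using assms by (simp add: permutes_lessThan)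
  then have "(\<Prod>i<m. f i (p i)) = 0" using assms(1) by (intro prod_zero) auto
  then show "signof p * (\<Prod>i<m. f i (p i)) = 0" by simp
qed

lemma fdet_same:
  assumes "i \<noteq> j" "i < m" "j < m" "\<And>k. k < m \<Longrightarrow> f i k = f j k"
  shows "fdet m f = 0"
  unfolding fdet_det
  by (rule det_identical_rows[of _ m i j]) (use assms in \<open>auto intro!: eq_vecI\<close>)

lemma fdet_swap:
  assumes "i \<noteq> j" "i < m" "j < m"
  shows "fdet m (f(i := x, j := y)) = - fdet m (f(i := y, j := x))"
proof -
  have z: "fdet m (f(i := z, j := z)) = 0" for z
    by (rule fdet_same[OF assms]) (use assms in auto)
  have "0 = fdet m (f(i := x + y, j := x + y))" by (simp only: z)
  also have "\<dots> = fdet m (f(i := x + y, j := x)) + fdet m (f(i := x + y, j := y))"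
    by (rule fdet_row_add) fact
  also have "\<dots> = fdet m (f(j := x, i := x + y)) + fdet m (f(j := y, i := x + y))"
    using assms by (simp add: fun_upd_twist)
  also have "\<dots> = fdet m (f(j := x, i := x)) + fdet m (f(j := x, i := y)) + (fdet m (f(j := y, i := x)) + fdet m (f(j := y, i := y)))"
    by (simp only: fdet_row_add[OF assms(2)])
  also have "\<dots> = fdet m (f(i := x, j := x)) + fdet m (f(i := y, j := x)) + (fdet m (f(i := x, j := y)) + fdet m (f(i := y, j := y)))"
    using assms by (simp add: fun_upd_twist)
  finally show ?thesis by (simp add: z eq_neg_iff_add_eq_0 add.commute)
qed

lemma fdet_transpose: "fdet m (\<lambda>i j. f j i) = fdet m f"
proof -
  have "mat m m (\<lambda>(i, j). f j i) = (mat m m (\<lambda>(i, j). f i j))\<^sup>T" by (intro eq_matI) auto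
  then show ?thesis unfolding fdet_det by (simp add: det_transpose[of _ m])
qed

text \<open>
  Cramer's rule: it writes a multiple of an arbitrary row \<open>z\<close> as a linear combination of the rows of \<open>f\<close>.
\<close>

lemma fdet_cramer:
  assumes j: "j < m"
  shows "fdet m f * z j = (\<Sum>k<m. fdet m (f(k := z)) * f k j)"
proof -
  let ?A = "mat m m (\<lambda>(i, j). f i j)"
  have A: "?A \<in> carrier_mat m m" by simp
  have c: "fdet m (f(k := z)) = (\<Sum>l<m. z l * cofactor ?A k l)" if k: "k < m" for k
  proof -
    have "cofactor (mat m m (\<lambda>(i, j). (f(k := z)) i j)) k l = cofactor ?A k l" if "l < m" for l
    proof -
      have "mat_delete (mat m m (\<lambda>(i, j). (f(k := z)) i j)) k l = mat_delete ?A k l"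
        by (intro eq_matI) (auto simp: mat_delete_def)
      then show ?thesis by (simp add: cofactor_def)
    qed
    then show ?thesis
      unfolding fdet_det using k
      by (subst laplace_expansion_row[of _ m k]) (auto intro!: sum.cong simp del: fun_upd_apply, simp)
  qed
  have "(\<Sum>k<m. fdet m (f(k := z)) * f k j) = (\<Sum>k<m. \<Sum>l<m. z l * (cofactor ?A k l * f k j))"
    by (intro sum.cong refl) (simp only: lessThan_iff c sum_distrib_left mult_ac)
  also have "\<dots> = (\<Sum>l<m. z l * (\<Sum>k<m. cofactor ?A k l * f k j))"
    by (subst sum.swap) (simp add: sum_distrib_left)
  also have "\<dots> = (\<Sum>l<m. z l * (adj_mat ?A * ?A) $$ (l, j))"
    using j by (intro sum.cong refl)
      (auto simp: adj_mat_def times_mat_def scalar_prod_def atLeast0LessThan)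
  also have "\<dots> = (\<Sum>l<m. if l = j then z l * fdet m f else 0)"
    using j by (intro sum.cong refl) (auto simp: adj_mat(3)[OF A] fdet_det)
  also have "\<dots> = fdet m f * z j" using j by (simp add: mult.commute)
  finally show ?thesis by simp
qed

text \<open>
  The three-term Pluecker relation. For unit rows \<open>x\<close>, \<open>y\<close> at \<open>i\<close>, \<open>j\<close> this is the Dodgson identity for
  the \<open>2 \<times> 2\<close> minors of the adjugate matrix.
\<close>

lemma fdet_plucker:
  assumes ij: "i \<noteq> j" "i < m" "j < m"
  shows "fdet m f * fdet m (f(i := x, j := y)) =
         fdet m (f(i := x)) * fdet m (f(j := y)) - fdet m (f(i := y)) * fdet m (f(j := x))"
proof -
  let ?g = "f(i := x)"
  have "fdet m f * fdet m (?g(j := y)) = fdet m (?g(j := smul (fdet m f) y))"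
    using ij by (simp add: fdet_row_smul)
  also have "\<dots> = fdet m (?g(j := (\<lambda>l. \<Sum>k<m. smul (fdet m (f(k := y))) (f k) l)))"
    by (rule fdet_cong) (simp add: smul_def fdet_cramer)
  also have "\<dots> = (\<Sum>k<m. fdet m (f(k := y)) * fdet m (?g(j := f k)))"
    using ij by (simp add: fdet_row_sum fdet_row_smul)
  also have "\<dots> = (\<Sum>k\<in>{i, j}. fdet m (f(k := y)) * fdet m (?g(j := f k)))"
  proof (rule sum.mono_neutral_right)
    show "\<forall>k\<in>{..<m} - {i, j}. fdet m (f(k := y)) * fdet m (?g(j := f k)) = 0"
    proof
      fix k assume "k \<in> {..<m} - {i, j}"
      then have "fdet m (?g(j := f k)) = 0"
        using ij by (intro fdet_same[of j k]) auto
      then show "fdet m (f(k := y)) * fdet m (?g(j := f k)) = 0" by simp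
    qed
  qed (use ij in auto)
  also have "\<dots> = fdet m (f(i := y)) * fdet m (?g(j := f i)) + fdet m (f(j := y)) * fdet m (?g(j := f j))"
    using ij by simp
  finally have "fdet m f * fdet m (?g(j := y)) = fdet m (f(i := y)) * fdet m (?g(j := f i)) + fdet m (f(j := y)) * fdet m (?g(j := f j))" .
  moreover have "fdet m (?g(j := f i)) = - fdet m (f(j := x))"
    using fdet_swap[OF ij, of f x "f i"] by simp
  moreover have "?g(j := f j) = f(i := x)" using ij by auto
  ultimately show ?thesis by (simp only: mult_minus_right) (simp add: mult.commute)
qed

lemma fdet_eq_0_iff_col:
  fixes f :: "nat \<Rightarrow> nat \<Rightarrow> 'a::field"
  shows "fdet m f = 0 \<longleftrightarrow> (\<exists>x. (\<exists>j<m. x j \<noteq> 0) \<and> (\<forall>i<m. (\<Sum>j<m. f i j * x j) = 0))"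
    (is "_ \<longleftrightarrow> ?R")
proof -
  let ?A = "mat m m (\<lambda>(i, j). f i j)"
  have "fdet m f = 0 \<longleftrightarrow> (\<exists>v. v \<in> carrier_vec m \<and> v \<noteq> 0\<^sub>v m \<and> ?A *\<^sub>v v = 0\<^sub>v m)"
    unfolding fdet_det by (rule det_0_iff_vec_prod_zero[of _ m]) simp
  also have "\<dots> \<longleftrightarrow> ?R"
  proof
    assume "\<exists>v. v \<in> carrier_vec m \<and> v \<noteq> 0\<^sub>v m \<and> ?A *\<^sub>v v = 0\<^sub>v m"
    then obtain v where v: "v \<in> carrier_vec m" "v \<noteq> 0\<^sub>v m" "?A *\<^sub>v v = 0\<^sub>v m" by blast
    have "\<exists>j<m. v $ j \<noteq> 0"
    proof (rule ccontr)
      assume "\<not> ?thesis"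
      then have "v = 0\<^sub>v m" using v(1) by (intro eq_vecI) auto
      with v(2) show False by simp
    qed
    moreover have "(\<Sum>j<m. f i j * v $ j) = 0" if "i < m" for i
    proof -
      have "(?A *\<^sub>v v) $ i = 0" using v(3) that by simp
      then show ?thesis using that v(1) by (simp add: mult_mat_vec_def scalar_prod_def atLeast0LessThan)
    qed
    ultimately show ?R by (intro exI[of _ "\<lambda>j. v $ j"]) auto
  next
    assume ?R
    then obtain x where x: "\<exists>j<m. x j \<noteq> 0" "\<forall>i<m. (\<Sum>j<m. f i j * x j) = 0" by blast
    have "vec m x \<noteq> 0\<^sub>v m" using x(1) by (metis index_vec index_zero_vec(1))
    moreover have "?A *\<^sub>v vec m x = 0\<^sub>v m"
      using x(2) by (intro eq_vecI) (auto simp: mult_mat_vec_def scalar_prod_def atLeast0LessThan)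
    ultimately show "\<exists>v. v \<in> carrier_vec m \<and> v \<noteq> 0\<^sub>v m \<and> ?A *\<^sub>v v = 0\<^sub>v m" by (intro exI[of _ "vec m x"]) auto
  qed
  finally show ?thesis .
qed

lemma fdet_zero_col:
  fixes f :: "nat \<Rightarrow> nat \<Rightarrow> 'a::field"
  assumes "j < m" "x j \<noteq> 0" "\<And>i. i < m \<Longrightarrow> (\<Sum>j<m. f i j * x j) = 0"
  shows "fdet m f = 0"
  using assms fdet_eq_0_iff_col by blast

lemma fdet_zero_row:
  fixes f :: "nat \<Rightarrow> nat \<Rightarrow> 'a::field"
  assumes "i < m" "x i \<noteq> 0" "\<And>j. j < m \<Longrightarrow> (\<Sum>i<m. x i * f i j) = 0"
  shows "fdet m f = 0"
proof -
  have "fdet m (\<lambda>i j. f j i) = 0"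
    by (rule fdet_zero_col[of i m x]) (use assms in \<open>simp_all add: mult.commute\<close>)
  then show ?thesis using fdet_transpose[of m f] by simp
qed

lemma fdet_zero_block:
  assumes "R \<subseteq> {..<m}" "C \<subseteq> {..<m}" "card R + card C > m"
    and z: "\<And>i j. i \<in> R \<Longrightarrow> j \<in> C \<Longrightarrow> f i j = 0"
  shows "fdet m f = 0"
  unfolding fdet_def
proof (intro sum.neutral ballI)
  fix p assume "p \<in> {p. p permutes {..<m}}"
  then have p: "p permutes {..<m}" by simp
  have "p ` R \<inter> C \<noteq> {}"
  proof
    assume "p ` R \<inter> C = {}"
    moreover have "p ` R \<subseteq> {..<m}" using assms(1) permutes_image[OF p] by blast
    moreover have "finite R" "finite C" using assms(1,2) by (auto intro: finite_subset)
    ultimately have "card (p ` R) + card C \<le> m"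
      using assms(2) card_mono[of "{..<m}" "p ` R \<union> C"] by (simp add: card_Un_disjoint)
    moreover have "card (p ` R) = card R"
      using permutes_inj[OF p] by (simp add: card_image inj_on_subset)
    ultimately show False using assms(3) by simp
  qed
  then obtain i where "i \<in> R" "p i \<in> C" by blast
  then have "(\<Prod>i<m. f i (p i)) = 0" using z assms(1) by (intro prod_zero) auto
  then show "signof p * (\<Prod>i<m. f i (p i)) = 0" by simp
qed

text \<open>
  Unit rows single out the permutations with prescribed values.
\<close>

lemma fdet_unit_rows:
  assumes "I \<subseteq> {..<m}"
  shows "fdet m (\<lambda>i. if i \<in> I then urow (\<pi> i) else B i) =
    (\<Sum>p | p permutes {..<m} \<and> (\<forall>i\<in>I. p i = \<pi> i). signof p * (\<Prod>i\<in>{..<m} - I. B i (p i)))"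
proof -
  have *: "(\<Prod>i<m. (if i \<in> I then urow (\<pi> i) else B i) (p i)) =
    (if \<forall>i\<in>I. p i = \<pi> i then \<Prod>i\<in>{..<m} - I. B i (p i) else 0)" for p
  proof -
    have fin: "finite I" using assms finite_subset by blast
    have "(\<Prod>i<m. (if i \<in> I then urow (\<pi> i) else B i) (p i)) =
      (\<Prod>i\<in>{..<m} - I. (if i \<in> I then urow (\<pi> i) else B i) (p i)) * (\<Prod>i\<in>I. (if i \<in> I then urow (\<pi> i) else B i) (p i))"
      by (rule prod.subset_diff) (use assms in auto)
    also have "(\<Prod>i\<in>I. (if i \<in> I then urow (\<pi> i) else B i) (p i)) = of_bool (\<forall>i\<in>I. p i = \<pi> i)"
    proof (cases "\<forall>i\<in>I. p i = \<pi> i")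
      case True then show ?thesis by (simp add: urow_def)
    next
      case False
      then obtain i where "i \<in> I" "p i \<noteq> \<pi> i" by blast
      with fin False show ?thesis
        by (subst prod_zero) (auto simp: urow_def intro!: bexI[of _ i])
    qed
    finally show ?thesis by (auto intro!: prod.cong)
  qed
  have "fdet m (\<lambda>i. if i \<in> I then urow (\<pi> i) else B i) = (\<Sum>p | p permutes {..<m}. if \<forall>i\<in>I. p i = \<pi> i then signof p * (\<Prod>i\<in>{..<m} - I. B i (p i)) else 0)"
    unfolding fdet_def * by (intro sum.cong) auto
  also have "\<dots> = (\<Sum>p\<in>{p. p permutes {..<m}} \<inter> {p. \<forall>i\<in>I. p i = \<pi> i}. signof p * (\<Prod>i\<in>{..<m} - I. B i (p i)))"
    by (simp add: finite_permutations sum.If_cases)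
  finally show ?thesis by (simp add: Collect_conj_eq)
qed

text \<open>
  A minor of a symmetric matrix equals the transposed minor: the removed rows are in \<open>I\<close> and the
  removed columns in \<open>\<pi> ` I\<close>. Inversion of permutations exchanges the two sides.
\<close>

lemma fdet_unit_rows_sym:
  assumes I: "I \<subseteq> {..<m}" and pi: "\<pi> ` I \<subseteq> {..<m}" and rho: "\<And>i. i \<in> I \<Longrightarrow> \<rho> (\<pi> i) = i"
    and sym: "\<And>i j. i < m \<Longrightarrow> j < m \<Longrightarrow> B i j = B j i"
  shows "fdet m (\<lambda>i. if i \<in> I then urow (\<pi> i) else B i) = fdet m (\<lambda>i. if i \<in> \<pi> ` I then urow (\<rho> i) else B i)"
proof -
  have "(\<Sum>p | p permutes {..<m} \<and> (\<forall>i\<in>I. p i = \<pi> i). signof p * (\<Prod>i\<in>{..<m} - I. B i (p i)))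
    = (\<Sum>p | p permutes {..<m} \<and> (\<forall>i\<in>\<pi> ` I. p i = \<rho> i). signof p * (\<Prod>i\<in>{..<m} - \<pi> ` I. B i (p i)))"
  proof (rule sum.reindex_bij_witness[of _ Hilbert_Choice.inv Hilbert_Choice.inv])
    fix p assume p: "p \<in> {p. p permutes {..<m} \<and> (\<forall>i\<in>I. p i = \<pi> i)}"
    then have pp: "p permutes {..<m}" by simp
    show "Hilbert_Choice.inv (Hilbert_Choice.inv p) = p" using pp by (rule permutes_inv_inv)
    show "Hilbert_Choice.inv p \<in> {p. p permutes {..<m} \<and> (\<forall>i\<in>\<pi> ` I. p i = \<rho> i)}"
      using p by (auto simp: permutes_inv rho permutes_inverses(2)[OF pp] permutes_inv_eq[OF pp])
    have s: "(signof (Hilbert_Choice.inv p) :: 'a) = signof p"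
      by (rule signof_inv[OF _ pp]) simp
    have im: "p ` ({..<m} - I) = {..<m} - \<pi> ` I"
    proof -
      have "p ` I = \<pi> ` I" using p by auto
      then show ?thesis
        using permutes_image[OF pp] by (simp add: image_set_diff[OF permutes_inj[OF pp]])
    qed
    have "(\<Prod>i\<in>{..<m} - \<pi> ` I. B i (Hilbert_Choice.inv p i)) = (\<Prod>i\<in>{..<m} - I. B (p i) (Hilbert_Choice.inv p (p i)))"
      unfolding im[symmetric]
      by (subst prod.reindex) (use permutes_inj[OF pp] in \<open>auto intro: inj_on_subset\<close>)
    also have "\<dots> = (\<Prod>i\<in>{..<m} - I. B i (p i))"
      by (intro prod.cong refl) (simp add: permutes_inverses[OF pp] permutes_lessThan[OF pp] sym)
    finally show "signof (Hilbert_Choice.inv p) * (\<Prod>i\<in>{..<m} - \<pi> ` I. B i (Hilbert_Choice.inv p i)) = signof p * (\<Prod>i\<in>{..<m} - I. B i (p i))"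
      using s by simp
  next
    fix p assume p: "p \<in> {p. p permutes {..<m} \<and> (\<forall>i\<in>\<pi> ` I. p i = \<rho> i)}"
    then have pp: "p permutes {..<m}" by simp
    show "Hilbert_Choice.inv (Hilbert_Choice.inv p) = p" using pp by (rule permutes_inv_inv)
    show "Hilbert_Choice.inv p \<in> {p. p permutes {..<m} \<and> (\<forall>i\<in>I. p i = \<pi> i)}"
      using p by (auto simp: permutes_inv rho permutes_inv_eq[OF pp])
  qed
  then show ?thesis
    by (simp only: fdet_unit_rows[OF I] fdet_unit_rows[OF pi])
qed

section \<open>Divisibility of point counts of determinants\<close>

text \<open>
  The affine space with coordinates \<open>J\<close>. The other coordinates are fixed to \<open>0\<close>, so that spaces for
  different \<open>J\<close> live in the same type.
\<close>

definition pts :: "nat set \<Rightarrow> (nat \<Rightarrow> 'k::zero) set" where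
  "pts J = {a. \<forall>i. i \<notin> J \<longrightarrow> a i = 0}"

text \<open>
  The minor with the rows and columns in \<open>S\<close> removed, as a matrix of unchanged size.
\<close>

definition units_on :: "nat set \<Rightarrow> (nat \<Rightarrow> nat \<Rightarrow> 'a::comm_ring_1) \<Rightarrow> nat \<Rightarrow> nat \<Rightarrow> 'a" where
  "units_on S f = (\<lambda>i. if i \<in> S then urow i else f i)"

text \<open>
  The variables \<open>a\<close> are added on the diagonal.
\<close>

definition add_diag :: "(nat \<Rightarrow> nat \<Rightarrow> 'a::comm_ring_1) \<Rightarrow> (nat \<Rightarrow> 'a) \<Rightarrow> nat \<Rightarrow> nat \<Rightarrow> 'a" where
  "add_diag f a = (\<lambda>i. f i + smul (a i) (urow i))"

lemma pts_empty: "pts {} = {\<lambda>_. 0}"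
  by (auto simp: pts_def)

lemma bij_betw_pts_insert:
  assumes "x \<notin> J"
  shows "bij_betw (\<lambda>(b, t). b(x := t)) (SIGMA b:pts J. {t. P (b(x := t))}) {a \<in> pts (insert x J). P a}"
  by (rule bij_betw_byWitness[of _ "\<lambda>a. (a(x := 0), a x)"])
    (use assms in \<open>auto simp: pts_def fun_eq_iff\<close>)

lemma finite_pts: "finite J \<Longrightarrow> finite (pts J :: (nat \<Rightarrow> 'k::{finite,zero}) set)"
proof (induction J rule: finite_induct)
  case (insert x J)
  from bij_betw_finite[OF bij_betw_pts_insert[OF insert(2), of "\<lambda>_::nat \<Rightarrow> 'k. True"]] insert(3)
  show ?case by simp
qed (simp add: pts_empty)

lemma card_pts_insert:
  fixes P :: "(nat \<Rightarrow> 'k::{finite,zero}) \<Rightarrow> bool"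
  assumes "x \<notin> J" "finite J"
  shows "int (card {a \<in> pts (insert x J). P a}) = (\<Sum>b\<in>pts J. int (card {t. P (b(x := t))}))"
proof -
  have "card {a \<in> pts (insert x J). P a} = card (SIGMA b:pts J. {t. P (b(x := t))})"
    by (rule bij_betw_same_card[OF bij_betw_pts_insert[OF assms(1)], symmetric])
  also have "\<dots> = (\<Sum>b\<in>pts J. card {t. P (b(x := t))})"
    by (rule card_SigmaI) (auto simp: finite_pts assms)
  finally show ?thesis by simp
qed

lemma card_pts: "finite J \<Longrightarrow> card (pts J :: (nat \<Rightarrow> 'k::{finite,zero}) set) = CARD('k) ^ card J"
proof (induction J rule: finite_induct)
  case (insert x J)
  from card_pts_insert[OF insert(2,1), of "\<lambda>_::nat \<Rightarrow> 'k. True"] insert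
  show ?case by (simp flip: of_nat_mult of_nat_power)
qed (simp add: pts_empty)

lemma sum_of_bool: "finite A \<Longrightarrow> (\<Sum>a\<in>A. of_bool (P a)) = (int (card {a \<in> A. P a}))"
  by (simp add: of_bool_def sum.If_cases Int_def)

lemma card_affine_nonzero:
  fixes k c :: "'k::{finite,field}"
  shows "int (card {t. t * k + c \<noteq> 0}) = int CARD('k) * of_bool (k \<noteq> 0 \<or> c \<noteq> 0) - of_bool (k \<noteq> 0)"
proof (cases "k = 0")
  case False
  then have "{t. t * k + c \<noteq> 0} = UNIV - {- c / k}"
    by (auto simp: field_simps add_eq_0_iff2)
  then show ?thesis using False
    by (simp add: card_Diff_singleton Suc_leI)
qed auto

text \<open>
  Elimination of a variable from two affine polynomials. The number of common zeros is governed by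
  the resultant \<open>k * c' - c * k'\<close>.
\<close>

lemma card_affine_pair_nonzero:
  fixes k c k' c' :: "'k::{finite,field}"
  shows "int (card {t. t * k + c \<noteq> 0 \<or> t * k' + c' \<noteq> 0}) =
    int CARD('k) * of_bool (k \<noteq> 0 \<or> c \<noteq> 0 \<or> k' \<noteq> 0 \<or> c' \<noteq> 0)
      - of_bool (k \<noteq> 0 \<or> k' \<noteq> 0) + of_bool (k * c' - c * k' \<noteq> 0)"
proof -
  have *: "int (card (UNIV - {t::'k})) = int CARD('k) - 1" for t
    by (simp add: card_Diff_singleton Suc_leI)
  consider "k = 0" "k' = 0" | "k \<noteq> 0" | "k = 0" "k' \<noteq> 0" by blast
  then show ?thesis
  proof cases
    case 1 then show ?thesis by auto
  next
    case 2
    have "t * k + c \<noteq> 0 \<or> t * k' + c' \<noteq> 0 \<longleftrightarrow> t \<noteq> - c / k \<or> k * c' - c * k' \<noteq> 0" for t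
    proof -
      have "t * k + c = 0 \<longleftrightarrow> t = - c / k" using 2 by (auto simp: field_simps add_eq_0_iff2)
      moreover have "(- c / k) * k' + c' = (k * c' - c * k') / k" using 2 by (simp add: field_simps)
      ultimately show ?thesis using 2 by (cases "t = - c / k") auto
    qed
    then have "{t. t * k + c \<noteq> 0 \<or> t * k' + c' \<noteq> 0} = (if k * c' - c * k' \<noteq> 0 then UNIV else UNIV - {- c / k})"
      by auto
    with 2 * show ?thesis by simp
  next
    case 3
    have "t * k + c \<noteq> 0 \<or> t * k' + c' \<noteq> 0 \<longleftrightarrow> t \<noteq> - c' / k' \<or> k * c' - c * k' \<noteq> 0" for t
    proof -
      have "t * k' + c' = 0 \<longleftrightarrow> t = - c' / k'" using 3 by (auto simp: field_simps add_eq_0_iff2)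
      then show ?thesis using 3 by auto
    qed
    then have "{t. t * k + c \<noteq> 0 \<or> t * k' + c' \<noteq> 0} = (if k * c' - c * k' \<noteq> 0 then UNIV else UNIV - {- c' / k'})"
      by auto
    with 3 * show ?thesis by simp
  qed
qed

lemma add_diag_upd:
  assumes "a x = 0"
  shows "add_diag f (a(x := t)) = (add_diag f a)(x := f x + smul t (urow x))"
    "(add_diag f a)(x := z) = add_diag (f(x := z)) a"
    "add_diag f a x = f x"
  using assms by (auto simp: add_diag_def fun_eq_iff smul_def)

lemma fdet_add_diag_upd:
  assumes "x < m" "a x = 0"
  shows "fdet m (add_diag f (a(x := t))) = t * fdet m (add_diag (f(x := urow x)) a) + fdet m (add_diag f a)"
proof -
  have "fdet m (add_diag f (a(x := t))) = fdet m ((add_diag f a)(x := f x)) + t * fdet m ((add_diag f a)(x := urow x))"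
    by (simp only: add_diag_upd(1)[of a x, OF assms(2)] fdet_row_add[OF assms(1)] fdet_row_smul[OF assms(1)])
  then show ?thesis using assms by (simp add: add_diag_upd)
qed

lemma card_insert_fdet_nonzero:
  fixes f :: "nat \<Rightarrow> nat \<Rightarrow> 'k::{finite,field}"
  assumes x: "x < m" "x \<notin> J" "finite J"
  shows "int (card {a \<in> pts (insert x J). fdet m (add_diag f a) \<noteq> 0}) =
    int CARD('k) * int (card {a \<in> pts J. fdet m (add_diag f a) \<noteq> 0 \<or> fdet m (add_diag (f(x := urow x)) a) \<noteq> 0})
    - int (card {a \<in> pts J. fdet m (add_diag (f(x := urow x)) a) \<noteq> 0})"
proof -
  have "int (card {a \<in> pts (insert x J). fdet m (add_diag f a) \<noteq> 0}) =
      (\<Sum>b\<in>pts J. int (card {t. t * fdet m (add_diag (f(x := urow x)) b) + fdet m (add_diag f b) \<noteq> 0}))"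
  proof (subst card_pts_insert[OF x(2,3)], intro sum.cong refl)
    fix b :: "nat \<Rightarrow> 'k" assume "b \<in> pts J"
    then have "b x = 0" using x by (auto simp: pts_def)
    then show "int (card {t. fdet m (add_diag f (b(x := t))) \<noteq> 0}) =
      int (card {t. t * fdet m (add_diag (f(x := urow x)) b) + fdet m (add_diag f b) \<noteq> 0})"
      using x by (simp add: fdet_add_diag_upd)
  qed
  also have "\<dots> = int CARD('k) * (\<Sum>b\<in>pts J. of_bool (fdet m (add_diag f b) \<noteq> 0 \<or> fdet m (add_diag (f(x := urow x)) b) \<noteq> 0))
       - (\<Sum>b\<in>pts J. of_bool (fdet m (add_diag (f(x := urow x)) b) \<noteq> 0))"
    by (simp only: card_affine_nonzero sum_subtractf sum_distrib_left disj_commute)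
  finally show ?thesis by (simp only: sum_of_bool[OF finite_pts[OF x(3)]])
qed

lemma fdet_zero_block_rows:
  assumes "C \<subseteq> {..<m}" "finite R" "card R < card C"
    and "\<And>i j. i < m \<Longrightarrow> i \<notin> R \<Longrightarrow> j \<in> C \<Longrightarrow> f i j = 0"
  shows "fdet m f = 0"
proof (rule fdet_zero_block[of "{..<m} - R" m C])
  have "card {..<m} - card R \<le> card ({..<m} - R)" by (rule diff_card_le_card_Diff) fact
  moreover have "card C \<le> m" using assms(1) card_mono[of "{..<m}" C] by simp
  ultimately show "m < card ({..<m} - R) + card C" using assms(3) by simp
qed (use assms in auto)

text \<open>
  In the columns \<open>C\<close> all rows outside \<open>J\<close> and \<open>R\<close> vanish. After elimination of the variables in \<open>J\<close> the
  rows in \<open>J\<close> are unit rows, which vanish there too, and the matrix is singular as \<open>card R < card C\<close>.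
\<close>

lemma dvd_card_fdet_nonzero:
  fixes f :: "nat \<Rightarrow> nat \<Rightarrow> 'k::{finite,field}"
  assumes "finite J" "J \<subseteq> {..<m}" "C \<subseteq> {..<m}" "J \<inter> C = {}" "finite R" "card R < card C"
    and "\<And>i j. i < m \<Longrightarrow> i \<notin> J \<Longrightarrow> i \<notin> R \<Longrightarrow> j \<in> C \<Longrightarrow> f i j = 0"
  shows "int CARD('k) dvd int (card {a \<in> pts J. fdet m (add_diag f a) \<noteq> 0})"
  using assms(1,2,4,7)
proof (induction J arbitrary: f rule: finite_induct)
  case empty
  have "fdet m (add_diag f (\<lambda>_. 0)) = 0"
    by (rule fdet_zero_block_rows[OF assms(3,5,6)]) (use empty in \<open>auto simp: add_diag_def smul_def\<close>)
  then show ?case by (simp add: pts_empty cong: conj_cong)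
next
  case (insert x J)
  have "int CARD('k) dvd int (card {a \<in> pts J. fdet m (add_diag (f(x := urow x)) a) \<noteq> 0})"
    by (rule insert.IH) (use insert.prems in \<open>auto simp: urow_def\<close>)
  then show ?case
    using insert by (subst card_insert_fdet_nonzero) auto
qed

lemma units_on_upd: "x \<notin> S \<Longrightarrow> (units_on S g)(x := urow x) = units_on (insert x S) g"
  by (auto simp: units_on_def)

lemma add_diag_units_on:
  "(\<And>i. i \<in> S \<Longrightarrow> a i = 0) \<Longrightarrow> add_diag (units_on S g) a = units_on S (add_diag g a)"
  by (auto simp: add_diag_def units_on_def fun_eq_iff smul_def)

lemma fdet_units_sym1:
  assumes "S \<subseteq> {..<m}" "x < m" "y < m" "x \<notin> S" "y \<notin> S"
    and "\<And>i j. i < m \<Longrightarrow> j < m \<Longrightarrow> B i j = B j i"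
  shows "fdet m ((units_on S B)(x := urow y)) = fdet m ((units_on S B)(y := urow x))"
proof -
  have "(units_on S B)(x := urow y) = (\<lambda>i. if i \<in> insert x S then urow ((id(x := y)) i) else B i)"
    using assms by (auto simp: units_on_def)
  moreover have im: "(id(x := y)) ` insert x S = insert y S" using assms by auto
  have "fdet m (\<lambda>i. if i \<in> insert x S then urow ((id(x := y)) i) else B i) =
     fdet m (\<lambda>i. if i \<in> (id(x := y)) ` insert x S then urow ((id(y := x)) i) else B i)"
    by (rule fdet_unit_rows_sym) (use assms in auto)
  moreover have "(\<lambda>i. if i \<in> insert y S then urow ((id(y := x)) i) else B i) = (units_on S B)(y := urow x)"
    using assms by (auto simp: units_on_def)
  ultimately show ?thesis by (simp only: im)
qed

lemma add_diag_sym: "B i j = B j i \<Longrightarrow> add_diag B a i j = add_diag B a j i"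
  by (auto simp: add_diag_def smul_def urow_def)

text \<open>
  The pair of \<open>det M\<close> and \<open>det M[y := unit row]\<close>. Eliminating the variable at \<open>x\<close>, the resultant is the
  square of the minor with row \<open>x\<close> and column \<open>y\<close> removed, where row \<open>y\<close> is no longer a unit row.
  Therefore \<open>R\<close> is enlarged by \<open>y\<close>, and the bound on \<open>card C\<close> exceeds by one the one for a
  single determinant.
\<close>

lemma dvd_card_fdet_pair_nonzero:
  fixes g :: "nat \<Rightarrow> nat \<Rightarrow> 'k::{finite,field}"
  assumes "finite J" "J \<subseteq> {..<m}" "C \<subseteq> {..<m}" "J \<inter> C = {}" "finite R" "card R + 1 < card C"
    and y: "y < m" "y \<notin> C"
    and sym: "\<And>i j. i < m \<Longrightarrow> j < m \<Longrightarrow> g i j = g j i"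
    and "S \<subseteq> {..<m}" "S \<inter> J = {}" "y \<notin> J" "y \<notin> S" "S \<inter> C = {}"
    and "\<And>i j. i < m \<Longrightarrow> i \<notin> J \<Longrightarrow> i \<notin> R \<Longrightarrow> i \<noteq> y \<Longrightarrow> i \<notin> S \<Longrightarrow> j \<in> C \<Longrightarrow> g i j = 0"
  shows "int CARD('k) dvd int (card {a \<in> pts J.
     fdet m (add_diag (units_on S g) a) \<noteq> 0 \<or> fdet m (add_diag ((units_on S g)(y := urow y)) a) \<noteq> 0})"
  using assms(1,2,4,10-15)
proof (induction J arbitrary: S rule: finite_induct)
  case empty
  have R: "card (insert y R) < card C" using assms(5,6) by (simp add: card_insert_if)
  have "fdet m (units_on S g) = 0"
    by (rule fdet_zero_block_rows[OF assms(3) _ R]) (use empty assms(5) in \<open>auto simp: units_on_def urow_def\<close>)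
  moreover have "fdet m ((units_on S g)(y := urow y)) = 0"
    by (rule fdet_zero_block_rows[OF assms(3) _ R]) (use empty assms(5) y in \<open>auto simp: units_on_def urow_def\<close>)
  moreover have "add_diag f (\<lambda>_. 0) = f" for f :: "nat \<Rightarrow> nat \<Rightarrow> 'k"
    by (auto simp: add_diag_def smul_def fun_eq_iff)
  ultimately show ?case by (simp add: pts_empty cong: conj_cong del: fun_upd_apply)
next
  case (insert x J)
  let ?f = "units_on S g"
  let ?D = "\<lambda>f b. fdet m (add_diag f b)"
  have xS: "x \<notin> S" "x \<noteq> y" "x < m" using insert.prems by auto
  have fin: "finite J" by fact
  have J: "\<And>b :: nat \<Rightarrow> 'k. b \<in> pts J \<Longrightarrow> b x = 0 \<and> b y = 0 \<and> (\<forall>i\<in>S. b i = 0)"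
    using insert by (auto simp: pts_def)
  have "int (card {a \<in> pts (insert x J). ?D ?f a \<noteq> 0 \<or> ?D (?f(y := urow y)) a \<noteq> 0}) =
    (\<Sum>b\<in>pts J. int CARD('k) * of_bool (?D (?f(x := urow x)) b \<noteq> 0 \<or> ?D ?f b \<noteq> 0 \<or>
           ?D (?f(y := urow y, x := urow x)) b \<noteq> 0 \<or> ?D (?f(y := urow y)) b \<noteq> 0)
       - of_bool (?D (?f(x := urow x)) b \<noteq> 0 \<or> ?D (?f(y := urow y, x := urow x)) b \<noteq> 0)
       + of_bool (?D (?f(x := urow y)) b \<noteq> 0))" (is "_ = (\<Sum>b\<in>pts J. ?T b)")
  proof (subst card_pts_insert[OF insert(2,1)], intro sum.cong refl)
    fix b :: "nat \<Rightarrow> 'k" assume "b \<in> pts J"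
    note b = J[OF this]
    have d: "?D ?f (b(x := t)) = t * ?D (?f(x := urow x)) b + ?D ?f b"
      "?D (?f(y := urow y)) (b(x := t)) = t * ?D (?f(y := urow y, x := urow x)) b + ?D (?f(y := urow y)) b" for t
      using xS b by (simp_all add: fdet_add_diag_upd)
    let ?F = "add_diag ?f b"
    have F: "add_diag (?f(x := z)) b = ?F(x := z)" "add_diag (?f(y := w)) b = ?F(y := w)"
       "add_diag (?f(y := w, x := z)) b = ?F(x := z, y := w)" for z w
      using b xS by (simp_all add: add_diag_upd(2)[symmetric] fun_upd_twist)
    have "fdet m ?F * fdet m (?F(x := urow x, y := urow y)) =
       fdet m (?F(x := urow x)) * fdet m (?F(y := urow y)) - fdet m (?F(x := urow y)) * fdet m (?F(y := urow x))"
      by (rule fdet_plucker) (use xS y in auto)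
    moreover have eq: "?F = units_on S (add_diag g b)" by (rule add_diag_units_on) (use b in auto)
    have "fdet m (?F(x := urow y)) = fdet m (?F(y := urow x))"
      unfolding eq
      by (rule fdet_units_sym1) (use xS y insert.prems in \<open>auto intro: add_diag_sym sym\<close>)
    ultimately have "?D (?f(x := urow x)) b * ?D (?f(y := urow y)) b - ?D ?f b * ?D (?f(y := urow y, x := urow x)) b
       = (?D (?f(x := urow y)) b) ^ 2"
      by (simp add: F power2_eq_square algebra_simps del: fun_upd_apply)
    then show "int (card {t. ?D ?f (b(x := t)) \<noteq> 0 \<or> ?D (?f(y := urow y)) (b(x := t)) \<noteq> 0}) = ?T b"
      by (simp only: d card_affine_pair_nonzero) simp
  qed
  also have "\<dots> = int CARD('k) * (\<Sum>b\<in>pts J. of_bool (?D (?f(x := urow x)) b \<noteq> 0 \<or> ?D ?f b \<noteq> 0 \<or>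
           ?D (?f(y := urow y, x := urow x)) b \<noteq> 0 \<or> ?D (?f(y := urow y)) b \<noteq> 0))
       - int (card {b \<in> pts J. ?D (?f(x := urow x)) b \<noteq> 0 \<or> ?D (?f(y := urow y, x := urow x)) b \<noteq> 0})
       + int (card {b \<in> pts J. ?D (?f(x := urow y)) b \<noteq> 0})"
    by (simp only: sum.distrib sum_subtractf sum_distrib_left[symmetric] sum_of_bool[OF finite_pts[OF fin]])
  also have "int CARD('k) dvd \<dots>"
  proof (intro dvd_add dvd_diff)
    have "?f(y := urow y, x := urow x) = (units_on (insert x S) g)(y := urow y)" "?f(x := urow x) = units_on (insert x S) g"
      using xS by (auto simp: units_on_def)
    then show "int CARD('k) dvd int (card {b \<in> pts J. ?D (?f(x := urow x)) b \<noteq> 0 \<or> ?D (?f(y := urow y, x := urow x)) b \<noteq> 0})"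
      using insert.IH[of "insert x S"] insert.prems insert.hyps by (simp del: fun_upd_apply)
    show "int CARD('k) dvd int (card {b \<in> pts J. ?D (?f(x := urow y)) b \<noteq> 0})"
    proof (rule dvd_card_fdet_nonzero[where C = C and R = "insert y R"])
      show "card (insert y R) < card C" using assms(5,6) by (simp add: card_insert_if)
    qed (use insert.prems fin assms(3,5) xS y in \<open>auto simp: units_on_def urow_def\<close>)
  qed simp
  finally show ?case .
qed

lemma square_dvd_card_fdet_nonzero:
  fixes g :: "nat \<Rightarrow> nat \<Rightarrow> 'k::{finite,field}"
  assumes "finite J" "J \<subseteq> {..<m}" "C \<subseteq> {..<m}" "J \<inter> C = {}" "finite R" "card R + 1 < card C"
    and sym: "\<And>i j. i < m \<Longrightarrow> j < m \<Longrightarrow> g i j = g j i"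
    and "S \<subseteq> {..<m}" "S \<inter> J = {}" "S \<inter> C = {}"
    and "\<And>i j. i < m \<Longrightarrow> i \<notin> J \<Longrightarrow> i \<notin> R \<Longrightarrow> i \<notin> S \<Longrightarrow> j \<in> C \<Longrightarrow> g i j = 0"
  shows "int CARD('k) ^ 2 dvd int (card {a \<in> pts J. fdet m (add_diag (units_on S g) a) \<noteq> 0})"
  using assms(1,2,4,8-11)
proof (induction J arbitrary: S rule: finite_induct)
  case empty
  have "fdet m (add_diag (units_on S g) (\<lambda>_. 0)) = 0"
    by (rule fdet_zero_block_rows[OF assms(3,5)])
      (use empty assms(6) in \<open>auto simp: add_diag_def smul_def units_on_def urow_def\<close>)
  then show ?case by (simp add: pts_empty cong: conj_cong)
next
  case (insert x J)
  have x: "x \<notin> S" "x < m" "x \<notin> C" using insert.prems by auto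
  have "int CARD('k) dvd int (card {a \<in> pts J. fdet m (add_diag (units_on S g) a) \<noteq> 0 \<or>
      fdet m (add_diag ((units_on S g)(x := urow x)) a) \<noteq> 0})"
    by (rule dvd_card_fdet_pair_nonzero[where C = C and R = R])
      (use insert.prems insert.hyps x assms(3,5,6) sym in auto)
  moreover have "int CARD('k) ^ 2 dvd int (card {a \<in> pts J. fdet m (add_diag (units_on (insert x S) g) a) \<noteq> 0})"
    by (rule insert.IH) (use insert.prems insert.hyps x in auto)
  ultimately show ?case
    by (subst card_insert_fdet_nonzero[OF x(2) insert(2,1)])
      (simp add: units_on_upd x power2_eq_square del: fun_upd_apply)
qed

section \<open>Elementary point counts over a finite field\<close>

text \<open>
  Numbers of solutions are written as iterated sums of indicator functions.
\<close>

lemma sum_shift: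
  fixes f :: "'k::{finite,ab_group_add} \<Rightarrow> int"
  shows "(\<Sum>x\<in>UNIV. f (x + c)) = (\<Sum>x\<in>UNIV. f x)"
  by (rule sum.reindex_bij_witness[of _ "\<lambda>x. x - c" "\<lambda>x. x + c"]) auto

lemma sum_of_bool_UNIV: "(\<Sum>a\<in>UNIV. of_bool (P a)) = (int (card {a::'k::finite. P a}))"
  using sum_of_bool[of "UNIV :: 'k set" P] by simp

lemma sum_of_bool_singleton: "(\<Sum>x\<in>UNIV. of_bool (x = (c::'k::finite) \<and> P)) = (of_bool P :: int)"
  by (cases P) (simp_all add: sum_of_bool_UNIV)

lemma sum_affine_zero:
  fixes k c :: "'k::{finite,field}"
  shows "(\<Sum>t\<in>UNIV. of_bool (t * k + c = 0)) = (of_bool (k \<noteq> 0) + int CARD('k) * of_bool (k = 0 \<and> c = 0))"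
proof (cases "k = 0")
  case False
  then have "t * k + c = 0 \<longleftrightarrow> t = - c / k \<and> True" for t by (auto simp: field_simps add_eq_0_iff2)
  then show ?thesis using False by (simp only: sum_of_bool_singleton) simp
qed simp

lemma sum_prod_eq_square:
  fixes s :: "'k::{finite,field}"
  shows "(\<Sum>x\<in>UNIV. \<Sum>y\<in>UNIV. of_bool (x * y = s ^ 2)) = (int CARD('k) - 1 + int CARD('k) * of_bool (s = 0))"
proof -
  have "(\<Sum>x\<in>UNIV. \<Sum>y\<in>UNIV. of_bool (x * y = s ^ 2)) = (\<Sum>x\<in>UNIV. \<Sum>y\<in>UNIV. of_bool (y * x + (- (s ^ 2)) = 0) :: int)"
    by (intro sum.cong refl) (simp add: mult.commute)
  also have "\<dots> = (\<Sum>x\<in>(UNIV::'k set). (1 - of_bool (x = 0 \<and> True)) + int CARD('k) * of_bool (x = 0 \<and> s = 0))"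
    unfolding sum_affine_zero by (intro sum.cong refl) auto
  also have "\<dots> = int CARD('k) - 1 + int CARD('k) * of_bool (s = 0)"
    by (simp only: sum.distrib sum_subtractf sum_distrib_left[symmetric] sum_of_bool_singleton) simp
  finally show ?thesis .
qed

lemma sum_linear_pair_zero:
  fixes k l c :: "'k::{finite,field}"
  shows "(\<Sum>s\<in>UNIV. \<Sum>t\<in>UNIV. of_bool (c + s * k + t * l = 0)) =
    int CARD('k) * of_bool (k \<noteq> 0 \<or> l \<noteq> 0) + int CARD('k) ^ 2 * of_bool (k = 0 \<and> l = 0 \<and> c = 0)"
proof -
  have "(\<Sum>s\<in>UNIV. \<Sum>t\<in>UNIV. of_bool (c + s * k + t * l = 0)) =
    (\<Sum>s\<in>UNIV. \<Sum>t\<in>UNIV. of_bool (t * l + (s * k + c) = 0) :: int)"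
    by (intro sum.cong refl) (simp add: algebra_simps)
  also have "\<dots> = (\<Sum>s\<in>UNIV. of_bool (l \<noteq> 0) + int CARD('k) * (of_bool (l = 0) * of_bool (s * k + c = 0)))"
    unfolding sum_affine_zero by (intro sum.cong refl) auto
  also have "\<dots> = int CARD('k) * of_bool (l \<noteq> 0) + int CARD('k) * (of_bool (l = 0) * (\<Sum>s\<in>UNIV. of_bool (s * k + c = 0)))"
    by (simp only: sum.distrib sum_distrib_left[symmetric]) simp
  also have "\<dots> = int CARD('k) * of_bool (k \<noteq> 0 \<or> l \<noteq> 0) + int CARD('k) ^ 2 * of_bool (k = 0 \<and> l = 0 \<and> c = 0)"
    unfolding sum_affine_zero by (auto simp: power2_eq_square)
  finally show ?thesis .
qed

text \<open>
  For \<open>x \<noteq> 0\<close> the two conditions amount to \<open>w = x\<^sup>2 / u\<close> and \<open>(u y - x z)\<^sup>2 = 0\<close>, so no square roots are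
  needed and characteristic two is not exceptional.
\<close>

lemma sum_degenerate_pairs:
  fixes x y z :: "'k::{finite,field}"
  shows "(\<Sum>u\<in>UNIV. \<Sum>w\<in>UNIV. of_bool (u * w = x ^ 2 \<and> u * y ^ 2 + w * z ^ 2 = 2 * x * y * z)) =
    (if x = 0 then (if z = 0 then int CARD('k) else 1) + (if y = 0 then int CARD('k) - 1 else 0)
     else if y = 0 \<and> z = 0 then int CARD('k) - 1 else if y \<noteq> 0 \<and> z \<noteq> 0 then 1 else 0)" (is "?L = ?R")
proof (cases "x = 0")
  case True
  have "(\<Sum>w\<in>UNIV. of_bool (u * w = x ^ 2 \<and> u * y ^ 2 + w * z ^ 2 = 2 * x * y * z)) =
    of_bool (u = 0 \<and> True) * (if z = 0 then int CARD('k) else 1) + (1 - of_bool (u = 0 \<and> True)) * of_bool (y = 0)" for u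
  proof (cases "u = 0")
    case u: True
    have "(\<Sum>w\<in>UNIV. of_bool (u * w = x ^ 2 \<and> u * y ^ 2 + w * z ^ 2 = 2 * x * y * z)) = (\<Sum>w\<in>UNIV. of_bool (w * z ^ 2 + 0 = 0) :: int)"
      using True u by simp
    then show ?thesis unfolding sum_affine_zero using u by auto
  next
    case u: False
    have "(\<Sum>w\<in>UNIV. of_bool (u * w = x ^ 2 \<and> u * y ^ 2 + w * z ^ 2 = 2 * x * y * z)) = (\<Sum>w\<in>(UNIV::'k set). of_bool (w = 0 \<and> y = 0) :: int)"
      using True u by (intro sum.cong refl) auto
    then show ?thesis unfolding sum_of_bool_singleton using u by simp
  qed
  then have "?L = (\<Sum>u\<in>(UNIV :: 'k set). of_bool (u = 0 \<and> True)) * (if z = 0 then int CARD('k) else 1) + (int CARD('k) - (\<Sum>u\<in>(UNIV :: 'k set). of_bool (u = 0 \<and> True))) * of_bool (y = 0)"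
    by (simp add: sum.distrib sum_distrib_right[symmetric] sum_subtractf)
  then show ?thesis unfolding sum_of_bool_singleton using True by simp
next
  case False
  have "(\<Sum>w\<in>UNIV. of_bool (u * w = x ^ 2 \<and> u * y ^ 2 + w * z ^ 2 = 2 * x * y * z)) = (of_bool (u \<noteq> 0 \<and> u * y = x * z) :: int)" for u
  proof (cases "u = 0")
    case u: True then show ?thesis using False by simp
  next
    case u: False
    have "(u * w = x ^ 2 \<and> u * y ^ 2 + w * z ^ 2 = 2 * x * y * z) \<longleftrightarrow> (w = x ^ 2 / u \<and> u * y = x * z)" for w
    proof -
      have w: "u * w = x ^ 2 \<longleftrightarrow> w = x ^ 2 / u" using u by (auto simp: field_simps)
      have "u * (u * y ^ 2 + (x ^ 2 / u) * z ^ 2 - 2 * x * y * z) = (u * y - x * z) ^ 2"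
        using u by (simp add: field_simps power2_eq_square)
      then have "u * y ^ 2 + (x ^ 2 / u) * z ^ 2 - 2 * x * y * z = 0 \<longleftrightarrow> u * y - x * z = 0"
        using u by (metis mult_eq_0_iff power_eq_0_iff zero_neq_numeral zero_power2)
      then show ?thesis using w by auto
    qed
    then show ?thesis using u by (simp only: sum_of_bool_singleton) simp
  qed
  then have L: "?L = (\<Sum>u\<in>UNIV. of_bool (u \<noteq> 0 \<and> u * y = x * z))" by simp
  show ?thesis
  proof (cases "y = 0")
    case y: True
    have "?L = (\<Sum>u\<in>(UNIV :: 'k set). (1 - of_bool (u = 0 \<and> True)) * of_bool (z = 0))"
      unfolding L using False y by (intro sum.cong refl) auto
    also have "\<dots> = (int CARD('k) - 1) * of_bool (z = 0)"
      by (simp only: sum_distrib_right[symmetric] sum_subtractf sum_of_bool_singleton) simp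
    finally show ?thesis using False y by auto
  next
    case y: False
    then have "u \<noteq> 0 \<and> u * y = x * z \<longleftrightarrow> u = x * z / y \<and> z \<noteq> 0" for u
      using False by (auto simp: field_simps)
    then have "?L = of_bool (z \<noteq> 0)" unfolding L by (simp only: sum_of_bool_singleton)
    then show ?thesis using False y by auto
  qed
qed

text \<open>
  The number of singular symmetric \<open>3 \<times> 3\<close> matrices with prescribed off-diagonal entries \<open>x\<close>, \<open>y\<close>, \<open>z\<close>.
\<close>

lemma sum_singular_sym3:
  fixes x y z :: "'k::{finite,field}"
  defines "q \<equiv> int CARD('k)"
  shows "(\<Sum>d1\<in>UNIV. \<Sum>d2\<in>UNIV. \<Sum>d3\<in>UNIV. of_bool (d1 * d2 * d3 + 2 * x * y * z - d1 * x ^ 2 - d2 * y ^ 2 - d3 * z ^ 2 = 0)) =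
    q ^ 2 + 1 - q * (of_bool (x = 0) + of_bool (y = 0) + of_bool (z = 0))
     + q ^ 2 * (of_bool (x = 0 \<and> y = 0) + of_bool (x = 0 \<and> z = 0) + of_bool (y = 0 \<and> z = 0) - of_bool (x = 0 \<and> y = 0 \<and> z = 0))"
proof -
  have "(\<Sum>d1\<in>UNIV. \<Sum>d2\<in>UNIV. \<Sum>d3\<in>UNIV. of_bool (d1 * d2 * d3 + 2 * x * y * z - d1 * x ^ 2 - d2 * y ^ 2 - d3 * z ^ 2 = 0)) =
    (\<Sum>d1\<in>UNIV. \<Sum>(d2, d3)\<in>UNIV \<times> UNIV. of_bool (d1 * (d2 * d3 - x ^ 2) + (2 * x * y * z - d2 * y ^ 2 - d3 * z ^ 2) = 0) :: int)"
    by (simp only: sum.cartesian_product[symmetric]) (intro sum.cong refl, simp add: algebra_simps)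
  also have "\<dots> = (\<Sum>(d2, d3)\<in>UNIV \<times> UNIV. \<Sum>d1\<in>UNIV. of_bool (d1 * (d2 * d3 - x ^ 2) + (2 * x * y * z - d2 * y ^ 2 - d3 * z ^ 2) = 0) :: int)"
    by (subst sum.swap) (simp add: case_prod_beta)
  also have "\<dots> = (\<Sum>d2\<in>UNIV. \<Sum>d3\<in>UNIV. (1 - of_bool (d2 * d3 = x ^ 2)) + q * of_bool (d2 * d3 = x ^ 2 \<and> d2 * y ^ 2 + d3 * z ^ 2 = 2 * x * y * z))"
    unfolding sum_affine_zero q_def
    by (simp only: sum.cartesian_product[symmetric]) (intro sum.cong refl, auto simp: algebra_simps)
  also have "\<dots> = q ^ 2 - (q - 1 + q * of_bool (x = 0)) + q * 
     (if x = 0 then (if z = 0 then q else 1) + (if y = 0 then q - 1 else 0)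
     else if y = 0 \<and> z = 0 then q - 1 else if y \<noteq> 0 \<and> z \<noteq> 0 then 1 else 0)"
    by (simp only: sum.distrib sum_subtractf sum_distrib_left[symmetric] sum_prod_eq_square sum_degenerate_pairs)
      (simp add: q_def power2_eq_square)
  also have "\<dots> = q ^ 2 + 1 - q * (of_bool (x = 0) + of_bool (y = 0) + of_bool (z = 0))
     + q ^ 2 * (of_bool (x = 0 \<and> y = 0) + of_bool (x = 0 \<and> z = 0) + of_bool (y = 0 \<and> z = 0) - of_bool (x = 0 \<and> y = 0 \<and> z = 0))"
    by (auto simp: algebra_simps power2_eq_square)
  finally show ?thesis .
qed

text \<open>
  The off-diagonal entries \<open>c_ij + x4\<close> vanish for exactly one value of \<open>x4\<close> each. So the result depends only
  on the coincidences between \<open>c12\<close>, \<open>c13\<close> and \<open>c23\<close>.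
\<close>

lemma sum_star4_generic:
  fixes c11 :: "'k::{finite,field}"
  defines "q \<equiv> int CARD('k)"
  shows "(\<Sum>x1\<in>UNIV. \<Sum>x2\<in>UNIV. \<Sum>x3\<in>UNIV. \<Sum>x4\<in>UNIV. of_bool (
      (x1 + c11 + x4) * (x2 + c22 + x4) * (x3 + c33 + x4) + 2 * (c23 + x4) * (c13 + x4) * (c12 + x4)
      - (x1 + c11 + x4) * (c23 + x4) ^ 2 - (x2 + c22 + x4) * (c13 + x4) ^ 2 - (x3 + c33 + x4) * (c12 + x4) ^ 2 = 0)) =
    q ^ 3 - 2 * q + q ^ 2 * (of_bool (c12 = c13) + of_bool (c12 = c23) + of_bool (c13 = c23) - of_bool (c12 = c13 \<and> c12 = c23))"
    (is "(\<Sum>x1\<in>UNIV. \<Sum>x2\<in>UNIV. \<Sum>x3\<in>UNIV. \<Sum>x4\<in>UNIV. ?P x1 x2 x3 x4) = _")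
proof -
  let ?D = "\<lambda>x y z d1 d2 d3 :: 'k. (of_bool (d1 * d2 * d3 + 2 * x * y * z - d1 * x ^ 2 - d2 * y ^ 2 - d3 * z ^ 2 = 0) :: int)"
  have "(\<Sum>x1\<in>UNIV. \<Sum>x2\<in>UNIV. \<Sum>x3\<in>UNIV. \<Sum>x4\<in>UNIV. ?P x1 x2 x3 x4) =
    (\<Sum>x1\<in>UNIV. \<Sum>x2\<in>UNIV. \<Sum>x4\<in>UNIV. \<Sum>x3\<in>UNIV. ?P x1 x2 x3 x4)"
    by (intro sum.cong refl sum.swap)
  also have "\<dots> = (\<Sum>x1\<in>UNIV. \<Sum>x4\<in>UNIV. \<Sum>x2\<in>UNIV. \<Sum>x3\<in>UNIV. ?P x1 x2 x3 x4)"
    by (intro sum.cong refl sum.swap)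
  also have "\<dots> = (\<Sum>x4\<in>UNIV. \<Sum>x1\<in>UNIV. \<Sum>x2\<in>UNIV. \<Sum>x3\<in>UNIV. ?P x1 x2 x3 x4)"
    by (rule sum.swap)
  also have "\<dots> = (\<Sum>x4\<in>UNIV. \<Sum>x1\<in>UNIV. \<Sum>x2\<in>UNIV. \<Sum>x3\<in>UNIV. ?D (c23 + x4) (c13 + x4) (c12 + x4) (x1 + (c11 + x4)) (x2 + (c22 + x4)) (x3 + (c33 + x4)))"
    by (simp only: add.assoc)
  also have "\<dots> = (\<Sum>x4\<in>UNIV. \<Sum>x1\<in>UNIV. \<Sum>x2\<in>UNIV. \<Sum>x3\<in>UNIV. ?D (c23 + x4) (c13 + x4) (c12 + x4) x1 x2 x3)"
    by (simp only: sum_shift[where f = "\<lambda>x3. ?D _ _ _ _ _ x3"] sum_shift[where f = "\<lambda>x2. \<Sum>x3\<in>UNIV. ?D _ _ _ _ x2 x3"]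
       sum_shift[where f = "\<lambda>x1. \<Sum>x2\<in>UNIV. \<Sum>x3\<in>UNIV. ?D _ _ _ x1 x2 x3"])
  also have "\<dots> = (\<Sum>x4\<in>UNIV. q ^ 2 + 1 - q * (of_bool (x4 = - c23 \<and> True) + of_bool (x4 = - c13 \<and> True) + of_bool (x4 = - c12 \<and> True))
     + q ^ 2 * (of_bool (x4 = - c23 \<and> c13 = c23) + of_bool (x4 = - c23 \<and> c12 = c23) + of_bool (x4 = - c13 \<and> c12 = c13) - of_bool (x4 = - c23 \<and> c12 = c13 \<and> c12 = c23)))"
    unfolding sum_singular_sym3 q_def
    by (intro sum.cong refl) (auto simp: add_eq_0_iff)
  also have "\<dots> = q * (q ^ 2 + 1) - q * 3 + q ^ 2 * (of_bool (c13 = c23) + of_bool (c12 = c23) + of_bool (c12 = c13) - of_bool (c12 = c13 \<and> c12 = c23))"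
    by (simp only: sum.distrib sum_subtractf sum_distrib_left[symmetric] sum_of_bool_singleton) (simp add: q_def algebra_simps)
  also have "\<dots> = q ^ 3 - 2 * q + q ^ 2 * (of_bool (c12 = c13) + of_bool (c12 = c23) + of_bool (c13 = c23) - of_bool (c12 = c13 \<and> c12 = c23))"
    by (simp add: algebra_simps power2_eq_square power3_eq_cube)
  finally show ?thesis .
qed

lemma sum_star3_generic:
  fixes c11 :: "'k::{finite,field}"
  shows "(\<Sum>x1\<in>UNIV. \<Sum>x2\<in>UNIV. \<Sum>x4\<in>UNIV. of_bool ((x1 + c11 + x4) * (x2 + c22 + x4) = (c12 + x4) ^ 2)) = int CARD('k) ^ 2"
proof -
  have "(\<Sum>x1\<in>UNIV. \<Sum>x2\<in>UNIV. \<Sum>x4\<in>UNIV. of_bool ((x1 + c11 + x4) * (x2 + c22 + x4) = (c12 + x4) ^ 2)) =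
     (\<Sum>x1\<in>UNIV. \<Sum>x4\<in>UNIV. \<Sum>x2\<in>UNIV. of_bool ((x1 + c11 + x4) * (x2 + c22 + x4) = (c12 + x4) ^ 2) :: int)"
    by (intro sum.cong refl sum.swap)
  also have "\<dots> = (\<Sum>x4\<in>UNIV. \<Sum>x1\<in>UNIV. \<Sum>x2\<in>UNIV. of_bool ((x1 + (c11 + x4)) * (x2 + (c22 + x4)) = (c12 + x4) ^ 2))"
    by (subst sum.swap) (simp only: add.assoc)
  also have "\<dots> = (\<Sum>x4\<in>UNIV. \<Sum>x1\<in>UNIV. \<Sum>x2\<in>UNIV. of_bool (x1 * x2 = (c12 + x4) ^ 2))"
    by (simp only: sum_shift[where f = "\<lambda>x2. of_bool (_ * x2 = _)"] sum_shift[where f = "\<lambda>x1. \<Sum>x2\<in>UNIV. of_bool (x1 * x2 = _)"])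
  also have "\<dots> = (\<Sum>x4\<in>UNIV. int CARD('k) - 1 + int CARD('k) * of_bool (x4 = - c12 \<and> True))"
    unfolding sum_prod_eq_square by (intro sum.cong refl) (auto simp: add_eq_0_iff)
  also have "\<dots> = int CARD('k) ^ 2"
    by (simp only: sum.distrib sum_distrib_left[symmetric] sum_of_bool_singleton) (simp add: algebra_simps power2_eq_square)
  finally show ?thesis .
qed

lemma sum_star4_rank1:
  fixes a b :: "'k::{finite,field}"
  defines "q \<equiv> int CARD('k)"
  shows "(\<Sum>x1\<in>UNIV. \<Sum>x2\<in>UNIV. \<Sum>x3\<in>UNIV. \<Sum>x4\<in>UNIV. of_bool (
      (x3 + f x1 x2) * (x4 + h x1 x2) = (g + x1 * a + x2 * b) ^ 2)) =
    q ^ 3 - q ^ 2 * of_bool (a = 0 \<and> b = 0) + q ^ 3 * of_bool (a = 0 \<and> b = 0 \<and> g = 0)"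
proof -
  have "(\<Sum>x1\<in>UNIV. \<Sum>x2\<in>UNIV. \<Sum>x3\<in>UNIV. \<Sum>x4\<in>UNIV. of_bool (
      (x3 + f x1 x2) * (x4 + h x1 x2) = (g + x1 * a + x2 * b) ^ 2)) =
    (\<Sum>x1\<in>UNIV. \<Sum>x2\<in>UNIV. q - 1 + q * of_bool (g + x1 * a + x2 * b = 0))"
    by (simp only: sum_shift[where f = "\<lambda>x2. of_bool (_ * x2 = _)"] sum_shift[where f = "\<lambda>x1. \<Sum>x2\<in>UNIV. of_bool (x1 * x2 = _)"]
        sum_prod_eq_square q_def)
  also have "\<dots> = q ^ 2 * (q - 1) + q * (q * of_bool (a \<noteq> 0 \<or> b \<noteq> 0) + q ^ 2 * of_bool (a = 0 \<and> b = 0 \<and> g = 0))"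
    by (simp only: sum.distrib sum_distrib_left[symmetric] sum_linear_pair_zero q_def) (simp add: power2_eq_square)
  also have "\<dots> = q ^ 3 - q ^ 2 * of_bool (a = 0 \<and> b = 0) + q ^ 3 * of_bool (a = 0 \<and> b = 0 \<and> g = 0)"
    by (auto simp: algebra_simps power2_eq_square power3_eq_cube)
  finally show ?thesis .
qed

section \<open>The alternating form attached to a star of four edges\<close>

text \<open>
  The determinant of a \<open>4 \<times> 4\<close> matrix, by Laplace expansion along the first two rows.
\<close>

definition det4 :: "'a::comm_ring_1 \<Rightarrow> 'a \<Rightarrow> 'a \<Rightarrow> 'a \<Rightarrow> 'a \<Rightarrow> 'a \<Rightarrow> 'a \<Rightarrow> 'a \<Rightarrow> 'a \<Rightarrow> 'a \<Rightarrow> 'a \<Rightarrow> 'a \<Rightarrow> 'a \<Rightarrow> 'a \<Rightarrow> 'a \<Rightarrow> 'a \<Rightarrow> 'a" where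
  "det4 a1 a2 a3 a4 b1 b2 b3 b4 c1 c2 c3 c4 d1 d2 d3 d4 =
     (a1 * b2 - a2 * b1) * (c3 * d4 - c4 * d3) - (a1 * b3 - a3 * b1) * (c2 * d4 - c4 * d2)
   + (a1 * b4 - a4 * b1) * (c2 * d3 - c3 * d2) + (a2 * b3 - a3 * b2) * (c1 * d4 - c4 * d1)
   - (a2 * b4 - a4 * b2) * (c1 * d3 - c3 * d1) + (a3 * b4 - a4 * b3) * (c1 * d2 - c2 * d1)"

text \<open>
  The situation at a 4-valent vertex with all other edge variables fixed: a symmetric matrix and four
  indices \<open>i1, \<dots>, i4\<close> of the edges of the star. The vector \<open>xi\<close> belongs to the column of the vertex: the
  corresponding combination of rows is the sum of the four unit rows, and it does not involve the
  rows \<open>i1, \<dots>, i4\<close>.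
\<close>

locale star4 =
  fixes m :: nat and B :: "nat \<Rightarrow> nat \<Rightarrow> 'k::{finite,field}" and i1 i2 i3 i4 :: nat and xi :: "nat \<Rightarrow> 'k"
  assumes sym: "\<And>i j. i < m \<Longrightarrow> j < m \<Longrightarrow> B i j = B j i"
    and dist: "distinct [i1, i2, i3, i4]"
    and lt: "{i1, i2, i3, i4} \<subseteq> {..<m}"
    and xi0: "\<And>i. i \<in> {i1, i2, i3, i4} \<Longrightarrow> xi i = 0"
    and xi_row: "\<And>j. j < m \<Longrightarrow> (\<Sum>k<m. xi k * B k j) = of_bool (j \<in> {i1, i2, i3, i4})"
begin

lemma perm:
  assumes "distinct [j1, j2, j3, j4]" "{j1, j2, j3, j4} = {i1, i2, i3, i4}"
  shows "star4 m B j1 j2 j3 j4 xi"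
  using sym lt xi0 xi_row assms unfolding star4_def by metis

lemma neq: "i1 \<noteq> i2" "i1 \<noteq> i3" "i1 \<noteq> i4" "i2 \<noteq> i3" "i2 \<noteq> i4" "i3 \<noteq> i4"
  "i2 \<noteq> i1" "i3 \<noteq> i1" "i4 \<noteq> i1" "i3 \<noteq> i2" "i4 \<noteq> i2" "i4 \<noteq> i3"
  using dist by auto

lemma less: "i1 < m" "i2 < m" "i3 < m" "i4 < m"
  using lt by auto

text \<open>
  The alternating 4-linear form given by the rows at \<open>i1, \<dots>, i4\<close>. The values at the unit rows \<open>e1, \<dots>, e4\<close> and
  the rows \<open>r1, \<dots>, r4\<close> of \<open>B\<close> comprise all coefficients of the graph polynomial and the Dodgson
  polynomials of the star.
\<close>

definition W :: "(nat \<Rightarrow> 'k) \<Rightarrow> (nat \<Rightarrow> 'k) \<Rightarrow> (nat \<Rightarrow> 'k) \<Rightarrow> (nat \<Rightarrow> 'k) \<Rightarrow> 'k" where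
  "W x1 x2 x3 x4 = fdet m (B(i1 := x1, i2 := x2, i3 := x3, i4 := x4))"

lemma W_alt:
  "W x1 x2 x3 x4 = fdet m (B(i2 := x2, i3 := x3, i4 := x4, i1 := x1))"
  "W x1 x2 x3 x4 = fdet m (B(i1 := x1, i3 := x3, i4 := x4, i2 := x2))"
  "W x1 x2 x3 x4 = fdet m (B(i1 := x1, i2 := x2, i4 := x4, i3 := x3))"
  unfolding W_def by (intro arg_cong[of _ _ "fdet m"] ext; simp add: neq)+

lemma W_add:
  "W (x + y) x2 x3 x4 = W x x2 x3 x4 + W y x2 x3 x4"
  "W x1 (x + y) x3 x4 = W x1 x x3 x4 + W x1 y x3 x4"
  "W x1 x2 (x + y) x4 = W x1 x2 x x4 + W x1 x2 y x4"
  "W x1 x2 x3 (x + y) = W x1 x2 x3 x + W x1 x2 x3 y"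
  unfolding W_alt(1)[of "x + y"] W_alt(1)[of x] W_alt(1)[of y] 
    W_alt(2)[of _ "x + y"] W_alt(2)[of _ x] W_alt(2)[of _ y]
    W_alt(3)[of _ _ "x + y"] W_alt(3)[of _ _ x] W_alt(3)[of _ _ y]
  by (simp_all only: W_def fdet_row_add less)

lemma W_smul:
  "W (smul c x) x2 x3 x4 = c * W x x2 x3 x4"
  "W x1 (smul c x) x3 x4 = c * W x1 x x3 x4"
  "W x1 x2 (smul c x) x4 = c * W x1 x2 x x4"
  "W x1 x2 x3 (smul c x) = c * W x1 x2 x3 x"
  unfolding W_alt(1)[of "smul c x"] W_alt(1)[of x]
    W_alt(2)[of _ "smul c x"] W_alt(2)[of _ x]
    W_alt(3)[of _ _ "smul c x"] W_alt(3)[of _ _ x]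
  by (simp_all only: W_def fdet_row_smul less)

lemma W_same:
  "W x x x3 x4 = 0" "W x x2 x x4 = 0" "W x x2 x3 x = 0"
  "W x1 x x x4 = 0" "W x1 x x3 x = 0" "W x1 x2 x x = 0"
proof -
  show "W x x x3 x4 = 0" unfolding W_def by (rule fdet_same[of i1 i2]; simp add: neq less)
  show "W x x2 x x4 = 0" unfolding W_def by (rule fdet_same[of i1 i3]; simp add: neq less)
  show "W x x2 x3 x = 0" unfolding W_def by (rule fdet_same[of i1 i4]; simp add: neq less)
  show "W x1 x x x4 = 0" unfolding W_def by (rule fdet_same[of i2 i3]; simp add: neq less)
  show "W x1 x x3 x = 0" unfolding W_def by (rule fdet_same[of i2 i4]; simp add: neq less)
  show "W x1 x2 x x = 0" unfolding W_def by (rule fdet_same[of i3 i4]; simp add: neq less)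
qed

lemma W_swap12: "W x1 x2 x3 x4 = - W x2 x1 x3 x4"
  using W_same(1)[of "x1 + x2" x3 x4, unfolded W_add] by (simp add: W_same eq_neg_iff_add_eq_0 add.commute)

lemma W_swap23: "W x1 x2 x3 x4 = - W x1 x3 x2 x4"
  using W_same(4)[of x1 "x2 + x3" x4, unfolded W_add] by (simp add: W_same eq_neg_iff_add_eq_0 add.commute)

lemma W_swap34: "W x1 x2 x3 x4 = - W x1 x2 x4 x3"
  using W_same(6)[of x1 x2 "x3 + x4", unfolded W_add] by (simp add: W_same eq_neg_iff_add_eq_0 add.commute)

lemma W_rot: "W x1 x2 x3 x4 = - W x2 x3 x4 x1"
  using W_swap12[of x1 x2 x3 x4] W_swap23[of x2 x1 x3 x4] W_swap34[of x2 x3 x1 x4] by simp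

text \<open>
  Equality modulo the radical of \<open>W\<close>.
\<close>

definition eqv :: "(nat \<Rightarrow> 'k) \<Rightarrow> (nat \<Rightarrow> 'k) \<Rightarrow> bool" where
  "eqv x y \<longleftrightarrow> (\<forall>u v w. W x u v w = W y u v w)"

lemma W_cong:
  assumes "eqv x1 y1" "eqv x2 y2" "eqv x3 y3" "eqv x4 y4"
  shows "W x1 x2 x3 x4 = W y1 y2 y3 y4"
proof -
  have "W x1 x2 x3 x4 = W y1 x2 x3 x4" using assms(1) by (simp add: eqv_def)
  also have "\<dots> = - W x2 x3 x4 y1" by (rule W_rot)
  also have "\<dots> = - W y2 x3 x4 y1" using assms(2) by (simp add: eqv_def)
  also have "\<dots> = W x3 x4 y1 y2" by (simp add: W_rot[of y2])
  also have "\<dots> = W y3 x4 y1 y2" using assms(3) by (simp add: eqv_def)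
  also have "\<dots> = - W x4 y1 y2 y3" by (rule W_rot)
  also have "\<dots> = - W y4 y1 y2 y3" using assms(4) by (simp add: eqv_def)
  also have "\<dots> = W y1 y2 y3 y4" by (simp add: W_rot[of y4])
  finally show ?thesis .
qed

lemma eqv_refl: "eqv x x"
  by (simp add: eqv_def)

text \<open>
  The linear combination of \<open>b1, \<dots>, b4\<close> with coefficients \<open>c1, \<dots>, c4\<close>.
\<close>

definition lin :: "(nat \<Rightarrow> 'k) \<Rightarrow> (nat \<Rightarrow> 'k) \<Rightarrow> (nat \<Rightarrow> 'k) \<Rightarrow> (nat \<Rightarrow> 'k) \<Rightarrow> 'k \<Rightarrow> 'k \<Rightarrow> 'k \<Rightarrow> 'k \<Rightarrow> (nat \<Rightarrow> 'k)" where
  "lin b1 b2 b3 b4 c1 c2 c3 c4 = smul c1 b1 + smul c2 b2 + smul c3 b3 + smul c4 b4"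

lemma eqv_row:
  assumes "eqv x (lin b1 b2 b3 b4 c1 c2 c3 c4)" "eqv y (lin b1 b2 b3 b4 d1 d2 d3 d4)"
  shows "eqv (y + smul t x) (lin b1 b2 b3 b4 (d1 + t * c1) (d2 + t * c2) (d3 + t * c3) (d4 + t * c4))"
  using assms by (simp add: eqv_def lin_def W_add W_smul algebra_simps)

lemma W_lin:
  "W (lin b1 b2 b3 b4 p1 p2 p3 p4) (lin b1 b2 b3 b4 q1 q2 q3 q4)
     (lin b1 b2 b3 b4 r1 r2 r3 r4) (lin b1 b2 b3 b4 s1 s2 s3 s4) =
   det4 p1 p2 p3 p4 q1 q2 q3 q4 r1 r2 r3 r4 s1 s2 s3 s4 * W b1 b2 b3 b4"
  unfolding lin_def
  apply (simp only: W_add W_smul W_same mult_zero_right add_0_left add_0_right)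
  apply (simp only: W_swap12[of b2 b1] W_swap12[of b3 b1] W_swap12[of b4 b1] W_swap12[of b3 b2] W_swap12[of b4 b2] W_swap12[of b4 b3]
     W_swap23[of _ b2 b1] W_swap23[of _ b3 b1] W_swap23[of _ b4 b1] W_swap23[of _ b3 b2] W_swap23[of _ b4 b2] W_swap23[of _ b4 b3]
     W_swap34[of _ _ b2 b1] W_swap34[of _ _ b3 b1] W_swap34[of _ _ b4 b1] W_swap34[of _ _ b3 b2] W_swap34[of _ _ b4 b2] W_swap34[of _ _ b4 b3])
  apply (simp only: det4_def minus_minus mult_minus_right)
  apply (simp only: ring_distribs mult_minus_left minus_mult_minus diff_conv_add_uminus minus_add_distrib minus_minus mult_minus_right)
  apply (simp only: ac_simps)
  done

text \<open>
  Modulo the radical every row is a combination of four rows \<open>b1, \<dots>, b4\<close> on which \<open>W\<close> does not vanish.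
  The coefficients are given by Cramer's rule.
\<close>

lemma eqv_coords:
  assumes "W b1 b2 b3 b4 = w" "w \<noteq> 0"
  shows "eqv z (lin b1 b2 b3 b4 (W z b2 b3 b4 / w) (W b1 z b3 b4 / w) (W b1 b2 z b4 / w) (W b1 b2 b3 z / w))"
  unfolding eqv_def
proof (intro allI)
  fix u v t
  let ?I = "{i1, i2, i3, i4}"
  let ?F = "B(i1 := b1, i2 := b2, i3 := b3, i4 := b4)"
  let ?G = "\<lambda>x. (B(i2 := u, i3 := v, i4 := t))(i1 := x)"
  have G: "fdet m (?G x) = W x u v t" for x by (simp only: W_alt(1))
  have "w * W z u v t = fdet m (?G (smul (fdet m ?F) z))"
    by (simp only: G W_smul assms(1)[unfolded W_def])
  also have "\<dots> = fdet m (?G (\<lambda>l. \<Sum>k<m. smul (fdet m (?F(k := z))) (?F k) l))"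
    by (rule fdet_cong) (simp add: smul_def fdet_cramer)
  also have "\<dots> = (\<Sum>k<m. fdet m (?F(k := z)) * fdet m (?G (?F k)))"
    by (simp only: fdet_row_sum fdet_row_smul less)
  also have "\<dots> = (\<Sum>k\<in>?I. fdet m (?F(k := z)) * fdet m (?G (?F k)))"
  proof (rule sum.mono_neutral_right)
    show "\<forall>k\<in>{..<m} - ?I. fdet m (?F(k := z)) * fdet m (?G (?F k)) = 0"
    proof
      fix k assume "k \<in> {..<m} - ?I"
      then have "fdet m (?G (?F k)) = 0"
        using less by (intro fdet_same[of i1 k]) auto
      then show "fdet m (?F(k := z)) * fdet m (?G (?F k)) = 0" by simp
    qed
  qed (use lt in auto)
  also have "\<dots> = W z b2 b3 b4 * W b1 u v t + W b1 z b3 b4 * W b2 u v t + W b1 b2 z b4 * W b3 u v t + W b1 b2 b3 z * W b4 u v t"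
  proof -
    have "?F(i1 := z) = B(i1 := z, i2 := b2, i3 := b3, i4 := b4)" "?F(i2 := z) = B(i1 := b1, i2 := z, i3 := b3, i4 := b4)"
      "?F(i3 := z) = B(i1 := b1, i2 := b2, i3 := z, i4 := b4)" "?F(i4 := z) = B(i1 := b1, i2 := b2, i3 := b3, i4 := z)"
      by (simp_all add: fun_eq_iff neq)
    moreover have "?F i1 = b1" "?F i2 = b2" "?F i3 = b3" "?F i4 = b4"
      by (simp_all add: neq)
    ultimately show ?thesis
      by (simp add: neq G W_def[symmetric] del: fun_upd_apply)
  qed
  finally show "W z u v t = W (lin b1 b2 b3 b4 (W z b2 b3 b4 / w) (W b1 z b3 b4 / w) (W b1 b2 z b4 / w) (W b1 b2 b3 z / w)) u v t"
    using assms(2) by (simp add: lin_def W_add W_smul field_simps)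
qed

abbreviation "e1 \<equiv> (urow i1 :: nat \<Rightarrow> 'k)"
abbreviation "e2 \<equiv> (urow i2 :: nat \<Rightarrow> 'k)"
abbreviation "e3 \<equiv> (urow i3 :: nat \<Rightarrow> 'k)"
abbreviation "e4 \<equiv> (urow i4 :: nat \<Rightarrow> 'k)"
abbreviation "r1 \<equiv> B i1"
abbreviation "r2 \<equiv> B i2"
abbreviation "r3 \<equiv> B i3"
abbreviation "r4 \<equiv> B i4"

text \<open>
  The relation given by \<open>xi\<close> makes \<open>e1 + e2 + e3 + e4\<close> a combination of rows other than \<open>i1, \<dots>, i4\<close>.
\<close>

lemma W_kill: "W (e1 + e2 + e3 + e4) x2 x3 x4 = 0"
  unfolding W_alt(1)
proof (rule fdet_zero_row[of i1 m "xi(i1 := - 1)"])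
  fix j assume j: "j < m"
  let ?F = "B(i2 := x2, i3 := x3, i4 := x4, i1 := e1 + e2 + e3 + e4)"
  have "(\<Sum>i<m. (xi(i1 := - 1)) i * ?F i j) = - (e1 + e2 + e3 + e4) j + (\<Sum>i\<in>{..<m} - {i1}. xi i * ?F i j)"
    using less by (subst sum.remove[of _ i1]) auto
  also have "(\<Sum>i\<in>{..<m} - {i1}. xi i * ?F i j) = (\<Sum>i\<in>{..<m} - {i1}. xi i * B i j)"
    using xi0 by (intro sum.cong refl) auto
  also have "\<dots> = (\<Sum>i<m. xi i * B i j)"
    using less xi0 by (subst (2) sum.remove[of _ i1]) auto
  also have "\<dots> = of_bool (j \<in> {i1, i2, i3, i4})" by (rule xi_row) fact
  also have "(e1 + e2 + e3 + e4) j = of_bool (j \<in> {i1, i2, i3, i4})"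
    by (auto simp: urow_def of_bool_def neq)
  also have "- of_bool (j \<in> {i1, i2, i3, i4}) + of_bool (j \<in> {i1, i2, i3, i4}) = (0 :: 'k)" by simp
  finally show "(\<Sum>i<m. (xi(i1 := - 1)) i * ?F i j) = 0" .
qed (use less in auto)

lemma eqv_e4: "eqv e4 (smul (- 1) e1 + smul (- 1) e2 + smul (- 1) e3)"
  unfolding eqv_def using W_kill by (auto simp: W_add W_smul add_eq_0_iff algebra_simps)

lemma W_e4:
  "W e4 x2 x3 x4 = - W e1 x2 x3 x4 - W e2 x2 x3 x4 - W e3 x2 x3 x4"
  "W x1 e4 x3 x4 = - W x1 e1 x3 x4 - W x1 e2 x3 x4 - W x1 e3 x3 x4"
  "W x1 x2 e4 x4 = - W x1 x2 e1 x4 - W x1 x2 e2 x4 - W x1 x2 e3 x4"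
  "W x1 x2 x3 e4 = - W x1 x2 x3 e1 - W x1 x2 x3 e2 - W x1 x2 x3 e3"
  using W_cong[OF eqv_e4 eqv_refl eqv_refl eqv_refl, of x2 x3 x4] W_cong[OF eqv_refl eqv_e4 eqv_refl eqv_refl, of x1 x3 x4]
    W_cong[OF eqv_refl eqv_refl eqv_e4 eqv_refl, of x1 x2 x4] W_cong[OF eqv_refl eqv_refl eqv_refl eqv_e4, of x1 x2 x3]
  by (simp_all add: W_add W_smul)

lemma fdet_sym1:
  assumes "S \<subseteq> {..<m}" "x < m" "y < m" "x \<notin> S" "y \<notin> S"
  shows "fdet m ((units_on S B)(x := urow y)) = fdet m ((units_on S B)(y := urow x))"
  using fdet_units_sym1[of S m x y B] assms sym by blast

lemma W_units:
  "fdet m (units_on {i3, i4} B) = W r1 r2 e3 e4" "fdet m (units_on {i2, i4} B) = W r1 e2 r3 e4"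
  "fdet m (units_on {i2, i3} B) = W r1 e2 e3 r4" "fdet m (units_on {i1, i4} B) = W e1 r2 r3 e4"
  "fdet m (units_on {i1, i3} B) = W e1 r2 e3 r4" "fdet m (units_on {i1, i2} B) = W e1 e2 r3 r4"
  unfolding W_def by (intro arg_cong[of _ _ "fdet m"] ext; auto simp: units_on_def neq)+

lemma W_sym3:
  "W e1 e2 r3 e3 = W e1 e2 e4 r4" "W e1 e3 r3 r4 = W e1 r2 e2 r4"
proof -
  have 1: "W e1 e2 r3 e3 = fdet m ((units_on {i1, i2} B)(i4 := urow i3))" "W e1 e2 e4 r4 = fdet m ((units_on {i1, i2} B)(i3 := urow i4))"
    "W e1 e3 r3 r4 = fdet m ((units_on {i1} B)(i2 := urow i3))" "W e1 r2 e2 r4 = fdet m ((units_on {i1} B)(i3 := urow i2))"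
    unfolding W_def by (intro arg_cong[of _ _ "fdet m"] ext; auto simp: units_on_def neq)+
  show "W e1 e2 r3 e3 = W e1 e2 e4 r4" "W e1 e3 r3 r4 = W e1 r2 e2 r4"
    unfolding 1 by (auto intro!: fdet_sym1 simp: neq less)
qed

end

section \<open>Counts over the star and coordinates of the alternating form\<close>

lemma sum_pts_insert:
  fixes F :: "(nat \<Rightarrow> 'k::{finite,zero}) \<Rightarrow> int"
  assumes "x \<notin> J" "finite J"
  shows "(\<Sum>a\<in>pts (insert x J). F a) = (\<Sum>b\<in>pts J. \<Sum>t\<in>UNIV. F (b(x := t)))"
proof -
  have "(\<Sum>b\<in>pts J. \<Sum>t\<in>UNIV. F (b(x := t))) = (\<Sum>(b, t)\<in>pts J \<times> UNIV. F (b(x := t)))"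
    by (rule sum.cartesian_product)
  also have "\<dots> = (\<Sum>a\<in>pts (insert x J). F a)"
    using sum.reindex_bij_betw[OF bij_betw_pts_insert[OF assms(1), of "\<lambda>_::nat \<Rightarrow> 'k. True"], of F]
    by (simp add: case_prod_beta)
  finally show ?thesis by simp
qed

lemma sum_pts3:
  fixes F :: "(nat \<Rightarrow> 'k::{finite,field}) \<Rightarrow> int"
  assumes "distinct [j1, j2, j3]"
  shows "(\<Sum>a\<in>pts {j1, j2, j3}. F a) =
    (\<Sum>x1\<in>UNIV. \<Sum>x2\<in>UNIV. \<Sum>x3\<in>UNIV. F ((\<lambda>_. 0)(j1 := x1, j2 := x2, j3 := x3)))"
proof -
  have "(\<Sum>a\<in>pts {j1, j2, j3}. F a) = (\<Sum>a\<in>pts (insert j3 (insert j2 (insert j1 {}))). F a)"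
    by (rule arg_cong[of _ _ "\<lambda>J. sum F (pts J)"]) auto
  also have "\<dots> = (\<Sum>a\<in>pts (insert j2 (insert j1 {})). \<Sum>x3\<in>UNIV. F (a(j3 := x3)))"
    by (rule sum_pts_insert) (use assms in auto)
  also have "\<dots> = (\<Sum>a\<in>pts (insert j1 {}). \<Sum>x2\<in>UNIV. \<Sum>x3\<in>UNIV. F (a(j2 := x2, j3 := x3)))"
    by (rule sum_pts_insert) (use assms in auto)
  also have "\<dots> = (\<Sum>a\<in>pts {}. \<Sum>x1\<in>UNIV. \<Sum>x2\<in>UNIV. \<Sum>x3\<in>UNIV. F (a(j1 := x1, j2 := x2, j3 := x3)))"
    by (rule sum_pts_insert) auto
  finally show ?thesis by (simp only: pts_empty) (simp add: fun_upd_def)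
qed

lemma sum_pts4:
  fixes F :: "(nat \<Rightarrow> 'k::{finite,field}) \<Rightarrow> int"
  assumes "distinct [j1, j2, j3, j4]"
  shows "(\<Sum>a\<in>pts {j1, j2, j3, j4}. F a) =
    (\<Sum>x1\<in>UNIV. \<Sum>x2\<in>UNIV. \<Sum>x3\<in>UNIV. \<Sum>x4\<in>UNIV. F ((\<lambda>_. 0)(j1 := x1, j2 := x2, j3 := x3, j4 := x4)))"
proof -
  have "(\<Sum>a\<in>pts {j1, j2, j3, j4}. F a) = (\<Sum>a\<in>pts (insert j4 {j1, j2, j3}). F a)"
    by (rule arg_cong[of _ _ "\<lambda>J. sum F (pts J)"]) auto
  also have "\<dots> = (\<Sum>a\<in>pts {j1, j2, j3}. \<Sum>x4\<in>UNIV. F (a(j4 := x4)))"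
    by (rule sum_pts_insert) (use assms in auto)
  also have "\<dots> = (\<Sum>x1\<in>UNIV. \<Sum>x2\<in>UNIV. \<Sum>x3\<in>UNIV. \<Sum>x4\<in>UNIV. F ((\<lambda>_. 0)(j1 := x1, j2 := x2, j3 := x3, j4 := x4)))"
    by (rule sum_pts3) (use assms in auto)
  finally show ?thesis .
qed

lemma sum_linear3_zero:
  fixes k1 :: "'k::{finite,field}"
  shows "(\<Sum>x1\<in>UNIV. \<Sum>x2\<in>UNIV. \<Sum>x3\<in>UNIV. of_bool (k0 + x1 * k1 + x2 * k2 + x3 * k3 = 0)) =
    int CARD('k) ^ 2 * of_bool (k1 \<noteq> 0 \<or> k2 \<noteq> 0 \<or> k3 \<noteq> 0) + int CARD('k) ^ 3 * of_bool (k1 = 0 \<and> k2 = 0 \<and> k3 = 0 \<and> k0 = 0)"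
proof -
  have "(\<Sum>x1\<in>UNIV. \<Sum>x2\<in>UNIV. \<Sum>x3\<in>UNIV. of_bool (k0 + x1 * k1 + x2 * k2 + x3 * k3 = 0)) =
    (\<Sum>x1\<in>UNIV. int CARD('k) * of_bool (k2 \<noteq> 0 \<or> k3 \<noteq> 0) + int CARD('k) ^ 2 * (of_bool (k2 = 0 \<and> k3 = 0) * of_bool (x1 * k1 + k0 = 0)))"
    unfolding sum_linear_pair_zero by (intro sum.cong refl) (auto simp: add.commute)
  also have "\<dots> = int CARD('k) * (int CARD('k) * of_bool (k2 \<noteq> 0 \<or> k3 \<noteq> 0)) +
      int CARD('k) ^ 2 * (of_bool (k2 = 0 \<and> k3 = 0) * (of_bool (k1 \<noteq> 0) + int CARD('k) * of_bool (k1 = 0 \<and> k0 = 0)))"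
    by (simp only: sum.distrib sum_distrib_left[symmetric] sum_affine_zero) simp
  also have "\<dots> = int CARD('k) ^ 2 * of_bool (k1 \<noteq> 0 \<or> k2 \<noteq> 0 \<or> k3 \<noteq> 0) + int CARD('k) ^ 3 * of_bool (k1 = 0 \<and> k2 = 0 \<and> k3 = 0 \<and> k0 = 0)"
    by (auto simp: power2_eq_square power3_eq_cube)
  finally show ?thesis .
qed

lemma sum_linear4_zero_dvd:
  fixes k1 :: "'k::{finite,field}"
  shows "int CARD('k) ^ 3 dvd (\<Sum>x1\<in>UNIV. \<Sum>x2\<in>UNIV. \<Sum>x3\<in>UNIV. \<Sum>x4\<in>UNIV. of_bool (k0 + x1 * k1 + x2 * k2 + x3 * k3 + x4 * k4 = 0))"
proof -
  have "(\<Sum>x1\<in>UNIV. \<Sum>x2\<in>UNIV. \<Sum>x3\<in>UNIV. \<Sum>x4\<in>UNIV. of_bool (k0 + x1 * k1 + x2 * k2 + x3 * k3 + x4 * k4 = 0)) =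
    (\<Sum>x1\<in>UNIV. int CARD('k) ^ 2 * of_bool (k2 \<noteq> 0 \<or> k3 \<noteq> 0 \<or> k4 \<noteq> 0) + int CARD('k) ^ 3 * (of_bool (k2 = 0 \<and> k3 = 0 \<and> k4 = 0 \<and> k0 + x1 * k1 = 0)))"
    unfolding sum_linear3_zero by simp
  also have "\<dots> = int CARD('k) ^ 3 * of_bool (k2 \<noteq> 0 \<or> k3 \<noteq> 0 \<or> k4 \<noteq> 0) + int CARD('k) ^ 3 * (\<Sum>x1\<in>UNIV. of_bool (k2 = 0 \<and> k3 = 0 \<and> k4 = 0 \<and> k0 + x1 * k1 = 0))"
    by (simp only: sum.distrib sum_distrib_left[symmetric]) (simp add: power2_eq_square power3_eq_cube)
  finally show ?thesis by (simp only: dvd_add dvd_triv_left)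
qed

text \<open>
  The number of zeros in the variables of the star \<open>I\<close>, with the other variables contained in \<open>B\<close>.
\<close>

definition star_count4 :: "nat \<Rightarrow> (nat \<Rightarrow> nat \<Rightarrow> 'k::{finite,field}) \<Rightarrow> nat set \<Rightarrow> int" where
  "star_count4 m B I = int (card {a \<in> pts I. fdet m (add_diag B a) = 0})"

text \<open>
  The same after deletion of the edge \<open>l\<close> of the star.
\<close>

definition star_count3 :: "nat \<Rightarrow> (nat \<Rightarrow> nat \<Rightarrow> 'k::{finite,field}) \<Rightarrow> nat set \<Rightarrow> nat \<Rightarrow> int" where
  "star_count3 m B I l = int (card {a \<in> pts (I - {l}). fdet m (add_diag (B(l := urow l)) a) = 0})"

text \<open>
  Vanishing of the Dodgson polynomial with rows \<open>i\<close>, \<open>k\<close> and columns \<open>j\<close>, \<open>l\<close> removed.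
\<close>

definition star_dodgson :: "nat \<Rightarrow> (nat \<Rightarrow> nat \<Rightarrow> 'k::{finite,field}) \<Rightarrow> nat \<Rightarrow> nat \<Rightarrow> nat \<Rightarrow> nat \<Rightarrow> bool" where
  "star_dodgson m B i j k l \<longleftrightarrow> fdet m (B(i := urow j, k := urow l)) = 0"

context star4
begin

lemma W_swap13: "W x1 x2 x3 x4 = - W x3 x2 x1 x4"
  using W_swap12[of x1 x2 x3 x4] W_swap23[of x2 x1 x3 x4] W_swap12[of x2 x3 x1 x4] by simp

lemma W_swap24: "W x1 x2 x3 x4 = - W x1 x4 x3 x2"
  using W_swap23[of x1 x2 x3 x4] W_swap34[of x1 x3 x2 x4] W_swap23[of x1 x3 x4 x2] by simp

lemma W_swap14: "W x1 x2 x3 x4 = - W x4 x2 x3 x1"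
  using W_swap12[of x1 x2 x3 x4] W_swap24[of x2 x1 x3 x4] W_swap12[of x2 x4 x3 x1] by simp

text \<open>
  Up to sign, the value of the graph polynomial of the graph without the 4-valent vertex. Deleting any
  three of the four edges of the star gives the same value (\<open>A_eq\<close>).
\<close>

definition A where "A = W e1 e2 e3 r4"

lemma A_3: "W e1 e2 r3 e4 = W e1 e2 e3 r4"
proof -
  have "W e1 e2 r3 e4 = - W e1 e2 r3 e3" by (simp add: W_e4(4) W_same)
  also have "\<dots> = - W e1 e2 e4 r4" by (simp only: W_sym3)
  also have "\<dots> = W e1 e2 e3 r4" by (simp add: W_e4(3) W_same)
  finally show ?thesis .
qed

lemma A_eq: "W e1 e2 e3 r4 = A" "W e1 e2 r3 e4 = A" "W e1 r2 e3 e4 = A" "W r1 e2 e3 e4 = A"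
proof -
  show "W e1 e2 e3 r4 = A" by (simp add: A_def)
  show "W e1 e2 r3 e4 = A" by (simp add: A_def A_3)
  interpret p: star4 m B i1 i3 i2 i4 xi by (rule perm) (auto simp: neq)
  have pW: "p.W x y z w = W x z y w" for x y z w
    unfolding W_def p.W_def by (rule arg_cong[of _ _ "fdet m"]) (simp add: fun_eq_iff neq)
  show "W e1 r2 e3 e4 = A" using p.A_3 by (simp add: pW A_def)
  interpret p': star4 m B i2 i3 i1 i4 xi by (rule perm) (auto simp: neq)
  have pW': "p'.W x y z w = W z x y w" for x y z w
    unfolding W_def p'.W_def by (rule arg_cong[of _ _ "fdet m"]) (simp add: fun_eq_iff neq)
  show "W r1 e2 e3 e4 = A" using p'.A_3 by (simp add: pW' A_def)
qed

lemma W_sym: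
  "W r1 e1 e3 r4 = W e2 r2 e3 r4" "W r1 e2 e1 r4 = W e3 e2 r3 r4"
  "W e3 r2 r3 e4 = W r1 r2 e1 e4" "W r1 e3 r3 e4 = W r1 r2 e2 e4"
  "W e4 r2 e3 r4 = W r1 r2 e3 e1" "W r1 e4 e3 r4 = W r1 r2 e3 e2"
  "W r1 r2 e4 r4 = W r1 r2 r3 e3"
proof -
  have 1: "W r1 e1 e3 r4 = fdet m ((units_on {i3} B)(i2 := urow i1))" "W e2 r2 e3 r4 = fdet m ((units_on {i3} B)(i1 := urow i2))"
   "W r1 e2 e1 r4 = fdet m ((units_on {i2} B)(i3 := urow i1))" "W e3 e2 r3 r4 = fdet m ((units_on {i2} B)(i1 := urow i3))"
   "W e3 r2 r3 e4 = fdet m ((units_on {i4} B)(i1 := urow i3))" "W r1 r2 e1 e4 = fdet m ((units_on {i4} B)(i3 := urow i1))"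
   "W r1 e3 r3 e4 = fdet m ((units_on {i4} B)(i2 := urow i3))" "W r1 r2 e2 e4 = fdet m ((units_on {i4} B)(i3 := urow i2))"
   "W e4 r2 e3 r4 = fdet m ((units_on {i3} B)(i1 := urow i4))" "W r1 r2 e3 e1 = fdet m ((units_on {i3} B)(i4 := urow i1))"
   "W r1 e4 e3 r4 = fdet m ((units_on {i3} B)(i2 := urow i4))" "W r1 r2 e3 e2 = fdet m ((units_on {i3} B)(i4 := urow i2))"
   "W r1 r2 e4 r4 = fdet m ((units_on {} B)(i3 := urow i4))" "W r1 r2 r3 e3 = fdet m ((units_on {} B)(i4 := urow i3))"
    unfolding W_def by (intro arg_cong[of _ _ "fdet m"] ext; auto simp: units_on_def neq)+
  show "W r1 e1 e3 r4 = W e2 r2 e3 r4" unfolding 1 by (rule fdet_sym1) (auto simp: neq less)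
  show "W r1 e2 e1 r4 = W e3 e2 r3 r4" unfolding 1 by (rule fdet_sym1) (auto simp: neq less)
  show "W e3 r2 r3 e4 = W r1 r2 e1 e4" unfolding 1 by (rule fdet_sym1) (auto simp: neq less)
  show "W r1 e3 r3 e4 = W r1 r2 e2 e4" unfolding 1 by (rule fdet_sym1) (auto simp: neq less)
  show "W e4 r2 e3 r4 = W r1 r2 e3 e1" unfolding 1 by (rule fdet_sym1) (auto simp: neq less)
  show "W r1 e4 e3 r4 = W r1 r2 e3 e2" unfolding 1 by (rule fdet_sym1) (auto simp: neq less)
  show "W r1 r2 e4 r4 = W r1 r2 r3 e3" unfolding 1 by (rule fdet_sym1) (auto simp: neq less)
qed

text \<open>
  For \<open>A \<noteq> 0\<close> the rows \<open>e1, e2, e3, r4\<close> serve as a basis. The coordinates of \<open>r1\<close>, \<open>r2\<close>, \<open>r3\<close> at \<open>e1\<close>, \<open>e2\<close>,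
  \<open>e3\<close> form a symmetric matrix.
\<close>

lemma coords_generic:
  assumes "A \<noteq> 0"
  obtains c11 c12 c13 c22 c23 c33 where
    "eqv r1 (lin e1 e2 e3 r4 c11 c12 c13 1)" "eqv r2 (lin e1 e2 e3 r4 c12 c22 c23 1)"
    "eqv r3 (lin e1 e2 e3 r4 c13 c23 c33 1)"
proof -
  have "W e1 r1 e3 r4 = W r2 e2 e3 r4"
    using W_swap12[of e1 r1] W_swap12[of r2 e2] W_sym(1) by simp
  moreover have "W e1 e2 r1 r4 = W r3 e2 e3 r4"
    using W_swap13[of e1 e2 r1] W_swap13[of r3 e2 e3] W_sym(2) by simp
  moreover have "W e1 e2 r2 r4 = W e1 r3 e3 r4"
    using W_swap23[of e1 e2 r2] W_swap23[of e1 r3 e3] W_sym3(2) by simp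
  moreover have "W e1 e2 e3 r1 = A"
    using W_swap14[of e1 e2 e3 r1] A_eq(4) by (simp add: W_e4 W_same)
  moreover have "W e1 e2 e3 r2 = A"
    using W_swap24[of e1 e2 e3 r2] A_eq(3) by (simp add: W_e4 W_same)
  moreover have "W e1 e2 e3 r3 = A"
    using W_swap34[of e1 e2 e3 r3] A_eq(2) by (simp add: W_e4 W_same)
  ultimately show ?thesis
    using that eqv_coords[OF A_eq(1) assms, of r1] eqv_coords[OF A_eq(1) assms, of r2] eqv_coords[OF A_eq(1) assms, of r3] assms
    by simp
qed

lemma eqv_unit_coords:
  "eqv b1 (lin b1 b2 b3 b4 1 0 0 0)" "eqv b2 (lin b1 b2 b3 b4 0 1 0 0)"
  "eqv b3 (lin b1 b2 b3 b4 0 0 1 0)" "eqv b4 (lin b1 b2 b3 b4 0 0 0 1)"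
  by (auto simp: eqv_def lin_def W_add W_smul)

lemma eqv_e4_coords: "eqv e4 (lin e1 e2 e3 r4 (- 1) (- 1) (- 1) 0)"
  by (auto simp: eqv_def lin_def W_add W_smul W_e4)

lemma generic:
  assumes "A \<noteq> 0"
  obtains c11 c12 c13 c22 c23 c33 where
    "\<And>x1 x2 x3 x4. W (r1 + smul x1 e1) (r2 + smul x2 e2) (r3 + smul x3 e3) (r4 + smul x4 e4) =
      A * ((x1 + c11 + x4) * (x2 + c22 + x4) * (x3 + c33 + x4) + 2 * (c23 + x4) * (c13 + x4) * (c12 + x4)
      - (x1 + c11 + x4) * (c23 + x4) ^ 2 - (x2 + c22 + x4) * (c13 + x4) ^ 2 - (x3 + c33 + x4) * (c12 + x4) ^ 2)"
    "\<And>x1 x2 x4. W (r1 + smul x1 e1) (r2 + smul x2 e2) e3 (r4 + smul x4 e4) = A * ((x1 + c11 + x4) * (x2 + c22 + x4) - (c12 + x4) ^ 2)"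
    "W e2 r2 e4 r4 = A * (c12 - c23)" "W e2 r2 r3 e3 = A * (c12 - c13)" "W e3 e4 r3 r4 = A * (c13 - c23)"
proof -
  obtain c11 c12 c13 c22 c23 c33 where
    r: "eqv r1 (lin e1 e2 e3 r4 c11 c12 c13 1)" "eqv r2 (lin e1 e2 e3 r4 c12 c22 c23 1)"
    "eqv r3 (lin e1 e2 e3 r4 c13 c23 c33 1)" using coords_generic[OF assms] by blast
  note u = eqv_unit_coords[where ?b1.0 = e1 and ?b2.0 = e2 and ?b3.0 = e3 and ?b4.0 = r4]
  note R = eqv_row[OF u(1) r(1)] eqv_row[OF u(2) r(2)] eqv_row[OF u(3) r(3)] eqv_row[OF eqv_e4_coords u(4)]
  note L = W_lin[of e1 e2 e3 r4, unfolded A_eq]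
  show ?thesis
  proof (rule that)
    show "W (r1 + smul x1 e1) (r2 + smul x2 e2) (r3 + smul x3 e3) (r4 + smul x4 e4) =
      A * ((x1 + c11 + x4) * (x2 + c22 + x4) * (x3 + c33 + x4) + 2 * (c23 + x4) * (c13 + x4) * (c12 + x4)
      - (x1 + c11 + x4) * (c23 + x4) ^ 2 - (x2 + c22 + x4) * (c13 + x4) ^ 2 - (x3 + c33 + x4) * (c12 + x4) ^ 2)" for x1 x2 x3 x4
      unfolding W_cong[OF R] L by (subst mult.commute, rule arg_cong[of _ _ "(*) A"]) (simp add: det4_def power2_eq_square mult_2 algebra_simps)
    show "W (r1 + smul x1 e1) (r2 + smul x2 e2) e3 (r4 + smul x4 e4) = A * ((x1 + c11 + x4) * (x2 + c22 + x4) - (c12 + x4) ^ 2)" for x1 x2 x4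
      unfolding W_cong[OF R(1,2) u(3) R(4)] L by (subst mult.commute, rule arg_cong[of _ _ "(*) A"]) (simp add: det4_def power2_eq_square mult_2 algebra_simps)
    show "W e2 r2 e4 r4 = A * (c12 - c23)"
      unfolding W_cong[OF u(2) r(2) eqv_e4_coords u(4)] L by (simp add: det4_def algebra_simps)
    show "W e2 r2 r3 e3 = A * (c12 - c13)"
      unfolding W_cong[OF u(2) r(2) r(3) u(3)] L by (simp add: det4_def algebra_simps)
    show "W e3 e4 r3 r4 = A * (c13 - c23)"
      unfolding W_cong[OF u(3) eqv_e4_coords r(3) u(4)] L by (simp add: det4_def algebra_simps)
  qed
qed

end

section \<open>The congruence for fixed variables outside the star\<close>

text \<open>
  The congruence stated at the beginning, with \<open>a\<close> in place of \<open>A\<close>. The coefficients \<open>f_ij\<close> are indexed by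
  the pair \<open>T\<close> of deleted edges. The last conjuncts say that no two of the three Dodgson
  polynomials vanish without the third one. They make the statement invariant under permutations of the four
  indices.
\<close>

definition star_cong :: "nat \<Rightarrow> (nat \<Rightarrow> nat \<Rightarrow> 'k::{finite,field}) \<Rightarrow> nat \<Rightarrow> nat \<Rightarrow> nat \<Rightarrow> nat \<Rightarrow> bool" where
  "star_cong m B i1 i2 i3 i4 \<longleftrightarrow>
    (let q = int CARD('k); I = {i1, i2, i3, i4}; a = fdet m (units_on {i1, i2, i3} B);
       p1 = star_dodgson m B i1 i2 i3 i4; p2 = star_dodgson m B i1 i2 i4 i3; p3 = star_dodgson m B i1 i3 i2 i4
     in [star_count4 m B I + (\<Sum>l\<in>I. star_count3 m B I l) + q ^ 2 * of_bool (p1 \<and> p2) =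
          - 2 * q * of_bool (a \<noteq> 0) + q ^ 2 * (4 + of_bool p1 + of_bool p2 + of_bool p3
            - (\<Sum>T | T \<subseteq> I \<and> card T = 2. of_bool (a = 0 \<and> fdet m (units_on T B) = 0)))] (mod q ^ 3)
       \<and> (p1 \<and> p2 \<longrightarrow> p3) \<and> (p1 \<and> p3 \<longrightarrow> p2) \<and> (p2 \<and> p3 \<longrightarrow> p1))"

lemma pairs4:
  assumes "distinct [i1, i2, i3, i4]"
  shows "{T. T \<subseteq> {i1, i2, i3, i4} \<and> card T = 2} = {{i1, i2}, {i1, i3}, {i1, i4}, {i2, i3}, {i2, i4}, {i3, i4}}"
    (is "?L = ?R")
proof
    show "?L \<subseteq> ?R"
    proof
      fix T assume "T \<in> ?L"
      then obtain x y where T: "T = {x, y}" "x \<noteq> y" "x \<in> {i1, i2, i3, i4}" "y \<in> {i1, i2, i3, i4}"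
        by (auto simp: card_2_iff)
      from T(3,4,2) show "T \<in> ?R"
        unfolding T(1) by (elim insertE emptyE) (simp_all add: insert_commute)
    qed
    show "?R \<subseteq> ?L" using assms by simp
qed

lemma sum_pairs4:
  assumes "distinct [i1, i2, i3, i4]"
  shows "(\<Sum>T | T \<subseteq> {i1, i2, i3, i4} \<and> card T = 2. F T) =
    F {i1, i2} + F {i1, i3} + F {i1, i4} + F {i2, i3} + F {i2, i4} + (F {i3, i4} :: int)"
  using assms by (simp add: pairs4 doubleton_eq_iff)

context star4
begin

abbreviation "I \<equiv> {i1, i2, i3, i4}"

lemma count4:
  "star_count4 m B I = (\<Sum>x1\<in>UNIV. \<Sum>x2\<in>UNIV. \<Sum>x3\<in>UNIV. \<Sum>x4\<in>UNIV.
     of_bool (W (r1 + smul x1 e1) (r2 + smul x2 e2) (r3 + smul x3 e3) (r4 + smul x4 e4) = 0))"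
proof -
  have "add_diag B ((\<lambda>_. 0)(i1 := x1, i2 := x2, i3 := x3, i4 := x4)) =
     B(i1 := r1 + smul x1 e1, i2 := r2 + smul x2 e2, i3 := r3 + smul x3 e3, i4 := r4 + smul x4 e4)" for x1 x2 x3 x4
    by (simp add: fun_eq_iff add_diag_def neq smul_def)
  then show ?thesis
    unfolding star_count4_def W_def by (simp only: sum_of_bool[OF finite_pts, symmetric] finite.intros sum_pts4[OF dist])
qed

lemma count3:
  "star_count3 m B I i4 = (\<Sum>x1\<in>UNIV. \<Sum>x2\<in>UNIV. \<Sum>x3\<in>UNIV.
     of_bool (W (r1 + smul x1 e1) (r2 + smul x2 e2) (r3 + smul x3 e3) e4 = 0))"
  "star_count3 m B I i3 = (\<Sum>x1\<in>UNIV. \<Sum>x2\<in>UNIV. \<Sum>x4\<in>UNIV.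
     of_bool (W (r1 + smul x1 e1) (r2 + smul x2 e2) e3 (r4 + smul x4 e4) = 0))"
proof -
  have 1: "add_diag (B(i4 := e4)) ((\<lambda>_. 0)(i1 := x1, i2 := x2, i3 := x3)) =
     B(i1 := r1 + smul x1 e1, i2 := r2 + smul x2 e2, i3 := r3 + smul x3 e3, i4 := e4)" for x1 x2 x3
    by (simp add: fun_eq_iff add_diag_def neq smul_def)
  have 2: "add_diag (B(i3 := e3)) ((\<lambda>_. 0)(i1 := x1, i2 := x2, i4 := x4)) =
     B(i1 := r1 + smul x1 e1, i2 := r2 + smul x2 e2, i3 := e3, i4 := r4 + smul x4 e4)" for x1 x2 x4
    by (simp add: fun_eq_iff add_diag_def neq smul_def)
  have s: "I - {i4} = {i1, i2, i3}" "I - {i3} = {i1, i2, i4}" by (auto simp: neq)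
  have d: "distinct [i1, i2, i3]" "distinct [i1, i2, i4]" by (auto simp: neq)
  show "star_count3 m B I i4 = (\<Sum>x1\<in>UNIV. \<Sum>x2\<in>UNIV. \<Sum>x3\<in>UNIV.
     of_bool (W (r1 + smul x1 e1) (r2 + smul x2 e2) (r3 + smul x3 e3) e4 = 0))"
    unfolding star_count3_def W_def s
    by (simp only: sum_of_bool[OF finite_pts, symmetric] finite.intros sum_pts3[OF d(1)] 1)
  show "star_count3 m B I i3 = (\<Sum>x1\<in>UNIV. \<Sum>x2\<in>UNIV. \<Sum>x4\<in>UNIV.
     of_bool (W (r1 + smul x1 e1) (r2 + smul x2 e2) e3 (r4 + smul x4 e4) = 0))"
    unfolding star_count3_def W_def s
    by (simp only: sum_of_bool[OF finite_pts, symmetric] finite.intros sum_pts3[OF d(2)] 2)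
qed

lemma dodgson:
  "star_dodgson m B i1 i2 i3 i4 \<longleftrightarrow> W e2 r2 e4 r4 = 0"
  "star_dodgson m B i1 i2 i4 i3 \<longleftrightarrow> W e2 r2 r3 e3 = 0"
  "star_dodgson m B i1 i3 i2 i4 \<longleftrightarrow> W e3 e4 r3 r4 = 0"
proof -
  have "B(i1 := e2, i3 := e4) = B(i1 := e2, i2 := r2, i3 := e4, i4 := r4)"
    "B(i1 := e2, i4 := e3) = B(i1 := e2, i2 := r2, i3 := r3, i4 := e3)"
    "B(i1 := e3, i2 := e4) = B(i1 := e3, i2 := e4, i3 := r3, i4 := r4)"
    by (simp_all add: fun_eq_iff neq)
  then show "star_dodgson m B i1 i2 i3 i4 \<longleftrightarrow> W e2 r2 e4 r4 = 0"
    "star_dodgson m B i1 i2 i4 i3 \<longleftrightarrow> W e2 r2 r3 e3 = 0"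
    "star_dodgson m B i1 i3 i2 i4 \<longleftrightarrow> W e3 e4 r3 r4 = 0"
    unfolding star_dodgson_def W_def by (simp_all only:)
qed

lemma A_units:
  assumes "l \<in> I"
  shows "fdet m (units_on (I - {l}) B) = A"
proof -
  have "units_on {i1, i2, i3} B = B(i1 := e1, i2 := e2, i3 := e3, i4 := r4)"
    "units_on {i1, i2, i4} B = B(i1 := e1, i2 := e2, i3 := r3, i4 := e4)"
    "units_on {i1, i3, i4} B = B(i1 := e1, i2 := r2, i3 := e3, i4 := e4)"
    "units_on {i2, i3, i4} B = B(i1 := r1, i2 := e2, i3 := e3, i4 := e4)"
    by (auto simp: units_on_def fun_eq_iff neq)
  moreover have "I - {i4} = {i1, i2, i3}" "I - {i3} = {i1, i2, i4}" "I - {i2} = {i1, i3, i4}" "I - {i1} = {i2, i3, i4}"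
    by (auto simp: neq)
  moreover have "l = i1 \<or> l = i2 \<or> l = i3 \<or> l = i4" using assms by auto
  ultimately show ?thesis using A_eq by (elim disjE) (simp_all only: W_def)
qed

lemma count3_generic_i3: "A \<noteq> 0 \<Longrightarrow> star_count3 m B I i3 = int CARD('k) ^ 2"
proof -
  assume A: "A \<noteq> 0"
  obtain c11 c12 c22 where *: "\<And>x1 x2 x4. W (r1 + smul x1 e1) (r2 + smul x2 e2) e3 (r4 + smul x4 e4) =
      A * ((x1 + c11 + x4) * (x2 + c22 + x4) - (c12 + x4) ^ 2)"
    using generic[OF A] by metis
  show ?thesis unfolding count3(2) * using A by (simp only: mult_eq_0_iff simp_thms right_minus_eq sum_star3_generic)
qed

lemma perm_to:
  assumes "l \<in> I"
  obtains j1 j2 j3 where "star4 m B j1 j2 j3 l xi" "star4 m B j1 j2 l j3 xi" "{j1, j2, j3, l} = I" "{j1, j2, l, j3} = I"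
proof -
  consider "l = i1" | "l = i2" | "l = i3" | "l = i4" using assms by auto
  then show ?thesis
  proof cases
    case 1 show ?thesis by (rule that[of i2 i3 i4]; (rule perm)?) (auto simp: 1 neq)
  next
    case 2 show ?thesis by (rule that[of i1 i3 i4]; (rule perm)?) (auto simp: 2 neq)
  next
    case 3 show ?thesis by (rule that[of i1 i2 i4]; (rule perm)?) (auto simp: 3 neq)
  next
    case 4 show ?thesis by (rule that[of i1 i2 i3]; (rule perm)?) (auto simp: 4 neq)
  qed
qed

lemma A_perm:
  assumes "star4 m B j1 j2 j3 j4 xi" "{j1, j2, j3, j4} = I"
  shows "star4.A m B j1 j2 j3 j4 = A"
proof -
  interpret p: star4 m B j1 j2 j3 j4 xi by fact
  have j: "j4 \<in> I" using assms(2) by blast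
  have "fdet m (units_on (I - {j4}) B) = p.A" using p.A_units[of j4] unfolding assms(2) using j by blast
  with A_units[OF j] show ?thesis by simp
qed

lemma count3_generic: "A \<noteq> 0 \<Longrightarrow> l \<in> I \<Longrightarrow> star_count3 m B I l = int CARD('k) ^ 2"
proof -
  assume A: "A \<noteq> 0" and l: "l \<in> I"
  obtain j1 j2 j3 where j: "star4 m B j1 j2 l j3 xi" "{j1, j2, l, j3} = I" using perm_to[OF l] by metis
  interpret p: star4 m B j1 j2 l j3 xi by fact
  show ?thesis using p.count3_generic_i3 A A_perm[OF j] by (simp add: j(2))
qed

lemma count3_special_i4:
  assumes "A = 0"
  shows "[star_count3 m B I i4 = int CARD('k) ^ 2 * of_bool (\<exists>k\<in>I - {i4}. fdet m (units_on {i4, k} B) \<noteq> 0)] (mod int CARD('k) ^ 3)"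
proof -
  have s: "I - {i4} = {i1, i2, i3}" by (auto simp: neq)
  have f: "(\<exists>k\<in>I - {i4}. fdet m (units_on {i4, k} B) \<noteq> 0) \<longleftrightarrow> W e1 r2 r3 e4 \<noteq> 0 \<or> W r1 e2 r3 e4 \<noteq> 0 \<or> W r1 r2 e3 e4 \<noteq> 0"
    unfolding s W_units[symmetric] by (auto simp: insert_commute)
  have z: "W e1 e2 e3 e4 = 0" by (simp add: W_e4 W_same)
  have "W (r1 + smul x1 e1) (r2 + smul x2 e2) (r3 + smul x3 e3) e4 =
     W r1 r2 r3 e4 + x1 * W e1 r2 r3 e4 + x2 * W r1 e2 r3 e4 + x3 * W r1 r2 e3 e4" for x1 x2 x3
    by (simp add: W_add W_smul A_eq z assms)
  then show ?thesis
    unfolding count3(1) f by (simp only: sum_linear3_zero cong_iff_dvd_diff) simp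
qed

lemma count3_special:
  assumes "A = 0" "l \<in> I"
  shows "[star_count3 m B I l = int CARD('k) ^ 2 * of_bool (\<exists>k\<in>I - {l}. fdet m (units_on {l, k} B) \<noteq> 0)] (mod int CARD('k) ^ 3)"
proof -
  obtain j1 j2 j3 where j: "star4 m B j1 j2 j3 l xi" "{j1, j2, j3, l} = I" using perm_to[OF assms(2)] by metis
  interpret p: star4 m B j1 j2 j3 l xi by fact
  show ?thesis using p.count3_special_i4 assms A_perm[OF j] by (simp add: j(2))
qed

lemma A_units_123: "fdet m (units_on {i1, i2, i3} B) = A"
proof -
  have "I - {i4} = {i1, i2, i3}" by (auto simp: neq)
  then show ?thesis using A_units[of i4] by simp
qed

lemma sum_I: "(\<Sum>l\<in>I. F l) = F i1 + F i2 + F i3 + (F i4 :: int)"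
  by (simp add: neq)

lemma star_cong_generic:
  assumes "A \<noteq> 0"
  shows "star_cong m B i1 i2 i3 i4"
proof -
  obtain c11 c12 c13 c22 c23 c33 where c: "\<And>x1 x2 x3 x4. W (r1 + smul x1 e1) (r2 + smul x2 e2) (r3 + smul x3 e3) (r4 + smul x4 e4) =
      A * ((x1 + c11 + x4) * (x2 + c22 + x4) * (x3 + c33 + x4) + 2 * (c23 + x4) * (c13 + x4) * (c12 + x4)
      - (x1 + c11 + x4) * (c23 + x4) ^ 2 - (x2 + c22 + x4) * (c13 + x4) ^ 2 - (x3 + c33 + x4) * (c12 + x4) ^ 2)"
    "W e2 r2 e4 r4 = A * (c12 - c23)" "W e2 r2 r3 e3 = A * (c12 - c13)" "W e3 e4 r3 r4 = A * (c13 - c23)"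
    using generic[OF assms] by metis
  have n4: "star_count4 m B I = int CARD('k) ^ 3 - 2 * int CARD('k) + int CARD('k) ^ 2 * (of_bool (c12 = c13) + of_bool (c12 = c23) + of_bool (c13 = c23) - of_bool (c12 = c13 \<and> c12 = c23))"
    unfolding count4 c using assms by (simp only: mult_eq_0_iff simp_thms sum_star4_generic)
  have p: "star_dodgson m B i1 i2 i3 i4 \<longleftrightarrow> c12 = c23" "star_dodgson m B i1 i2 i4 i3 \<longleftrightarrow> c12 = c13" "star_dodgson m B i1 i3 i2 i4 \<longleftrightarrow> c13 = c23"
    unfolding dodgson c using assms by auto
  have n3: "(\<Sum>l\<in>I. star_count3 m B I l) = 4 * int CARD('k) ^ 2"
    unfolding sum_I using assms by (simp add: count3_generic)
  show ?thesis
    unfolding star_cong_def Let_def p n4 n3 A_units_123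
    by (auto simp: assms cong_iff_dvd_diff algebra_simps)
qed

text \<open>
  For \<open>A = 0\<close> and \<open>f_12 = w \<noteq> 0\<close> the rows \<open>r1, r2, e3, e4\<close> serve as a basis. The coordinates of \<open>r3\<close> and
  \<open>r4\<close> at \<open>r1\<close> and \<open>r2\<close> are determined, by symmetry, by those of \<open>e1\<close>.
\<close>

lemma coords_rank1:
  assumes "A = 0" and w: "W r1 r2 e3 e4 = w" "w \<noteq> 0"
  obtains a b g33 g34 g44 where
    "eqv e1 (lin r1 r2 e3 e4 0 0 a b)" "eqv e2 (lin r1 r2 e3 e4 0 0 (- 1 - a) (- 1 - b))"
    "eqv r3 (lin r1 r2 e3 e4 (- a) (1 + a) g33 g34)" "eqv r4 (lin r1 r2 e3 e4 (- b) (1 + b) g34 g44)"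
proof -
  define a b where "a = W r1 r2 e1 e4 / w" and "b = W r1 r2 e3 e1 / w"
  have "W r1 e1 e3 e4 = 0"
    using A_eq(4) assms(1) W_swap24[of r1 e1 e3 e2] by (simp add: W_e4 W_same)
  then have 1: "eqv e1 (lin r1 r2 e3 e4 0 0 a b)"
    using eqv_coords[OF w, of e1] A_eq(3) assms(1) by (simp add: a_def b_def)
  have 2: "eqv e2 (lin r1 r2 e3 e4 0 0 (- 1 - a) (- 1 - b))"
  proof -
    have k2: "W e2 u v t = - W e1 u v t - W e3 u v t - W e4 u v t" for u v t
      by (simp add: W_e4)
    have k1: "W e1 u v t = a * W e3 u v t + b * W e4 u v t" for u v t
      using 1 by (simp add: eqv_def lin_def W_add W_smul)
    have "W e2 u v t = (- 1 - a) * W e3 u v t + (- 1 - b) * W e4 u v t" for u v t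
      by (simp only: k2[of u v t] k1[of u v t]) (simp add: algebra_simps)
    then show ?thesis by (simp add: eqv_def lin_def W_add W_smul)
  qed
  have aw: "W r1 r2 e1 e4 = a * w" "W r1 r2 e3 e1 = b * w" using w by (simp_all add: a_def b_def)
  note u = eqv_unit_coords[where ?b1.0 = r1 and ?b2.0 = r2 and ?b3.0 = e3 and ?b4.0 = e4]
  have "W r1 r2 e2 e4 = (- 1 - a) * w" "W r1 r2 e3 e2 = (- 1 - b) * w"
    unfolding W_cong[OF u(1) u(2) 2 u(4)] W_cong[OF u(1) u(2) u(3) 2] W_lin w by (simp_all add: det4_def)
  moreover have "W r3 r2 e3 e4 = - W r1 r2 e1 e4" "W r1 r3 e3 e4 = - W r1 r2 e2 e4"
    "W r4 r2 e3 e4 = - W r1 r2 e3 e1" "W r1 r4 e3 e4 = - W r1 r2 e3 e2"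
    using W_swap13[of r3 r2 e3 e4] W_swap23[of r1 r3 e3 e4] W_swap14[of r4 r2 e3 e4] W_swap24[of r1 r4 e3 e4] W_sym(3-6) by simp_all
  moreover have "W r1 r2 e3 r3 = W r1 r2 r4 e4"
    using W_swap34[of r1 r2 e3 r3] W_swap34[of r1 r2 r4 e4] W_sym(7) by simp
  ultimately have 3: "eqv r3 (lin r1 r2 e3 e4 (- a) (1 + a) (W r1 r2 r3 e4 / w) (W r1 r2 r4 e4 / w))"
    "eqv r4 (lin r1 r2 e3 e4 (- b) (1 + b) (W r1 r2 r4 e4 / w) (W r1 r2 e3 r4 / w))"
    using eqv_coords[OF w, of r3] eqv_coords[OF w, of r4] w(2) aw by (simp_all add: add.commute)
  show ?thesis by (rule that[OF 1 2 3])
qed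

lemma rank1:
  assumes "A = 0" and w: "W r1 r2 e3 e4 = w" "w \<noteq> 0"
  obtains a b g33 g34 g44 where
    "\<And>x1 x2 x3 x4. W (r1 + smul x1 e1) (r2 + smul x2 e2) (r3 + smul x3 e3) (r4 + smul x4 e4) =
      w * ((x3 + (g33 + x1 * a ^ 2 + x2 * (1 + a) ^ 2)) * (x4 + (g44 + x1 * b ^ 2 + x2 * (1 + b) ^ 2))
           - (g34 + x1 * (a * b) + x2 * ((1 + a) * (1 + b))) ^ 2)"
    "W r1 e2 r3 e4 = w * (1 + a) ^ 2" "W r1 e2 e3 r4 = w * (1 + b) ^ 2" "W e1 r2 r3 e4 = w * a ^ 2"
    "W e1 r2 e3 r4 = w * b ^ 2" "W e1 e2 r3 r4 = w * (a - b) ^ 2"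
    "W e2 r2 e4 r4 = w * (b * (1 + a))" "W e2 r2 r3 e3 = w * (a * (1 + b))" "W e3 e4 r3 r4 = w * (b - a)"
proof -
  obtain a b g33 g34 g44 where
    e: "eqv e1 (lin r1 r2 e3 e4 0 0 a b)" "eqv e2 (lin r1 r2 e3 e4 0 0 (- 1 - a) (- 1 - b))"
    and r: "eqv r3 (lin r1 r2 e3 e4 (- a) (1 + a) g33 g34)" "eqv r4 (lin r1 r2 e3 e4 (- b) (1 + b) g34 g44)"
    using coords_rank1[OF assms] by blast
  note u = eqv_unit_coords[where ?b1.0 = r1 and ?b2.0 = r2 and ?b3.0 = e3 and ?b4.0 = e4]
  note R = eqv_row[OF e(1) u(1)] eqv_row[OF e(2) u(2)] eqv_row[OF u(3) r(1)] eqv_row[OF u(4) r(2)]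
  note L = W_lin[of r1 r2 e3 e4, unfolded w]
  show ?thesis
  proof (rule that)
    show "W (r1 + smul x1 e1) (r2 + smul x2 e2) (r3 + smul x3 e3) (r4 + smul x4 e4) =
      w * ((x3 + (g33 + x1 * a ^ 2 + x2 * (1 + a) ^ 2)) * (x4 + (g44 + x1 * b ^ 2 + x2 * (1 + b) ^ 2))
           - (g34 + x1 * (a * b) + x2 * ((1 + a) * (1 + b))) ^ 2)" for x1 x2 x3 x4
      unfolding W_cong[OF R] L by (subst mult.commute, rule arg_cong[of _ _ "(*) w"]) (simp add: det4_def power2_eq_square algebra_simps)
    show "W r1 e2 r3 e4 = w * (1 + a) ^ 2" unfolding W_cong[OF u(1) e(2) r(1) u(4)] L by (simp add: det4_def power2_eq_square algebra_simps)
    show "W r1 e2 e3 r4 = w * (1 + b) ^ 2" unfolding W_cong[OF u(1) e(2) u(3) r(2)] L by (simp add: det4_def power2_eq_square algebra_simps)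
    show "W e1 r2 r3 e4 = w * a ^ 2" unfolding W_cong[OF e(1) u(2) r(1) u(4)] L by (simp add: det4_def power2_eq_square algebra_simps)
    show "W e1 r2 e3 r4 = w * b ^ 2" unfolding W_cong[OF e(1) u(2) u(3) r(2)] L by (simp add: det4_def power2_eq_square algebra_simps)
    show "W e1 e2 r3 r4 = w * (a - b) ^ 2" unfolding W_cong[OF e(1) e(2) r(1) r(2)] L by (simp add: det4_def power2_eq_square algebra_simps)
    show "W e2 r2 e4 r4 = w * (b * (1 + a))" unfolding W_cong[OF e(2) u(2) u(4) r(2)] L by (simp add: det4_def power2_eq_square algebra_simps)
    show "W e2 r2 r3 e3 = w * (a * (1 + b))" unfolding W_cong[OF e(2) u(2) r(1) u(3)] L by (simp add: det4_def power2_eq_square algebra_simps)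
    show "W e3 e4 r3 r4 = w * (b - a)" unfolding W_cong[OF u(3) u(4) r(1) r(2)] L by (simp add: det4_def power2_eq_square algebra_simps)
  qed
qed

end

text \<open>
  The combinatorial identity behind the case \<open>A = 0\<close>, \<open>f_12 \<noteq> 0\<close>. Here \<open>A0\<close>, \<open>B0\<close>, \<open>A1\<close>, \<open>B1\<close>, \<open>E\<close> stand for
  \<open>a = 0\<close>, \<open>b = 0\<close>, \<open>1 + a = 0\<close>, \<open>1 + b = 0\<close>, \<open>a = b\<close>.
\<close>

lemma rank1_indicators:
  assumes "A0 \<Longrightarrow> \<not> A1" "B0 \<Longrightarrow> \<not> B1" "A0 \<Longrightarrow> \<not> B0 \<Longrightarrow> \<not> E" "B0 \<Longrightarrow> \<not> A0 \<Longrightarrow> \<not> E"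
    "A1 \<Longrightarrow> \<not> B1 \<Longrightarrow> \<not> E" "B1 \<Longrightarrow> \<not> A1 \<Longrightarrow> \<not> E" "A1 \<Longrightarrow> B1 \<Longrightarrow> E" "A0 \<Longrightarrow> B0 \<Longrightarrow> E"
  shows "- of_bool ((A0 \<or> B0) \<and> (A1 \<or> B1)) + (of_bool (\<not> (A0 \<and> B0)) + of_bool (\<not> (A1 \<and> B1)) + 1 + 1)
      + of_bool ((B0 \<or> A1) \<and> (A0 \<or> B1)) =
    (4 + of_bool (B0 \<or> A1) + of_bool (A0 \<or> B1) + of_bool E
      - (of_bool E + of_bool B0 + of_bool A0 + of_bool B1 + of_bool A1) :: int)"
  using assms by (cases A0; cases B0; cases A1; cases B1; cases E) simp_all

lemma permute_indicators:
  fixes X S a q :: int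
  assumes "[X + q ^ 2 * of_bool (p1 \<and> p2) = a + q ^ 2 * (4 + of_bool p1 + of_bool p2 + of_bool p3 - S)] (mod q ^ 3)
      \<and> (p1 \<and> p2 \<longrightarrow> p3) \<and> (p1 \<and> p3 \<longrightarrow> p2) \<and> (p2 \<and> p3 \<longrightarrow> p1)"
    and "p1 = P2 \<and> p2 = P1 \<and> p3 = P3 \<or> p1 = P3 \<and> p2 = P2 \<and> p3 = P1"
  shows "[X + q ^ 2 * of_bool (P1 \<and> P2) = a + q ^ 2 * (4 + of_bool P1 + of_bool P2 + of_bool P3 - S)] (mod q ^ 3)
      \<and> (P1 \<and> P2 \<longrightarrow> P3) \<and> (P1 \<and> P3 \<longrightarrow> P2) \<and> (P2 \<and> P3 \<longrightarrow> P1)"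
  using assms(2)
proof
  assume "p1 = P2 \<and> p2 = P1 \<and> p3 = P3"
  with assms(1) show ?thesis by (cases P1; cases P2; cases P3) simp_all
next
  assume "p1 = P3 \<and> p2 = P2 \<and> p3 = P1"
  with assms(1) show ?thesis by (cases P1; cases P2; cases P3) simp_all
qed

context star4
begin

lemma star_cong_rank1:
  assumes "A = 0" and "fdet m (units_on {i3, i4} B) \<noteq> 0"
  shows "star_cong m B i1 i2 i3 i4"
proof -
  define w where "w = W r1 r2 e3 e4"
  have w: "W r1 r2 e3 e4 = w" "w \<noteq> 0" using assms(2) by (simp_all add: w_def W_units)
  obtain a b g33 g34 g44 where ab: "\<And>x1 x2 x3 x4. W (r1 + smul x1 e1) (r2 + smul x2 e2) (r3 + smul x3 e3) (r4 + smul x4 e4) =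
      w * ((x3 + (g33 + x1 * a ^ 2 + x2 * (1 + a) ^ 2)) * (x4 + (g44 + x1 * b ^ 2 + x2 * (1 + b) ^ 2))
           - (g34 + x1 * (a * b) + x2 * ((1 + a) * (1 + b))) ^ 2)"
    "W r1 e2 r3 e4 = w * (1 + a) ^ 2" "W r1 e2 e3 r4 = w * (1 + b) ^ 2" "W e1 r2 r3 e4 = w * a ^ 2"
    "W e1 r2 e3 r4 = w * b ^ 2" "W e1 e2 r3 r4 = w * (a - b) ^ 2"
    "W e2 r2 e4 r4 = w * (b * (1 + a))" "W e2 r2 r3 e3 = w * (a * (1 + b))" "W e3 e4 r3 r4 = w * (b - a)"
    using rank1[OF assms(1) w] by metis
  define z where "z = (of_bool (a * b = 0 \<and> (1 + a) * (1 + b) = 0 \<and> g34 = 0) :: int)"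
  have n4: "star_count4 m B I = int CARD('k) ^ 3 - int CARD('k) ^ 2 * of_bool (a * b = 0 \<and> (1 + a) * (1 + b) = 0)
     + int CARD('k) ^ 3 * z"
    unfolding count4 ab(1) z_def using w(2)
    by (simp only: mult_eq_0_iff[of w] simp_thms right_minus_eq sum_star4_rank1)
  have p: "star_dodgson m B i1 i2 i3 i4 \<longleftrightarrow> b * (1 + a) = 0" "star_dodgson m B i1 i2 i4 i3 \<longleftrightarrow> a * (1 + b) = 0"
    "star_dodgson m B i1 i3 i2 i4 \<longleftrightarrow> b = a"
    unfolding dodgson ab using w(2) by auto
  have f: "fdet m (units_on {i3, i4} B) = w" "fdet m (units_on {i2, i4} B) = w * (1 + a) ^ 2"
     "fdet m (units_on {i2, i3} B) = w * (1 + b) ^ 2" "fdet m (units_on {i1, i4} B) = w * a ^ 2"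
     "fdet m (units_on {i1, i3} B) = w * b ^ 2" "fdet m (units_on {i1, i2} B) = w * (a - b) ^ 2"
    by (simp_all only: W_units ab w)
  have s: "I - {i4} = {i1, i2, i3}" "I - {i3} = {i1, i2, i4}" "I - {i2} = {i1, i3, i4}" "I - {i1} = {i2, i3, i4}"
    by (auto simp: neq)
  let ?n = "\<lambda>l. of_bool (\<exists>k\<in>I - {l}. fdet m (units_on {l, k} B) \<noteq> 0) :: int"
  have n: "?n i3 = 1" "?n i4 = 1" "?n i1 = of_bool (\<not> (a = 0 \<and> b = 0))" "?n i2 = of_bool (\<not> (1 + a = 0 \<and> 1 + b = 0))"
  proof -
    have "{i4, i3} = {i3, i4}" "{i2, i1} = {i1, i2}" "{i3, i1} = {i1, i3}" "{i3, i2} = {i2, i3}" "{i4, i1} = {i1, i4}" "{i4, i2} = {i2, i4}"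
      by auto
    note * = this f
    show "?n i3 = 1" "?n i4 = 1" unfolding s using w(2) by (simp_all add: *)
    show "?n i1 = of_bool (\<not> (a = 0 \<and> b = 0))" unfolding s using w(2) by (auto simp: *)
    show "?n i2 = of_bool (\<not> (1 + a = 0 \<and> 1 + b = 0))" 
    proof -
      have "1 + a = 0 \<Longrightarrow> 1 + b = 0 \<Longrightarrow> a = b" by (metis add_left_cancel)
      then show ?thesis unfolding s using w(2) by (auto simp: *)
    qed
  qed
  have n3: "[(\<Sum>l\<in>I. star_count3 m B I l) = int CARD('k) ^ 2 * (?n i1 + ?n i2 + 1 + 1)] (mod int CARD('k) ^ 3)"
  proof -
    have "[(\<Sum>l\<in>I. star_count3 m B I l) = int CARD('k) ^ 2 * (?n i1 + ?n i2 + ?n i3 + ?n i4)] (mod int CARD('k) ^ 3)"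
      unfolding sum_I distrib_left by (intro cong_add count3_special[OF assms(1)]) simp_all
    then show ?thesis by (simp only: n(1,2))
  qed
  have "[star_count4 m B I + (\<Sum>l\<in>I. star_count3 m B I l) + int CARD('k) ^ 2 * of_bool (b * (1 + a) = 0 \<and> a * (1 + b) = 0) =
    - (int CARD('k) ^ 2) * of_bool (a * b = 0 \<and> (1 + a) * (1 + b) = 0) + int CARD('k) ^ 2 * (?n i1 + ?n i2 + 1 + 1)
     + int CARD('k) ^ 2 * of_bool (b * (1 + a) = 0 \<and> a * (1 + b) = 0)] (mod int CARD('k) ^ 3)"
    by (intro cong_add n3 cong_refl) (simp add: n4 cong_iff_dvd_diff)
  also have "- (int CARD('k) ^ 2) * of_bool (a * b = 0 \<and> (1 + a) * (1 + b) = 0) + int CARD('k) ^ 2 * (?n i1 + ?n i2 + 1 + 1)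
     + int CARD('k) ^ 2 * of_bool (b * (1 + a) = 0 \<and> a * (1 + b) = 0) =
     int CARD('k) ^ 2 * (4 + of_bool (b * (1 + a) = 0) + of_bool (a * (1 + b) = 0) + of_bool (b = a)
       - (of_bool (a = b) + of_bool (b = 0) + of_bool (a = 0) + of_bool (1 + b = 0) + of_bool (1 + a = 0)))"
  proof -
    have "- of_bool (a * b = 0 \<and> (1 + a) * (1 + b) = 0) + (?n i1 + ?n i2 + 1 + 1) + of_bool (b * (1 + a) = 0 \<and> a * (1 + b) = 0) =
     (4 + of_bool (b * (1 + a) = 0) + of_bool (a * (1 + b) = 0) + of_bool (b = a)
       - (of_bool (a = b) + of_bool (b = 0) + of_bool (a = 0) + of_bool (1 + b = 0) + of_bool (1 + a = 0)) :: int)"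
    proof -
      have "a = 0 \<Longrightarrow> 1 + a \<noteq> 0" "b = 0 \<Longrightarrow> 1 + b \<noteq> 0" "a = 0 \<Longrightarrow> b \<noteq> 0 \<Longrightarrow> a \<noteq> b" "b = 0 \<Longrightarrow> a \<noteq> 0 \<Longrightarrow> a \<noteq> b"
         "1 + a = 0 \<Longrightarrow> 1 + b \<noteq> 0 \<Longrightarrow> a \<noteq> b" "1 + b = 0 \<Longrightarrow> 1 + a \<noteq> 0 \<Longrightarrow> a \<noteq> b" "1 + a = 0 \<Longrightarrow> 1 + b = 0 \<Longrightarrow> a = b"
        "a = 0 \<Longrightarrow> b = 0 \<Longrightarrow> a = b"
        by (auto simp: add_eq_0_iff)
      then show ?thesis
        unfolding n mult_eq_0_iff eq_commute[of b a] by (rule rank1_indicators)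
    qed
    from arg_cong[OF this, of "\<lambda>x. int CARD('k) ^ 2 * x"] show ?thesis
      by (simp only: distrib_left mult_minus_right mult_minus_left minus_mult_commute)
  qed
  finally have main: "[star_count4 m B I + (\<Sum>l\<in>I. star_count3 m B I l) + int CARD('k) ^ 2 * of_bool (b * (1 + a) = 0 \<and> a * (1 + b) = 0) =
     int CARD('k) ^ 2 * (4 + of_bool (b * (1 + a) = 0) + of_bool (a * (1 + b) = 0) + of_bool (b = a)
       - (of_bool (a = b) + of_bool (b = 0) + of_bool (a = 0) + of_bool (1 + b = 0) + of_bool (1 + a = 0)))] (mod int CARD('k) ^ 3)" .
  have S: "(\<Sum>T | T \<subseteq> I \<and> card T = 2. of_bool (A = 0 \<and> fdet m (units_on T B) = 0)) =
    (of_bool (a = b) + of_bool (b = 0) + of_bool (a = 0) + of_bool (1 + b = 0) + of_bool (1 + a = 0) :: int)"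
    unfolding sum_pairs4[OF dist] f using w(2) by (simp add: assms(1))
  have imps: "b * (1 + a) = 0 \<and> a * (1 + b) = 0 \<longrightarrow> b = a" "b * (1 + a) = 0 \<and> b = a \<longrightarrow> a * (1 + b) = 0"
    "a * (1 + b) = 0 \<and> b = a \<longrightarrow> b * (1 + a) = 0"
    by (auto simp: add_eq_0_iff)
  have z: "- 2 * int CARD('k) * of_bool (A \<noteq> 0) = 0" using assms(1) by simp
  show ?thesis
    unfolding star_cong_def Let_def p A_units_123 S z add_0_left by (intro conjI main imps)
qed

text \<open>
  If \<open>A\<close> and all \<open>f_ij\<close> vanish, the Dodgson identity shows that the square of this minor is zero.
\<close>

lemma off_diagonal_zero:
  assumes "A = 0" and "\<And>T. T \<subseteq> I \<Longrightarrow> card T = 2 \<Longrightarrow> fdet m (units_on T B) = 0"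
  shows "fdet m (B(i1 := e2, i3 := e3)) = 0"
proof -
  let ?C = "B(i3 := e3)"
  have f: "W e1 r2 e3 r4 = 0" "W r1 r2 e3 e4 = 0"
    unfolding W_units[symmetric] by (rule assms(2); simp add: neq)+
  have C: "?C(i1 := x, i2 := y) = B(i1 := x, i2 := y, i3 := e3, i4 := r4)" "?C(i1 := x) = B(i1 := x, i2 := r2, i3 := e3, i4 := r4)"
    "?C(i2 := y) = B(i1 := r1, i2 := y, i3 := e3, i4 := r4)" for x y
    by (auto simp: fun_eq_iff neq)
  have "fdet m ?C * fdet m (?C(i1 := e1, i2 := e2)) = fdet m (?C(i1 := e1)) * fdet m (?C(i2 := e2)) - fdet m (?C(i1 := e2)) * fdet m (?C(i2 := e1))"
    by (rule fdet_plucker) (auto simp: neq less)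
  then have "fdet m ?C * W e1 e2 e3 r4 = W e1 r2 e3 r4 * W r1 e2 e3 r4 - W e2 r2 e3 r4 * W r1 e1 e3 r4"
    unfolding C(1) unfolding C(2,3) W_def .
  then have "W e2 r2 e3 r4 = 0"
    using assms(1) f W_sym(1) by (simp add: A_eq)
  moreover have "B(i1 := e2, i3 := e3) = B(i1 := e2, i2 := r2, i3 := e3, i4 := r4)"
    by (auto simp: fun_eq_iff neq)
  ultimately show ?thesis by (simp add: W_def)
qed

lemma dodgson_zero:
  assumes "A = 0" and f: "\<And>T. T \<subseteq> I \<Longrightarrow> card T = 2 \<Longrightarrow> fdet m (units_on T B) = 0"
  shows "star_dodgson m B i1 i2 i3 i4"
proof -
  interpret p: star4 m B i3 i2 i1 i4 xi by (rule perm) (auto simp: neq)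
  have pI: "p.I = I" by auto
  have "p.A = 0" using A_perm[OF p.star4_axioms pI] assms(1) by simp
  then have "fdet m (B(i3 := e2, i1 := e1)) = 0" by (rule p.off_diagonal_zero) (use f in \<open>simp only: pI\<close>)
  moreover have "B(i3 := e2, i1 := e1) = B(i1 := e1, i2 := r2, i3 := e2, i4 := r4)"
    by (auto simp: fun_eq_iff neq)
  ultimately have "W e1 r2 e2 r4 = 0" by (simp add: W_def)
  then have "W e2 r2 e1 r4 = 0" using W_swap13[of e2 r2 e1 r4] by simp
  moreover have "W e2 r2 e3 r4 = 0"
  proof -
    have "B(i1 := e2, i3 := e3) = B(i1 := e2, i2 := r2, i3 := e3, i4 := r4)"
      by (auto simp: fun_eq_iff neq)
    then show ?thesis using off_diagonal_zero[OF assms] by (simp add: W_def)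
  qed
  ultimately show ?thesis by (simp add: dodgson W_e4 W_same)
qed

lemma star_cong_zero:
  assumes "A = 0" and f: "\<And>T. T \<subseteq> I \<Longrightarrow> card T = 2 \<Longrightarrow> fdet m (units_on T B) = 0"
  shows "star_cong m B i1 i2 i3 i4"
proof -
  have p1: "star_dodgson m B i1 i2 i3 i4" by (rule dodgson_zero[OF assms])
  have p2: "star_dodgson m B i1 i2 i4 i3"
  proof -
    interpret p: star4 m B i1 i2 i4 i3 xi by (rule perm) (auto simp: neq)
    have pI: "p.I = I" by auto
    show ?thesis using p.dodgson_zero f A_perm[OF p.star4_axioms pI] assms(1) by (simp add: pI)
  qed
  have p3: "star_dodgson m B i1 i3 i2 i4"
  proof -
    interpret p: star4 m B i1 i3 i2 i4 xi by (rule perm) (auto simp: neq)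
    have pI: "p.I = I" by auto
    show ?thesis using p.dodgson_zero f A_perm[OF p.star4_axioms pI] assms(1) by (simp add: pI)
  qed
  have fW: "W r1 r2 e3 e4 = 0" "W r1 e2 r3 e4 = 0" "W r1 e2 e3 r4 = 0" "W e1 r2 r3 e4 = 0" "W e1 r2 e3 r4 = 0" "W e1 e2 r3 r4 = 0"
    unfolding W_units[symmetric] by (rule f; simp add: neq)+
  have z: "W e1 e2 e3 e4 = 0" by (simp add: W_e4 W_same)
  have "W (r1 + smul x1 e1) (r2 + smul x2 e2) (r3 + smul x3 e3) (r4 + smul x4 e4) =
     W r1 r2 r3 r4 + x1 * W e1 r2 r3 r4 + x2 * W r1 e2 r3 r4 + x3 * W r1 r2 e3 r4 + x4 * W r1 r2 r3 e4" for x1 x2 x3 x4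
    by (simp add: W_add W_smul A_eq z assms(1) fW)
  then have n4: "int CARD('k) ^ 3 dvd star_count4 m B I"
    unfolding count4 by (simp only: sum_linear4_zero_dvd)
  have n3: "int CARD('k) ^ 3 dvd star_count3 m B I l" if "l \<in> I" for l
  proof -
    have "\<not> (\<exists>k\<in>I - {l}. fdet m (units_on {l, k} B) \<noteq> 0)"
    proof -
      have "fdet m (units_on {l, k} B) = 0" if "k \<in> I - {l}" for k
        by (rule f) (use \<open>l \<in> I\<close> that in \<open>auto simp: card_insert_if\<close>)
      then show ?thesis by blast
    qed
    then show ?thesis using count3_special[OF assms(1) that] by (simp only: cong_0_iff of_bool_eq mult_zero_right)
  qed
  have "int CARD('k) ^ 3 dvd star_count4 m B I + (\<Sum>l\<in>I. star_count3 m B I l)"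
    by (intro dvd_add n4 dvd_sum n3)
  moreover have "(\<Sum>T | T \<subseteq> I \<and> card T = 2. of_bool (A = 0 \<and> fdet m (units_on T B) = 0)) = (6 :: int)"
    unfolding sum_pairs4[OF dist] using f by (simp add: assms(1) W_units fW)
  ultimately show ?thesis
    unfolding star_cong_def Let_def A_units_123 by (simp add: assms(1) p1 p2 p3 cong_iff_dvd_diff)
qed

lemma dodgson_swap:
  "star_dodgson m B i1 i2 i3 i4 \<longleftrightarrow> star_dodgson m B i2 i1 i4 i3"
  "star_dodgson m B i1 i2 i3 i4 \<longleftrightarrow> star_dodgson m B i1 i4 i3 i2"
  "star_dodgson m B i1 i2 i3 i4 \<longleftrightarrow> star_dodgson m B i3 i4 i1 i2"
proof -
  have "fdet m (\<lambda>i. if i \<in> {i1, i3} then urow ((id(i1 := i2, i3 := i4)) i) else B i) =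
    fdet m (\<lambda>i. if i \<in> (id(i1 := i2, i3 := i4)) ` {i1, i3} then urow ((id(i2 := i1, i4 := i3)) i) else B i)"
    by (rule fdet_unit_rows_sym) (auto simp: neq less sym)
  moreover have "(id(i1 := i2, i3 := i4)) ` {i1, i3} = {i2, i4}" by (auto simp: neq)
  moreover have "(\<lambda>i. if i \<in> {i1, i3} then urow ((id(i1 := i2, i3 := i4)) i) else B i) = B(i1 := e2, i3 := e4)"
    "(\<lambda>i. if i \<in> {i2, i4} then urow ((id(i2 := i1, i4 := i3)) i) else B i) = B(i2 := e1, i4 := e3)"
    by (auto simp: fun_eq_iff neq)
  ultimately have "fdet m (B(i1 := e2, i3 := e4)) = fdet m (B(i2 := e1, i4 := e3))"
    by (simp only:)
  then show "star_dodgson m B i1 i2 i3 i4 \<longleftrightarrow> star_dodgson m B i2 i1 i4 i3"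
    unfolding star_dodgson_def by (simp only:)
  show "star_dodgson m B i1 i2 i3 i4 \<longleftrightarrow> star_dodgson m B i1 i4 i3 i2"
    unfolding star_dodgson_def using fdet_swap[of i1 i3 m B e2 e4] by (simp add: neq less)
  show "star_dodgson m B i1 i2 i3 i4 \<longleftrightarrow> star_dodgson m B i3 i4 i1 i2"
    unfolding star_dodgson_def using fun_upd_twist[OF neq(2), of B e2 e4] by simp
qed

lemma star_cong_perm:
  assumes "star4 m B j1 j2 j3 j4 xi" and I: "{j1, j2, j3, j4} = I" and c: "star_cong m B j1 j2 j3 j4"
    and d: "star_dodgson m B j1 j2 j3 j4 \<longleftrightarrow> p1" "star_dodgson m B j1 j2 j4 j3 \<longleftrightarrow> p2" "star_dodgson m B j1 j3 j2 j4 \<longleftrightarrow> p3"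
    and p: "(p1, p2, p3) = (star_dodgson m B i1 i2 i4 i3, star_dodgson m B i1 i2 i3 i4, star_dodgson m B i1 i3 i2 i4)
      \<or> (p1, p2, p3) = (star_dodgson m B i1 i3 i2 i4, star_dodgson m B i1 i2 i4 i3, star_dodgson m B i1 i2 i3 i4)"
  shows "star_cong m B i1 i2 i3 i4"
proof -
  interpret p: star4 m B j1 j2 j3 j4 xi by fact
  have A: "fdet m (units_on {j1, j2, j3} B) = A"
    using p.A_units_123 A_perm[OF assms(1) I] by simp
  show ?thesis
    unfolding star_cong_def Let_def A_units_123
    by (rule permute_indicators[OF c[unfolded star_cong_def Let_def I A d]]) (use p in \<open>simp only: prod.inject\<close>)
qed

lemma star_cong_swap12:
  assumes "star_cong m B i2 i1 i3 i4"
  shows "star_cong m B i1 i2 i3 i4"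
proof (rule star_cong_perm[OF _ _ assms refl refl refl])
  show s: "star4 m B i2 i1 i3 i4 xi" by (rule perm) (auto simp: neq)
  interpret p: star4 m B i1 i2 i4 i3 xi by (rule perm) (auto simp: neq)
  interpret p': star4 m B i1 i3 i2 i4 xi by (rule perm) (auto simp: neq)
  interpret p'': star4 m B i1 i4 i2 i3 xi by (rule perm) (auto simp: neq)
  show "(star_dodgson m B i2 i1 i3 i4, star_dodgson m B i2 i1 i4 i3, star_dodgson m B i2 i3 i1 i4) =
     (star_dodgson m B i1 i2 i4 i3, star_dodgson m B i1 i2 i3 i4, star_dodgson m B i1 i3 i2 i4) \<or>
     (star_dodgson m B i2 i1 i3 i4, star_dodgson m B i2 i1 i4 i3, star_dodgson m B i2 i3 i1 i4) =
     (star_dodgson m B i1 i3 i2 i4, star_dodgson m B i1 i2 i4 i3, star_dodgson m B i1 i2 i3 i4)"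
    using dodgson_swap(1) p.dodgson_swap(1) p'.dodgson_swap(2) p''.dodgson_swap(3) by simp
qed auto

lemma star_cong_swap23:
  assumes "star_cong m B i1 i3 i2 i4"
  shows "star_cong m B i1 i2 i3 i4"
proof (rule star_cong_perm[OF _ _ assms refl refl refl])
  show s: "star4 m B i1 i3 i2 i4 xi" by (rule perm) (auto simp: neq)
  interpret p: star4 m B i1 i2 i4 i3 xi by (rule perm) (auto simp: neq)
  show "(star_dodgson m B i1 i3 i2 i4, star_dodgson m B i1 i3 i4 i2, star_dodgson m B i1 i2 i3 i4) =
     (star_dodgson m B i1 i2 i4 i3, star_dodgson m B i1 i2 i3 i4, star_dodgson m B i1 i3 i2 i4) \<or>
     (star_dodgson m B i1 i3 i2 i4, star_dodgson m B i1 i3 i4 i2, star_dodgson m B i1 i2 i3 i4) =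
     (star_dodgson m B i1 i3 i2 i4, star_dodgson m B i1 i2 i4 i3, star_dodgson m B i1 i2 i3 i4)"
    using p.dodgson_swap(2) by simp
qed auto

lemma star_cong_swap34:
  assumes "star_cong m B i1 i2 i4 i3"
  shows "star_cong m B i1 i2 i3 i4"
proof (rule star_cong_perm[OF _ _ assms refl refl refl])
  show s: "star4 m B i1 i2 i4 i3 xi" by (rule perm) (auto simp: neq)
  interpret p: star4 m B i1 i3 i2 i4 xi by (rule perm) (auto simp: neq)
  show "(star_dodgson m B i1 i2 i4 i3, star_dodgson m B i1 i2 i3 i4, star_dodgson m B i1 i4 i2 i3) =
     (star_dodgson m B i1 i2 i4 i3, star_dodgson m B i1 i2 i3 i4, star_dodgson m B i1 i3 i2 i4) \<or>
     (star_dodgson m B i1 i2 i4 i3, star_dodgson m B i1 i2 i3 i4, star_dodgson m B i1 i4 i2 i3) =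
     (star_dodgson m B i1 i3 i2 i4, star_dodgson m B i1 i2 i4 i3, star_dodgson m B i1 i2 i3 i4)"
    using p.dodgson_swap(2) by simp
qed auto

end

lemma star_cong_all:
  assumes "star4 m B i1 i2 i3 i4 xi"
  shows "star_cong m B i1 i2 i3 i4"
proof -
  interpret star4 m B i1 i2 i3 i4 xi by fact
  have s: "star4 m B j1 j2 j3 j4 xi" if "distinct [j1, j2, j3, j4]" "{j1, j2, j3, j4} = I" for j1 j2 j3 j4
    using that by (rule perm)
  have r: "star_cong m B j1 j2 j3 j4" if "A = 0" "distinct [j1, j2, j3, j4]" "{j1, j2, j3, j4} = I" "fdet m (units_on {j3, j4} B) \<noteq> 0" for j1 j2 j3 j4
  proof -
    interpret p: star4 m B j1 j2 j3 j4 xi by (rule s) fact+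
    show ?thesis using p.star_cong_rank1 A_perm[OF p.star4_axioms that(3)] that by simp
  qed
  have sw: "star_cong m B j1 j3 j2 j4 \<Longrightarrow> star_cong m B j1 j2 j3 j4" "star_cong m B j2 j1 j3 j4 \<Longrightarrow> star_cong m B j1 j2 j3 j4"
    "star_cong m B j1 j2 j4 j3 \<Longrightarrow> star_cong m B j1 j2 j3 j4"
    if "distinct [j1, j2, j3, j4]" "{j1, j2, j3, j4} = I" for j1 j2 j3 j4
    using star4.star_cong_swap23[OF s[OF that]] star4.star_cong_swap12[OF s[OF that]] star4.star_cong_swap34[OF s[OF that]] by blast+
  show ?thesis
  proof (cases "A = 0")
    case False then show ?thesis by (rule star_cong_generic)
  next
    case A: True
    show ?thesis
    proof (cases "\<forall>T. T \<subseteq> I \<and> card T = 2 \<longrightarrow> fdet m (units_on T B) = 0")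
      case True then show ?thesis using star_cong_zero[OF A] by blast
    next
      case False
      have T: "{T. T \<subseteq> I \<and> card T = 2} = {{i1, i2}, {i1, i3}, {i1, i4}, {i2, i3}, {i2, i4}, {i3, i4}}"
        by (rule pairs4[OF dist])
      from False obtain T where "T \<in> {T. T \<subseteq> I \<and> card T = 2}" and T0: "fdet m (units_on T B) \<noteq> 0" by auto
      then consider "T = {i3, i4}" | "T = {i2, i4}" | "T = {i2, i3}" | "T = {i1, i4}" | "T = {i1, i3}" | "T = {i1, i2}"
        unfolding T by blast
      then show ?thesis
      proof cases
        case 1 then show ?thesis using r[OF A] T0 by (auto simp: neq)
      next
        case 2
        have "star_cong m B i1 i3 i2 i4" by (rule r[OF A]) (use 2 T0 in \<open>auto simp: neq\<close>)
        then show ?thesis by (rule star_cong_swap23)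
      next
        case 3
        have "star_cong m B i1 i4 i2 i3" by (rule r[OF A]) (use 3 T0 in \<open>auto simp: neq\<close>)
        then have "star_cong m B i1 i2 i4 i3" by (rule sw(1)[rotated 2]) (auto simp: neq)
        then show ?thesis by (rule star_cong_swap34)
      next
        case 4
        have "star_cong m B i2 i3 i1 i4" by (rule r[OF A]) (use 4 T0 in \<open>auto simp: neq\<close>)
        then have "star_cong m B i2 i1 i3 i4" by (rule sw(1)[rotated 2]) (auto simp: neq)
        then show ?thesis by (rule star_cong_swap12)
      next
        case 5
        have "star_cong m B i2 i4 i1 i3" by (rule r[OF A]) (use 5 T0 in \<open>auto simp: neq\<close>)
        then have "star_cong m B i2 i1 i4 i3" by (rule sw(1)[rotated 2]) (auto simp: neq)
        then have "star_cong m B i1 i2 i4 i3" by (rule sw(2)[rotated 2]) (auto simp: neq)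
        then show ?thesis by (rule star_cong_swap34)
      next
        case 6
        have "star_cong m B i3 i4 i1 i2" by (rule r[OF A]) (use 6 T0 in \<open>auto simp: neq\<close>)
        then have "star_cong m B i3 i1 i4 i2" by (rule sw(1)[rotated 2]) (auto simp: neq)
        then have "star_cong m B i1 i3 i4 i2" by (rule sw(2)[rotated 2]) (auto simp: neq)
        then have "star_cong m B i1 i3 i2 i4" by (rule sw(3)[rotated 2]) (auto simp: neq)
        then show ?thesis by (rule star_cong_swap23)
      qed
    qed
  qed
qed

section \<open>Summation over the variables outside the star\<close>

lemma sum_pts_Un:
  fixes F :: "(nat \<Rightarrow> 'k::{finite,field}) \<Rightarrow> int"
  assumes "X \<inter> J = {}"
  shows "(\<Sum>a\<in>pts (X \<union> J). F a) = (\<Sum>h\<in>pts X. \<Sum>b\<in>pts J. F (h + b))"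
proof -
  have d: "i \<in> X \<Longrightarrow> i \<notin> J" and d': "i \<in> J \<Longrightarrow> i \<notin> X" for i using assms by auto
  have "(\<Sum>a\<in>pts (X \<union> J). F a) = (\<Sum>(h, b)\<in>pts X \<times> pts J. F (h + b))"
    by (rule sum.reindex_bij_witness[of _ "\<lambda>(h, b). h + b" "\<lambda>a. (\<lambda>i. if i \<in> X then a i else 0, \<lambda>i. if i \<in> J then a i else 0)"])
      (auto simp: pts_def fun_eq_iff d d' intro!: arg_cong[of _ _ F])
  then show ?thesis by (simp add: sum.cartesian_product)
qed

lemma add_diag_add: "add_diag f (h + b) = add_diag (add_diag f h) b"
  by (simp add: add_diag_def smul_def fun_eq_iff algebra_simps)

lemma card_pts_not:
  fixes P :: "(nat \<Rightarrow> 'k::{finite,field}) \<Rightarrow> bool"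
  assumes "finite X"
  shows "int (card {h \<in> pts X. \<not> P h}) = int CARD('k) ^ card X - int (card {h \<in> pts X. P h})"
proof -
  have "card (pts X :: (nat \<Rightarrow> 'k) set) = card {h \<in> pts X. P h} + card {h \<in> pts X. \<not> P h}"
    using finite_pts[OF assms, where 'k = 'k] by (subst card_Un_disjoint[symmetric]) (auto intro: arg_cong[of _ _ card])
  then show ?thesis by (simp add: card_pts[OF assms] flip: of_nat_power)
qed

text \<open>
  The symmetric graph matrix of a graph with \<open>N\<close> edges, without the edge variables: indices below \<open>N\<close> belong to
  edges, the other ones to all vertices but one, and the diagonal blocks vanish. The edges \<open>i1, \<dots>, i4\<close>
  form a star, as witnessed by \<open>xi\<close>.
\<close>

locale bipartite_star =
  fixes m N :: nat and B :: "nat \<Rightarrow> nat \<Rightarrow> 'k::{finite,field}" and i1 i2 i3 i4 :: nat and xi :: "nat \<Rightarrow> 'k"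
  assumes sym: "\<And>i j. B i j = B j i"
    and edges: "\<And>i j. i < N \<Longrightarrow> j < N \<Longrightarrow> B i j = 0"
    and verts: "\<And>i j. N \<le> i \<Longrightarrow> N \<le> j \<Longrightarrow> B i j = 0"
    and size: "N + 4 \<le> m" "5 \<le> N"
    and dist: "distinct [i1, i2, i3, i4]" and lt: "{i1, i2, i3, i4} \<subseteq> {..<N}"
    and xi0: "\<And>i. i < N \<Longrightarrow> xi i = 0"
    and xi_row: "\<And>j. j < m \<Longrightarrow> (\<Sum>k<m. xi k * B k j) = of_bool (j \<in> {i1, i2, i3, i4})"
begin

abbreviation "J4 \<equiv> {i1, i2, i3, i4}"
abbreviation "X \<equiv> {..<N} - J4"
abbreviation "C \<equiv> {N..<m}"

lemma card_I: "card J4 = 4"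
  using dist by simp

lemma finite_X: "finite X" by simp

lemma card_X: "card X = N - 4" "1 \<le> card X"
  using card_Diff_subset[of J4 "{..<N}"] lt card_I size by auto

lemma C: "C \<subseteq> {..<m}" "4 \<le> card C" "X \<inter> C = {}" "X \<subseteq> {..<m}" "J4 \<subseteq> {..<m}" "J4 \<inter> C = {}"
  using size lt by auto

lemma star4: "h \<in> pts X \<Longrightarrow> star4 m (add_diag B h) i1 i2 i3 i4 xi"
proof
  fix j assume j: "j < m" and h: "h \<in> pts X"
  have "xi k * add_diag B h k j = xi k * B k j" for k
  proof (cases "k < N")
    case False
    then have "h k = 0" using h by (auto simp: pts_def)
    then show ?thesis by (simp add: add_diag_def smul_def)
  qed (simp add: xi0)
  then have "(\<Sum>k<m. xi k * add_diag B h k j) = (\<Sum>k<m. xi k * B k j)" by (simp only:)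
  then show "(\<Sum>k<m. xi k * add_diag B h k j) = of_bool (j \<in> J4)"
    by (simp only: xi_row[OF j])
next
  fix i assume "i \<in> J4"
  then show "xi i = 0" using lt xi0 by blast
qed (use dist C sym in \<open>auto intro: add_diag_sym\<close>)

lemma dvd_units:
  assumes "l \<in> J4"
  shows "int CARD('k) ^ 2 dvd int (card {a \<in> pts X. fdet m (units_on (J4 - {l}) (add_diag B a)) \<noteq> 0})"
proof -
  have "int CARD('k) ^ 2 dvd int (card {a \<in> pts X. fdet m (add_diag (units_on (J4 - {l}) B) a) \<noteq> 0})"
    by (rule square_dvd_card_fdet_nonzero[where C = C and R = "{l}"]) (use C sym verts in auto)
  moreover have "add_diag (units_on (J4 - {l}) B) a = units_on (J4 - {l}) (add_diag B a)" if "a \<in> pts X" for a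
    by (rule add_diag_units_on) (use that in \<open>auto simp: pts_def\<close>)
  ultimately show ?thesis by (simp cong: conj_cong)
qed

lemma dvd_pair:
  assumes T: "T \<subseteq> J4" "card T = 2"
  shows "int CARD('k) dvd int (card {a \<in> pts X. fdet m (units_on {i1, i2, i3} (add_diag B a)) \<noteq> 0 \<or> fdet m (units_on T (add_diag B a)) \<noteq> 0})"
proof -
  have fT: "finite T" using T finite_subset by blast
  have "card (J4 - T) = 2" using T card_I by (simp add: card_Diff_subset fT)
  then obtain y z where yz: "J4 - T = {y, z}" "y \<noteq> z" by (auto simp: card_2_iff)
  have y: "y \<in> J4" "y \<notin> T" "z \<in> J4" "J4 - {z} = insert y T" using yz T by auto
  have "int CARD('k) dvd int (card {a \<in> pts X. fdet m (add_diag (units_on T B) a) \<noteq> 0 \<or> fdet m (add_diag ((units_on T B)(y := urow y)) a) \<noteq> 0})"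
  proof (rule dvd_card_fdet_pair_nonzero[where C = C and R = "{z}"])
    fix i j assume *: "i < m" "i \<notin> X" "i \<notin> {z}" "i \<noteq> y" "i \<notin> T" "j \<in> C"
    then have "i \<notin> J4" using yz by auto
    then show "B i j = 0" using * by (intro verts) auto
  qed (use C T y sym in auto)
  moreover have "fdet m (add_diag ((units_on T B)(y := urow y)) a) = fdet m (units_on {i1, i2, i3} (add_diag B a))"
    "add_diag (units_on T B) a = units_on T (add_diag B a)" if "a \<in> pts X" for a
  proof -
    interpret star4 m "add_diag B a" i1 i2 i3 i4 xi by (rule star4) fact
    have "add_diag ((units_on T B)(y := urow y)) a = add_diag (units_on (J4 - {z}) B) a"
      unfolding y units_on_upd[OF y(2)] ..
    also have "\<dots> = units_on (J4 - {z}) (add_diag B a)"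
      by (rule add_diag_units_on) (use that in \<open>auto simp: pts_def\<close>)
    finally show "fdet m (add_diag ((units_on T B)(y := urow y)) a) = fdet m (units_on {i1, i2, i3} (add_diag B a))"
      using A_units[OF y(3)] A_units_123 by simp
    show "add_diag (units_on T B) a = units_on T (add_diag B a)"
      by (rule add_diag_units_on) (use that T in \<open>auto simp: pts_def\<close>)
  qed
  ultimately show ?thesis by (simp add: disj_commute cong: conj_cong)
qed

lemma dvd_dodgson:
  assumes "distinct [i, j, k, l]" "{i, j, k, l} = J4"
  shows "int CARD('k) dvd int (card {a \<in> pts X. \<not> star_dodgson m (add_diag B a) i j k l})"
proof -
  have "int CARD('k) dvd int (card {a \<in> pts X. fdet m (add_diag (B(i := urow j, k := urow l)) a) \<noteq> 0})"
  proof (rule dvd_card_fdet_nonzero[where C = C and R = "{j, l}"])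
    fix x c assume *: "x < m" "x \<notin> X" "x \<notin> {j, l}" "c \<in> C"
    have "j \<notin> C" "l \<notin> C" using assms C by auto
    moreover have "x \<noteq> i \<Longrightarrow> x \<noteq> k \<Longrightarrow> x \<notin> J4" using * assms(2) by auto
    ultimately show "(B(i := urow j, k := urow l)) x c = 0"
      using * by (auto simp: urow_def intro!: verts)
  next
    show "card {j, l} < card C" using C(2) card_insert_le_m1[of 2 "{l}" j] by simp
  qed (use C in auto)
  moreover have "add_diag (B(i := urow j, k := urow l)) a = (add_diag B a)(i := urow j, k := urow l)" if "a \<in> pts X" for a
  proof -
    have "i \<in> J4" "k \<in> J4" using assms(2) by auto
    then have "a i = 0" "a k = 0" using that by (auto simp: pts_def)
    then show ?thesis by (simp add: add_diag_upd(2))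
  qed
  ultimately show ?thesis unfolding star_dodgson_def by (simp cong: conj_cong del: fun_upd_apply)
qed

lemma q_dvd: "int CARD('k) dvd int CARD('k) ^ card X"
  using card_X(2) by (intro dvd_power) auto

lemma sum_count4: "int (card {a \<in> pts {..<N}. fdet m (add_diag B a) = 0}) = (\<Sum>h\<in>pts X. star_count4 m (add_diag B h) J4)"
proof -
  have e: "{..<N} = X \<union> J4" using lt by auto
  have "int (card {a \<in> pts {..<N}. fdet m (add_diag B a) = 0}) = (\<Sum>a\<in>pts {..<N}. of_bool (fdet m (add_diag B a) = 0))"
    by (simp only: sum_of_bool finite_pts finite_lessThan)
  also have "\<dots> = (\<Sum>a\<in>pts (X \<union> J4). of_bool (fdet m (add_diag B a) = 0))"
    by (simp only: e[symmetric])
  also have "\<dots> = (\<Sum>h\<in>pts X. \<Sum>b\<in>pts J4. of_bool (fdet m (add_diag (add_diag B h) b) = 0))"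
    by (subst sum_pts_Un) (auto simp only: add_diag_add)
  also have "\<dots> = (\<Sum>h\<in>pts X. star_count4 m (add_diag B h) J4)"
    by (simp only: star_count4_def sum_of_bool finite_pts finite.intros)
  finally show ?thesis .
qed

lemma sum_count3:
  assumes "l \<in> J4"
  shows "int (card {a \<in> pts ({..<N} - {l}). fdet m (add_diag (B(l := urow l)) a) = 0}) = (\<Sum>h\<in>pts X. star_count3 m (add_diag B h) J4 l)"
proof -
  have e: "{..<N} - {l} = X \<union> (J4 - {l})" using lt assms by auto
  have "int (card {a \<in> pts ({..<N} - {l}). fdet m (add_diag (B(l := urow l)) a) = 0}) =
     (\<Sum>a\<in>pts ({..<N} - {l}). of_bool (fdet m (add_diag (B(l := urow l)) a) = 0))"
    by (simp only: sum_of_bool finite_pts finite_lessThan finite_Diff)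
  also have "\<dots> = (\<Sum>a\<in>pts (X \<union> (J4 - {l})). of_bool (fdet m (add_diag (B(l := urow l)) a) = 0))"
    by (simp only: e)
  also have "\<dots> = (\<Sum>h\<in>pts X. \<Sum>b\<in>pts (J4 - {l}). of_bool (fdet m (add_diag (add_diag (B(l := urow l)) h) b) = 0))"
    by (subst sum_pts_Un) (auto simp only: add_diag_add)
  also have "\<dots> = (\<Sum>h\<in>pts X. \<Sum>b\<in>pts (J4 - {l}). of_bool (fdet m (add_diag ((add_diag B h)(l := urow l)) b) = 0))"
  proof (intro sum.cong refl)
    fix h b :: "nat \<Rightarrow> 'k" assume "h \<in> pts X"
    then have "h l = 0" using assms by (auto simp: pts_def)
    then show "(of_bool (fdet m (add_diag (add_diag (B(l := urow l)) h) b) = 0) :: int) = of_bool (fdet m (add_diag ((add_diag B h)(l := urow l)) b) = 0)"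
      by (simp only: add_diag_upd(2))
  qed
  also have "\<dots> = (\<Sum>h\<in>pts X. star_count3 m (add_diag B h) J4 l)"
    by (simp only: star_count3_def sum_of_bool finite_pts finite.intros finite_Diff)
  finally show ?thesis .
qed

lemma dvd_indicator:
  fixes P :: "(nat \<Rightarrow> 'k) \<Rightarrow> bool"
  assumes "int CARD('k) dvd int (card {a \<in> pts X. \<not> P a})"
  shows "int CARD('k) dvd (\<Sum>h\<in>pts X. of_bool (P h))"
proof -
  have "(\<Sum>h\<in>pts X. of_bool (P h)) = int CARD('k) ^ card X - int (card {h \<in> pts X. \<not> P h})"
    using card_pts_not[OF finite_X, of "\<lambda>h. \<not> P h"] by (simp only: sum_of_bool finite_pts finite_X not_not)
  then show ?thesis using q_dvd assms by simp
qed

theorem bipartite_star_cong: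
  "[int (card {a \<in> pts {..<N}. fdet m (add_diag B a) = 0})
    + (\<Sum>l\<in>J4. int (card {a \<in> pts ({..<N} - {l}). fdet m (add_diag (B(l := urow l)) a) = 0}))
    + int CARD('k) ^ 2 * int (card {a \<in> pts X. star_dodgson m (add_diag B a) i1 i2 i3 i4 \<and> star_dodgson m (add_diag B a) i1 i2 i4 i3})
    = 0] (mod int CARD('k) ^ 3)"
proof -
  let ?q = "int CARD('k)"
  let ?p1 = "\<lambda>h. star_dodgson m (add_diag B h) i1 i2 i3 i4"
  let ?p2 = "\<lambda>h. star_dodgson m (add_diag B h) i1 i2 i4 i3"
  let ?p3 = "\<lambda>h. star_dodgson m (add_diag B h) i1 i3 i2 i4"
  let ?a = "\<lambda>h. fdet m (units_on {i1, i2, i3} (add_diag B h))"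
  let ?f = "\<lambda>T h. fdet m (units_on T (add_diag B h))"
  have "[(\<Sum>h\<in>pts X. star_count4 m (add_diag B h) J4 + (\<Sum>l\<in>J4. star_count3 m (add_diag B h) J4 l) + ?q ^ 2 * of_bool (?p1 h \<and> ?p2 h))
     = (\<Sum>h\<in>pts X. - 2 * ?q * of_bool (?a h \<noteq> 0) + ?q ^ 2 * (4 + of_bool (?p1 h) + of_bool (?p2 h) + of_bool (?p3 h)
            - (\<Sum>T | T \<subseteq> J4 \<and> card T = 2. of_bool (?a h = 0 \<and> ?f T h = 0))))] (mod ?q ^ 3)"
    by (rule cong_sum) (rule star_cong_all[OF star4, unfolded star_cong_def Let_def, THEN conjunct1])
  also have "(\<Sum>h\<in>pts X. - 2 * ?q * of_bool (?a h \<noteq> 0) + ?q ^ 2 * (4 + of_bool (?p1 h) + of_bool (?p2 h) + of_bool (?p3 h)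
            - (\<Sum>T | T \<subseteq> J4 \<and> card T = 2. of_bool (?a h = 0 \<and> ?f T h = 0)))) =
     - 2 * ?q * int (card {h \<in> pts X. ?a h \<noteq> 0}) + ?q ^ 2 * (4 * ?q ^ card X
         + (\<Sum>h\<in>pts X. of_bool (?p1 h)) + (\<Sum>h\<in>pts X. of_bool (?p2 h)) + (\<Sum>h\<in>pts X. of_bool (?p3 h))
         - (\<Sum>T | T \<subseteq> J4 \<and> card T = 2. \<Sum>h\<in>pts X. of_bool (?a h = 0 \<and> ?f T h = 0)))"
  proof -
    have swap: "(\<Sum>T | T \<subseteq> J4 \<and> card T = 2. \<Sum>h\<in>pts X. of_bool (?a h = 0 \<and> ?f T h = 0)) =
       (\<Sum>h\<in>pts X. \<Sum>T | T \<subseteq> J4 \<and> card T = 2. of_bool (?a h = 0 \<and> ?f T h = 0) :: int)"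
      by (rule sum.swap)
    have four: "4 * ?q ^ card X = (\<Sum>h\<in>(pts X :: (nat \<Rightarrow> 'k) set). 4)" by (simp add: card_pts)
    show ?thesis
      unfolding swap four sum_of_bool[OF finite_pts[OF finite_X], symmetric]
      by (simp only: sum.distrib sum_subtractf sum_distrib_left[symmetric])
  qed
  also have "[\<dots> = 0] (mod ?q ^ 3)"
  proof -
    have "J4 - {i4} = {i1, i2, i3}" using dist by auto
    then have "?q ^ 2 dvd int (card {h \<in> pts X. ?a h \<noteq> 0})" using dvd_units[of i4] by simp
    then have "?q * ?q ^ 2 dvd ?q * int (card {h \<in> pts X. ?a h \<noteq> 0})" by (rule mult_dvd_mono[OF dvd_refl])
    then have 1: "?q ^ 3 dvd - 2 * ?q * int (card {h \<in> pts X. ?a h \<noteq> 0})"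
      by (simp add: power3_eq_cube power2_eq_square mult.assoc dvd_mult)
    have p: "?q dvd (\<Sum>h\<in>pts X. of_bool (?p1 h))" "?q dvd (\<Sum>h\<in>pts X. of_bool (?p2 h))" "?q dvd (\<Sum>h\<in>pts X. of_bool (?p3 h))"
      by (rule dvd_indicator, rule dvd_dodgson; use dist in auto)+
    have T: "?q dvd (\<Sum>h\<in>pts X. of_bool (?a h = 0 \<and> ?f T h = 0))" if "T \<subseteq> J4" "card T = 2" for T
      by (rule dvd_indicator) (use dvd_pair[OF that] in simp)
    have "?q dvd (\<Sum>T | T \<subseteq> J4 \<and> card T = 2. \<Sum>h\<in>pts X. of_bool (?a h = 0 \<and> ?f T h = 0))"
      by (rule dvd_sum) (rule T, simp_all only: mem_Collect_eq)
    then have "?q dvd 4 * ?q ^ card X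
         + (\<Sum>h\<in>pts X. of_bool (?p1 h)) + (\<Sum>h\<in>pts X. of_bool (?p2 h)) + (\<Sum>h\<in>pts X. of_bool (?p3 h))
         - (\<Sum>T | T \<subseteq> J4 \<and> card T = 2. \<Sum>h\<in>pts X. of_bool (?a h = 0 \<and> ?f T h = 0))" (is "_ dvd ?E")
      by (rule dvd_diff[OF dvd_add[OF dvd_add[OF dvd_add[OF dvd_mult[OF q_dvd] p(1)] p(2)] p(3)]])
    then have "?q ^ 2 * ?q dvd ?q ^ 2 * ?E" by (rule mult_dvd_mono[OF dvd_refl])
    then have 2: "?q ^ 3 dvd ?q ^ 2 * ?E" by (simp add: power3_eq_cube power2_eq_square)
    show ?thesis unfolding cong_0_iff by (rule dvd_add[OF 1 2])
  qed
  also have "(\<Sum>h\<in>pts X. star_count4 m (add_diag B h) J4 + (\<Sum>l\<in>J4. star_count3 m (add_diag B h) J4 l) + ?q ^ 2 * of_bool (?p1 h \<and> ?p2 h)) =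
    (\<Sum>h\<in>pts X. star_count4 m (add_diag B h) J4) + (\<Sum>l\<in>J4. \<Sum>h\<in>pts X. star_count3 m (add_diag B h) J4 l)
      + ?q ^ 2 * int (card {h \<in> pts X. ?p1 h \<and> ?p2 h})"
  proof -
    have swap: "(\<Sum>l\<in>J4. \<Sum>h\<in>pts X. star_count3 m (add_diag B h) J4 l) = (\<Sum>h\<in>pts X. \<Sum>l\<in>J4. star_count3 m (add_diag B h) J4 l)"
      by (rule sum.swap)
    show ?thesis
      unfolding swap sum_of_bool[OF finite_pts[OF finite_X], symmetric]
      by (simp only: sum.distrib sum_distrib_left[symmetric])
  qed
  finally show ?thesis by (simp only: sum_count4 sum_count3 cong: sum.cong)
qed

text \<open>
  By this divisibility the division in the definition of the \<open>c_2\<close>-invariant is exact for the graphs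
  with one edge of the star deleted.
\<close>

lemma square_dvd_deleted:
  assumes "l \<in> J4"
  shows "int CARD('k) ^ 2 dvd int (card {a \<in> pts ({..<N} - {l}). fdet m (add_diag (B(l := urow l)) a) = 0})"
proof -
  have u: "B(l := urow l) = units_on {l} B" by (auto simp: units_on_def)
  have lN: "l < N" using assms lt by auto
  have "int CARD('k) ^ 2 dvd int (card {a \<in> pts ({..<N} - {l}). fdet m (add_diag (B(l := urow l)) a) \<noteq> 0})"
    unfolding u
  proof (rule square_dvd_card_fdet_nonzero[where C = C and R = "{}"])
    fix i j assume "i \<notin> {..<N} - {l}" "i \<notin> {l}" "j \<in> C"
    then show "B i j = 0" by (intro verts) auto
  qed (use size lN in \<open>auto simp: sym\<close>)
  moreover have "int CARD('k) ^ 2 dvd int CARD('k) ^ card ({..<N} - {l})"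
    using size lN by (intro le_imp_power_dvd) auto
  ultimately show ?thesis
    using card_pts_not[of "{..<N} - {l}" "\<lambda>a. fdet m (add_diag (B(l := urow l)) a) \<noteq> 0"] by simp
qed

end

section \<open>Unimodularity\<close>

lemma fdet_units: "fdet m urow = 1"
proof -
  have "mat m m (\<lambda>(i, j). urow i j :: 'a) = 1\<^sub>m m" by (intro eq_matI) (auto simp: urow_def)
  then show ?thesis by (simp add: fdet_det)
qed

lemma units_on_insert_upd: "units_on S (f(x := urow x)) = units_on (insert x S) f"
  by (auto simp: units_on_def)

lemma fdet_add_diag_expand:
  fixes f :: "nat \<Rightarrow> nat \<Rightarrow> 'a::comm_ring_1"
  assumes "finite J" "J \<subseteq> {..<m}"
  shows "fdet m (add_diag f (\<lambda>i. if i \<in> J then a i else 0)) = (\<Sum>S\<in>Pow J. (\<Prod>i\<in>S. a i) * fdet m (units_on S f))"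
  using assms
proof (induction J arbitrary: f rule: finite_induct)
  case empty
  have "add_diag f (\<lambda>i. 0) = f" by (simp add: add_diag_def smul_def fun_eq_iff)
  then show ?case by (simp add: units_on_def)
next
  case (insert x J)
  let ?b = "\<lambda>i. if i \<in> J then a i else 0"
  have "(\<lambda>i. if i \<in> insert x J then a i else 0) = ?b(x := a x)" by auto
  then have "fdet m (add_diag f (\<lambda>i. if i \<in> insert x J then a i else 0)) =
    a x * fdet m (add_diag (f(x := urow x)) ?b) + fdet m (add_diag f ?b)"
    using insert.hyps insert.prems by (simp only: fdet_add_diag_upd) (subst fdet_add_diag_upd, auto)
  also have "fdet m (add_diag (f(x := urow x)) ?b) = (\<Sum>S\<in>Pow J. (\<Prod>i\<in>S. a i) * fdet m (units_on (insert x S) f))"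
    by (rule insert.IH[of "f(x := urow x)", unfolded units_on_insert_upd]) (use insert.prems in auto)
  also have "fdet m (add_diag f ?b) = (\<Sum>S\<in>Pow J. (\<Prod>i\<in>S. a i) * fdet m (units_on S f))"
    using insert by simp
  also have "a x * (\<Sum>S\<in>Pow J. (\<Prod>i\<in>S. a i) * fdet m (units_on (insert x S) f)) =
    (\<Sum>S\<in>insert x ` Pow J. (\<Prod>i\<in>S. a i) * fdet m (units_on S f))"
  proof -
    have inj: "inj_on (insert x) (Pow J)" using insert.hyps(2) by (auto simp: inj_on_def)
    have "a x * ((\<Prod>i\<in>S. a i) * fdet m (units_on (insert x S) f)) = (\<Prod>i\<in>insert x S. a i) * fdet m (units_on (insert x S) f)" if "S \<in> Pow J" for S
    proof -
      have "finite S" "x \<notin> S" using that insert.hyps finite_subset by auto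
      then show ?thesis by (simp add: mult.assoc)
    qed
    then show ?thesis by (simp add: sum.reindex[OF inj] sum_distrib_left)
  qed
  also have "(\<Sum>S\<in>insert x ` Pow J. (\<Prod>i\<in>S. a i) * fdet m (units_on S f)) + (\<Sum>S\<in>Pow J. (\<Prod>i\<in>S. a i) * fdet m (units_on S f)) =
     (\<Sum>S\<in>Pow (insert x J). (\<Prod>i\<in>S. a i) * fdet m (units_on S f))"
  proof -
    have "Pow (insert x J) = insert x ` Pow J \<union> Pow J" by (auto simp: Pow_insert)
    moreover have "insert x ` Pow J \<inter> Pow J = {}" using insert.hyps(2) by auto
    ultimately show ?thesis using insert.hyps(1) by (simp add: sum.union_disjoint)
  qed
  finally show ?case .
qed

text \<open>
  The symmetric matrix with off-diagonal block \<open>E\<close> between \<open>T\<close> and \<open>V\<close>, vanishing diagonal blocks, and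
  unit rows outside \<open>T \<union> V\<close>.
\<close>

definition bip :: "nat set \<Rightarrow> nat set \<Rightarrow> (nat \<Rightarrow> nat \<Rightarrow> 'a::comm_ring_1) \<Rightarrow> nat \<Rightarrow> nat \<Rightarrow> 'a" where
  "bip T V E = (\<lambda>i j. if i \<in> T then (if j \<in> V then E i j else 0)
     else if i \<in> V then (if j \<in> T then E j i else 0) else urow i j)"

lemma fdet_bip_pivot:
  fixes E :: "nat \<Rightarrow> nat \<Rightarrow> 'a::comm_ring_1"
  assumes TV: "T \<inter> V = {}" "T \<union> V \<subseteq> {..<m}" and t: "t \<in> T" and v: "v \<in> V"
    and c: "E t v = c" "c * c = 1" and z: "\<And>v'. v' \<in> V \<Longrightarrow> v' \<noteq> v \<Longrightarrow> E t v' = 0"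
  shows "fdet m (bip T V E) = - fdet m (bip (T - {t}) (V - {v}) E)"
proof -
  have tv: "t \<noteq> v" "t < m" "v < m" "t \<notin> V" "v \<notin> T" using assms by auto
  let ?g = "bip (T - {t}) (V - {v}) E"
  let ?f = "?g(t := smul c (urow v), v := smul c (urow t))"
  have "fdet m (bip T V E) = fdet m ?f"
  proof (rule fdet_cong_prod)
    fix p assume p: "p permutes {..<m}"
    note inj = permutes_inj[OF p, THEN injD]
    show "(\<Prod>i<m. bip T V E i (p i)) = (\<Prod>i<m. ?f i (p i))"
    proof (cases "p t = v \<and> p v = t")
      case True
      show ?thesis
      proof (rule prod.cong[OF refl])
        fix i assume "i \<in> {..<m}"
        show "bip T V E i (p i) = ?f i (p i)"
        proof (cases "i = t \<or> i = v")
          case False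
          then have "p i \<noteq> t" "p i \<noteq> v" using True inj by metis+
          then show ?thesis using False by (auto simp: bip_def)
        next
          case i: True
          then show ?thesis using True tv t v c by (auto simp: bip_def smul_def urow_def)
        qed
      qed
    next
      case False
      have "\<exists>i<m. bip T V E i (p i) = 0"
      proof (cases "p t = v")
        case pt: False
        then have "bip T V E t (p t) = 0" using t z by (auto simp: bip_def)
        then show ?thesis using tv by blast
      next
        case pt: True
        then have pv: "p v \<noteq> t" using False by simp
        obtain i where i: "p i = t" "i < m"
          using permutes_surj[OF p] tv(2) permutes_lessThan[OF permutes_inv[OF p]] permutes_inverses(1)[OF p] by metis
        then have "i \<noteq> v" "i \<noteq> t" using pv pt tv by auto
        then have "bip T V E i (p i) = 0" using i(1) tv t z by (auto simp: bip_def urow_def)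
        then show ?thesis using i by blast
      qed
      moreover have "\<exists>i<m. ?f i (p i) = 0"
      proof (cases "p t = v")
        case pt: False
        then have "?f t (p t) = 0" using tv by (auto simp: smul_def urow_def)
        then show ?thesis using tv by blast
      next
        case pt: True
        then have "?f v (p v) = 0" using False by (auto simp: smul_def urow_def)
        then show ?thesis using tv by blast
      qed
      ultimately have "(\<Prod>i<m. bip T V E i (p i)) = 0" "(\<Prod>i<m. ?f i (p i)) = 0"
        by (auto intro!: prod_zero)
      then show ?thesis by simp
    qed
  qed
  also have "\<dots> = c * fdet m (?g(t := smul c (urow v), v := urow t))" using tv by (simp only: fdet_row_smul)
  also have "\<dots> = c * - fdet m (?g(t := urow t, v := smul c (urow v)))" using tv by (subst fdet_swap) auto
  also have "\<dots> = - (c * c) * fdet m (?g(t := urow t, v := urow v))" using tv by (simp only: fdet_row_smul) simp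
  also have "?g(t := urow t, v := urow v) = ?g" using tv by (auto simp: bip_def fun_eq_iff)
  finally show ?thesis using c by simp
qed

text \<open>
  If every row of \<open>E\<close> looks like a row of an incidence matrix with some columns removed, then \<open>E\<close> is totally
  unimodular, and the determinant is up to a fixed sign the square of that of \<open>E\<close>, or zero if \<open>E\<close> is
  not square. No assumption relates \<open>card T\<close> to \<open>card V\<close>.
\<close>

lemma fdet_bip_unimodular:
  fixes E :: "nat \<Rightarrow> nat \<Rightarrow> 'a::field"
  assumes "finite V" "T \<inter> V = {}" "T \<union> V \<subseteq> {..<m}"
    and "\<And>t. t \<in> T \<Longrightarrow> \<exists>u w c. c * c = 1 \<and> (\<forall>v\<in>V. E t v = c * (of_bool (v = u) - of_bool (v = w)))"
  shows "fdet m (bip T V E) \<in> {0, (- 1) ^ card V}"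
  using assms
proof (induction "card V" arbitrary: T V)
  case 0
  then have V: "V = {}" by simp
  show ?case
  proof (cases "T = {}")
    case True
    then have "bip T V E = urow" using V by (auto simp: bip_def fun_eq_iff)
    then show ?thesis using V by (simp add: fdet_units)
  next
    case False
    then obtain t where t: "t \<in> T" by blast
    then have "fdet m (bip T V E) = 0"
      using 0 V by (intro fdet_row_zero[of t]) (auto simp: bip_def)
    then show ?thesis by simp
  qed
next
  case (Suc n)
  show ?case
  proof (cases "\<exists>t\<in>T. \<exists>v\<in>V. E t v \<noteq> 0 \<and> (\<forall>v'\<in>V. v' \<noteq> v \<longrightarrow> E t v' = 0)")
    case True
    then obtain t v where tv: "t \<in> T" "v \<in> V" "E t v \<noteq> 0" "\<And>v'. v' \<in> V \<Longrightarrow> v' \<noteq> v \<Longrightarrow> E t v' = 0" by blast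
    obtain u w c where uwc: "c * c = 1" "\<forall>v\<in>V. E t v = c * (of_bool (v = u) - of_bool (v = w))"
      using Suc.prems(4)[OF tv(1)] by blast
    have "E t v * E t v = 1" using uwc tv(2,3) by (auto simp: of_bool_def split: if_splits)
    then have "fdet m (bip T V E) = - fdet m (bip (T - {t}) (V - {v}) E)"
      using tv by (intro fdet_bip_pivot[OF Suc.prems(2,3)]) auto
    moreover have "fdet m (bip (T - {t}) (V - {v}) E) \<in> {0, (- 1) ^ card (V - {v})}"
    proof (rule Suc.hyps(1))
      show "n = card (V - {v})" using Suc.hyps(2) tv(2) Suc.prems(1) by simp
      fix t' assume "t' \<in> T - {t}"
      then show "\<exists>u w c. c * c = 1 \<and> (\<forall>v\<in>V - {v}. E t' v = c * (of_bool (v = u) - of_bool (v = w)))"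
        using Suc.prems(4)[of t'] by blast
    qed (use Suc.prems in auto)
    moreover have "card V = Suc (card (V - {v}))" using tv(2) Suc.prems(1) by (metis card.remove)
    ultimately show ?thesis by auto
  next
    case False
    obtain v where v: "v \<in> V" using Suc.hyps(2) by fastforce
    have row: "(\<Sum>v\<in>V. E t v) = 0" if t: "t \<in> T" for t
    proof -
      obtain u w c where uwc: "c * c = 1" "\<And>v. v \<in> V \<Longrightarrow> E t v = c * (of_bool (v = u) - of_bool (v = w))"
        using Suc.prems(4)[OF t] by blast
      then have c0: "c \<noteq> 0" by auto
      have "u \<in> V \<longleftrightarrow> w \<in> V"
      proof (rule ccontr)
        assume "(u \<in> V) \<noteq> (w \<in> V)"
        then have "E t (if u \<in> V then u else w) \<noteq> 0 \<and> (\<forall>v'\<in>V. v' \<noteq> (if u \<in> V then u else w) \<longrightarrow> E t v' = 0)"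
          "(if u \<in> V then u else w) \<in> V"
          using uwc(2) c0 by auto
        with False t show False by blast
      qed
      moreover have "(\<Sum>v\<in>V. E t v) = (\<Sum>v\<in>V. c * (of_bool (v = u) - of_bool (v = w)))"
        by (rule sum.cong[OF refl uwc(2)])
      moreover have "\<dots> = c * ((\<Sum>v\<in>V. of_bool (v = u)) - (\<Sum>v\<in>V. of_bool (v = w)))"
        by (simp only: sum_distrib_left[symmetric] sum_subtractf)
      moreover have "(\<Sum>v\<in>V. of_bool (v = x)) = (of_bool (x \<in> V) :: 'a)" for x
        using Suc.prems(1) by (simp add: of_bool_def)
      ultimately show ?thesis by simp
    qed
    have "fdet m (bip T V E) = 0"
    proof (rule fdet_zero_col[of v m "\<lambda>j. of_bool (j \<in> V)"])
      fix i assume i: "i < m"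
      have V: "V \<subseteq> {..<m}" using Suc.prems(3) by simp
      have "(\<Sum>j<m. bip T V E i j * of_bool (j \<in> V)) = (\<Sum>j\<in>V. bip T V E i j)"
        using V by (subst sum.mono_neutral_cong_right[of "{..<m}" V _ "bip T V E i"]) auto
      also have "\<dots> = 0"
        using row[of i] Suc.prems(2) by (cases "i \<in> T"; cases "i \<in> V") (auto simp: bip_def urow_def intro!: sum.neutral)
      finally show "(\<Sum>j<m. bip T V E i j * of_bool (j \<in> V)) = 0" .
    qed (use v Suc.prems(3) in auto)
    then show ?thesis by simp
  qed
qed

lemma fdet_units_on_bip:
  fixes B :: "nat \<Rightarrow> nat \<Rightarrow> 'a::comm_ring_1"
  assumes "S \<subseteq> {..<N}" "N \<le> m"
    and sym: "\<And>i j. B i j = B j i"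
    and edges: "\<And>i j. i < N \<Longrightarrow> j < N \<Longrightarrow> B i j = 0"
    and verts: "\<And>i j. N \<le> i \<Longrightarrow> N \<le> j \<Longrightarrow> B i j = 0"
  shows "fdet m (units_on S B) = fdet m (bip ({..<N} - S) {N..<m} B)"
proof (rule fdet_cong_prod)
  fix p assume p: "p permutes {..<m}"
  show "(\<Prod>i<m. units_on S B i (p i)) = (\<Prod>i<m. bip ({..<N} - S) {N..<m} B i (p i))"
  proof (cases "\<forall>s\<in>S. p s = s")
    case True
    show ?thesis
    proof (rule prod.cong[OF refl])
      fix i assume i: "i \<in> {..<m}"
      then have pi: "p i < m" using permutes_lessThan[OF p] by simp
      show "units_on S B i (p i) = bip ({..<N} - S) {N..<m} B i (p i)"
      proof (cases "i \<in> S")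
        case True
        then show ?thesis using assms(1) by (auto simp: units_on_def bip_def)
      next
        case False
        then have "p i \<notin> S" using True permutes_inj[OF p, THEN injD] by metis
        then show ?thesis using False i pi sym[of i "p i"] edges[of i "p i"] verts[of i "p i"]
          by (cases "i < N"; cases "p i < N") (auto simp: units_on_def bip_def)
      qed
    qed
  next
    case False
    then obtain s where s: "s \<in> S" "p s \<noteq> s" by blast
    then have "units_on S B s (p s) = 0" "bip ({..<N} - S) {N..<m} B s (p s) = 0" "s < m"
      using assms(1,2) by (auto simp: units_on_def bip_def urow_def)
    then have "(\<Prod>i<m. units_on S B i (p i)) = 0" "(\<Prod>i<m. bip ({..<N} - S) {N..<m} B i (p i)) = 0"
      by (auto intro!: prod_zero)
    then show ?thesis by simp
  qed
qed

section \<open>Cycles and connectedness in multigraphs\<close>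

lemma nth_mod_Suc_telescope:
  fixes f :: "'v \<Rightarrow> 'a::ab_group_add"
  assumes "us \<noteq> []"
  shows "(\<Sum>i<length us. f (us ! (Suc i mod length us)) - f (us ! i)) = 0"
proof -
  obtain n where n: "length us = Suc n" using assms by (cases us) auto
  have "(\<Sum>i<Suc n. f (us ! (Suc i mod Suc n))) = (\<Sum>i<n. f (us ! (Suc i mod Suc n))) + f (us ! 0)" by simp
  also have "\<dots> = (\<Sum>i<n. f (us ! Suc i)) + f (us ! 0)" by simp
  also have "\<dots> = (\<Sum>i<Suc n. f (us ! i))" by (subst sum.lessThan_Suc_shift) (simp add: add.commute)
  finally show ?thesis by (simp add: n sum_subtractf)
qed

text \<open>
  A path of positive length with edges in \<open>P\<close>, without repeated vertices or edges.
\<close>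

definition simple_path :: "('v,'e) pre_digraph \<Rightarrow> 'e set \<Rightarrow> 'v list \<Rightarrow> 'e list \<Rightarrow> bool" where
  "simple_path G P us ps \<longleftrightarrow> ps \<noteq> [] \<and> length us = Suc (length ps) \<and> distinct us \<and> distinct ps \<and> set us \<subseteq> verts G \<and> set ps \<subseteq> P \<and>
     (\<forall>i<length ps. joins G (ps ! i) (us ! i) (us ! Suc i))"

text \<open>
  A nonempty set of edges without leaves contains a cycle: a longest path cannot be
  extended, so another edge at its end leads back to the path.
\<close>

lemma cycle_if_no_leaf:
  assumes G: "fin_digraph G" and P: "P \<subseteq> arcs G" "P \<noteq> {}"
    and leaf: "\<And>e u w. e \<in> P \<Longrightarrow> joins G e u w \<Longrightarrow> u \<noteq> w \<Longrightarrow> \<exists>e'\<in>P. e' \<noteq> e \<and> (\<exists>x. joins G e' w x)"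
  shows "\<exists>us ps. undirected_cycle G us ps \<and> set ps \<subseteq> P"
proof (rule ccontr)
  assume no: "\<not> ?thesis"
  interpret fin_digraph G by fact
  have ends: "u \<in> verts G" "v \<in> verts G" if "e \<in> P" "joins G e u v" for e u v
    using that P(1) by (auto simp: joins_def)
  have noloop: "u \<noteq> w" if "e \<in> P" "joins G e u w" for e u w
  proof
    assume "u = w"
    then have "undirected_cycle G [u] [e]" using that ends P(1) by (auto simp: undirected_cycle_def)
    then have "\<exists>us ps. undirected_cycle G us ps \<and> set ps \<subseteq> P"
      using that(1) by (intro exI[of _ "[u]"] exI[of _ "[e]"]) simp
    with no show False ..
  qed
  have len: "length ps < card (verts G)" if "simple_path G P us ps" for us ps
  proof -
    have "card (set us) \<le> card (verts G)" using that by (intro card_mono) (auto simp: simple_path_def)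
    then show ?thesis using that by (simp add: simple_path_def distinct_card)
  qed
  obtain e0 where e0: "e0 \<in> P" using P(2) by blast
  have "joins G e0 (tail G e0) (head G e0)" by (simp add: joins_def)
  then have "simple_path G P [tail G e0, head G e0] [e0]"
    using e0 ends noloop by (auto simp: simple_path_def)
  \<comment> \<open>The length of a simple path is bounded by the number of vertices.\<close>
  then have "\<exists>us ps. simple_path G P us ps \<and> (\<forall>us' ps'. simple_path G P us' ps' \<longrightarrow> length ps' \<le> length ps)"
    using ex_has_greatest_nat[of "\<lambda>(us, ps). simple_path G P us ps" "([tail G e0, head G e0], [e0])" "\<lambda>(us, ps). length ps" "card (verts G)"]
      len by (auto simp: less_imp_le)
  then obtain us ps where sp: "simple_path G P us ps" and max: "\<And>us' ps'. simple_path G P us' ps' \<Longrightarrow> length ps' \<le> length ps"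
    by blast
  define L where "L = length ps"
  have L: "0 < L" "length us = Suc L" "distinct us" "distinct ps" "set us \<subseteq> verts G" "set ps \<subseteq> P"
    and jn: "\<And>i. i < L \<Longrightarrow> joins G (ps ! i) (us ! i) (us ! Suc i)"
    using sp by (auto simp: simple_path_def L_def)
  let ?w = "us ! L"
  let ?e = "ps ! (L - 1)"
  have eP: "?e \<in> P" using L nth_mem[of "L - 1" ps] by (auto simp: L_def)
  have je: "joins G ?e (us ! (L - 1)) ?w" using jn[of "L - 1"] L(1) by simp
  obtain e' x where e': "e' \<in> P" "e' \<noteq> ?e" "joins G e' ?w x"
    using leaf[OF eP je noloop[OF eP je]] by blast
  have new: "e' \<notin> set ps"
  proof
    assume "e' \<in> set ps"
    then obtain j where j: "j < L" "e' = ps ! j" by (auto simp: in_set_conv_nth L_def)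
    then have "?w = us ! j \<or> ?w = us ! Suc j" using jn[OF j(1)] e'(3) by (auto simp: joins_def)
    then have "Suc j = L" using j(1) L(2) nth_eq_iff_index_eq[OF L(3), of L j] nth_eq_iff_index_eq[OF L(3), of L "Suc j"] by auto
    then have "j = L - 1" by simp
    with j e'(2) show False by simp
  qed
  show False
  proof (cases "x \<in> set us")
    case False
    have "simple_path G P (us @ [x]) (ps @ [e'])"
      unfolding simple_path_def
    proof (intro conjI allI impI)
      fix i assume "i < length (ps @ [e'])"
      then have "i < L \<or> i = L" by (auto simp: L_def)
      then consider "i < L" | "i = L" by blast
      then show "joins G ((ps @ [e']) ! i) ((us @ [x]) ! i) ((us @ [x]) ! Suc i)"
        using jn e'(3) L(2) by cases (auto simp: nth_append L_def)
    qed (use L new False e' ends[OF e'(1,3)] in \<open>auto simp: L_def\<close>)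
    from max[OF this] show False by simp
  next
    case True
    then obtain i where i: "i \<le> L" "x = us ! i" using L(2) by (auto simp: in_set_conv_nth less_Suc_eq_le)
    let ?us = "drop i us" and ?ps = "drop i ps @ [e']"
    have len': "length ?us = Suc (L - i)" "length ?ps = Suc (L - i)" using L(2) i by (auto simp: L_def Suc_diff_le)
    have "undirected_cycle G ?us ?ps"
      unfolding undirected_cycle_def
    proof (intro conjI allI impI)
      fix k assume k: "k < length ?ps"
      then have "k < L - i \<or> k = L - i" using len' by linarith
      then consider "k < L - i" | "k = L - i" by blast
      then show "joins G (?ps ! k) (?us ! k) (?us ! (Suc k mod length ?ps))"
      proof cases
        case 1
        then show ?thesis using jn[of "i + k"] L(2) i len' by (auto simp: nth_append L_def)
      next
        case 2
        then show ?thesis using e'(3) i L(2) len' by (auto simp: nth_append L_def)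
      qed
    qed (use L new e' P(1) i(1) in \<open>auto simp: L_def Suc_diff_le dest: in_set_dropD\<close>)
    moreover have "set ?ps \<subseteq> P" using L(6) e'(1) by (auto dest: in_set_dropD)
    ultimately show False using no by blast
  qed
qed

lemma connected_constant:
  assumes "Digraph_Component.connected G" "\<And>e. e \<in> arcs G \<Longrightarrow> y (tail G e) = y (head G e)" "u \<in> verts G" "v \<in> verts G"
  shows "y u = y v"
proof -
  have "u \<rightarrow>\<^sup>*\<^bsub>with_proj (mk_symmetric G)\<^esub> v"
    using assms by (auto simp: connected_def strongly_connected_def)
  then have "(u, v) \<in> rtrancl_on (verts G) (parcs (mk_symmetric G))"
    by (simp add: reachable_def)
  then show ?thesis
    by (induction rule: rtrancl_on_induct) (use assms(2) in \<open>auto simp: parcs_mk_symmetric\<close>)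
qed

lemma not_connected_closed_set:
  assumes "wf_digraph G" "\<not> Digraph_Component.connected G" "r \<in> verts G"
  obtains K where "K \<subseteq> verts G" "K \<noteq> {}" "r \<notin> K" "\<And>e. e \<in> arcs G \<Longrightarrow> tail G e \<in> K \<longleftrightarrow> head G e \<in> K"
proof -
  interpret wf_digraph G by fact
  let ?R = "rtrancl_on (verts G) (parcs (mk_symmetric G))"
  have "\<exists>u\<in>verts G. \<exists>v\<in>verts G. (u, v) \<notin> ?R"
    using assms(2,3) by (auto simp: connected_def strongly_connected_def reachable_def)
  then obtain u v where uv: "u \<in> verts G" "v \<in> verts G" "(u, v) \<notin> ?R" by blast
  \<comment> \<open>The component of \<open>u\<close>, or its complement if it contains \<open>r\<close>.\<close>
  define K where "K = {w \<in> verts G. (u, w) \<in> ?R}"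
  have cl: "tail G e \<in> K \<longleftrightarrow> head G e \<in> K" if "e \<in> arcs G" for e
  proof -
    have "(tail G e, head G e) \<in> parcs (mk_symmetric G)" "(head G e, tail G e) \<in> parcs (mk_symmetric G)"
      using that by (auto simp: parcs_mk_symmetric)
    then show ?thesis using that
      by (auto simp: K_def intro: rtrancl_on_into_rtrancl_on)
  qed
  show ?thesis
  proof (cases "r \<in> K")
    case False
    show ?thesis by (rule that[of K]) (use uv False cl in \<open>auto simp: K_def\<close>)
  next
    case True
    show ?thesis by (rule that[of "verts G - K"]) (use uv True cl assms in \<open>auto simp: K_def\<close>)
  qed
qed

section \<open>The matrix-tree theorem\<close>

text \<open>
  A graph with enumerated edges and vertices. The index \<open>t < N\<close> belongs to the edge \<open>es ! t\<close>, and the index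
  \<open>j\<close> with \<open>N \<le> j < m\<close> to the vertex \<open>vs ! (j - N)\<close>. The last vertex \<open>base\<close> has no index.
\<close>

locale graph_enum =
  fixes G :: "('v, 'e) pre_digraph" and es :: "'e list" and vs :: "'v list"
  assumes fin: "fin_digraph G" and es: "distinct es" "set es = arcs G"
    and vs: "distinct vs" "set vs = verts G" "vs \<noteq> []"
begin

definition N where "N = length es"
definition m where "m = length es + (length vs - 1)"
definition base where "base = vs ! (length vs - 1)"

lemma m_N: "m - N = length vs - 1" "N \<le> m" by (auto simp: m_def N_def)

lemma base: "base \<in> verts G"
  using vs(2,3) nth_mem[of "length vs - 1" vs] by (simp add: base_def)

lemma ends: "e \<in> arcs G \<Longrightarrow> tail G e \<in> verts G" "e \<in> arcs G \<Longrightarrow> head G e \<in> verts G"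
  using fin by (auto simp: fin_digraph_def wf_digraph_def)

lemma bij_verts: "bij_betw (\<lambda>j. vs ! (j - N)) {N..<m} (verts G - {base})"
proof -
  have "bij_betw (\<lambda>j. j - N) {N..<m} {..<length vs - 1}"
    by (rule bij_betw_byWitness[of _ "\<lambda>k. k + N"]) (auto simp: m_def N_def)
  moreover have "bij_betw ((!) vs) {..<length vs - 1} (verts G - {base})"
  proof -
    have "bij_betw ((!) vs) {..<length vs} (verts G)" using bij_betw_nth[OF vs(1) refl vs(2)[symmetric]] .
    then have "bij_betw ((!) vs) ({..<length vs} - {length vs - 1}) (verts G - {base})"
      unfolding base_def using vs(3) by (intro bij_betw_DiffI) (auto simp: bij_betw_def)
    moreover have "{..<length vs} - {length vs - 1} = {..<length vs - 1}" by auto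
    ultimately show ?thesis by simp
  qed
  ultimately have "bij_betw ((!) vs \<circ> (\<lambda>j. j - N)) {N..<m} (verts G - {base})" by (rule bij_betw_trans)
  then show ?thesis by (simp add: comp_def)
qed

lemma ex_index: "w \<in> verts G - {base} \<Longrightarrow> \<exists>j\<in>{N..<m}. vs ! (j - N) = w"
  unfolding bij_betw_imp_surj_on[OF bij_verts, symmetric] by (elim imageE) blast

lemma sum_verts: "(\<Sum>j\<in>{N..<m}. g (vs ! (j - N))) = (\<Sum>w\<in>verts G - {base}. g w)"
  by (rule sum.reindex_bij_betw[OF bij_verts])

lemma finite_verts: "finite (verts G)" using vs(2) by (metis List.finite_set)

lemma bij_arcs: "bij_betw ((!) es) {..<N} (arcs G)"
  using bij_betw_nth[OF es(1) refl es(2)[symmetric]] by (simp add: N_def)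

text \<open>
  The incidence matrix. The signs \<open>\<sigma>\<close> change the orientation of edges.
\<close>

definition inc :: "(nat \<Rightarrow> 'k::field) \<Rightarrow> nat \<Rightarrow> nat \<Rightarrow> 'k" where
  "inc \<sigma> t j = \<sigma> t * (of_bool (head G (es ! t) = vs ! (j - N)) - of_bool (tail G (es ! t) = vs ! (j - N)))"

lemma es_in: "t < N \<Longrightarrow> es ! t \<in> arcs G"
  unfolding N_def es(2)[symmetric] by (rule nth_mem)

lemma sum_inc:
  fixes y :: "'v \<Rightarrow> 'k::field"
  assumes "t < N" "y base = 0"
  shows "(\<Sum>j\<in>{N..<m}. inc \<sigma> t j * y (vs ! (j - N))) = \<sigma> t * (y (head G (es ! t)) - y (tail G (es ! t)))"
proof -
  have S: "(\<Sum>w\<in>verts G - {base}. of_bool (u = w) * y w) = y u" if "u \<in> verts G" for u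
  proof -
    have "(\<Sum>w\<in>verts G - {base}. of_bool (u = w) * y w) = (\<Sum>w\<in>verts G. if u = w then y w else 0)"
      using assms(2) finite_verts by (intro sum.mono_neutral_cong_left) auto
    then show ?thesis using that finite_verts by simp
  qed
  have "(\<Sum>j\<in>{N..<m}. inc \<sigma> t j * y (vs ! (j - N))) =
    (\<Sum>w\<in>verts G - {base}. \<sigma> t * (of_bool (head G (es ! t) = w) * y w - of_bool (tail G (es ! t) = w) * y w))"
    unfolding inc_def by (subst sum_verts[symmetric]) (simp add: algebra_simps)
  also have "\<dots> = \<sigma> t * ((\<Sum>w\<in>verts G - {base}. of_bool (head G (es ! t) = w) * y w) - (\<Sum>w\<in>verts G - {base}. of_bool (tail G (es ! t) = w) * y w))"
    by (simp only: sum_distrib_left[symmetric] sum_subtractf)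
  also have "\<dots> = \<sigma> t * (y (head G (es ! t)) - y (tail G (es ! t)))"
    using S ends[OF es_in[OF assms(1)]] by simp
  finally show ?thesis .
qed

abbreviation sub :: "nat set \<Rightarrow> ('v, 'e) pre_digraph" where
  "sub T \<equiv> G\<lparr>arcs := (!) es ` T\<rparr>"

lemma wf_sub: "T \<subseteq> {..<N} \<Longrightarrow> wf_digraph (sub T)" "T \<subseteq> {..<N} \<Longrightarrow> fin_digraph (sub T)"
proof -
  assume T: "T \<subseteq> {..<N}"
  then show 1: "wf_digraph (sub T)" using ends es_in by (auto simp: wf_digraph_def subset_eq)
  have "finite ((!) es ` T)" using T finite_subset by blast
  then show "fin_digraph (sub T)" using finite_verts
    by (intro fin_digraph.intro 1 fin_digraph_axioms.intro) auto
qed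

lemma sum_bip_edge:
  assumes "t \<in> T" "T \<subseteq> {..<N}"
  shows "(\<Sum>j<m. bip T {N..<m} E t j * x j) = (\<Sum>j\<in>{N..<m}. E t j * x j)"
  using assms by (intro sum.mono_neutral_cong_right) (auto simp: bip_def)

text \<open>
  The indicator function of a union of components not containing \<open>base\<close> is in the kernel.
\<close>

lemma det_zero_if_not_connected:
  fixes \<sigma> :: "nat \<Rightarrow> 'k::field"
  assumes T: "T \<subseteq> {..<N}" and nc: "\<not> Digraph_Component.connected (sub T)"
  shows "fdet m (bip T {N..<m} (inc \<sigma>)) = 0"
proof -
  obtain K where K: "K \<subseteq> verts G" "K \<noteq> {}" "base \<notin> K" "\<And>e. e \<in> (!) es ` T \<Longrightarrow> tail G e \<in> K \<longleftrightarrow> head G e \<in> K"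
    using not_connected_closed_set[OF wf_sub(1)[OF T] nc, of base] base by auto
  then obtain w where w: "w \<in> K" "w \<in> verts G - {base}" by auto
  obtain j where j: "j \<in> {N..<m}" "vs ! (j - N) = w" using ex_index[OF w(2)] by blast
  let ?x = "\<lambda>j. of_bool (j \<in> {N..<m} \<and> vs ! (j - N) \<in> K) :: 'k"
  show ?thesis
  proof (rule fdet_zero_col[of j m ?x])
    fix i assume i: "i < m"
    show "(\<Sum>j<m. bip T {N..<m} (inc \<sigma>) i j * ?x j) = 0"
    proof (cases "i \<in> T")
      case True
      have "(\<Sum>j<m. bip T {N..<m} (inc \<sigma>) i j * ?x j) = (\<Sum>j\<in>{N..<m}. inc \<sigma> i j * of_bool (vs ! (j - N) \<in> K))"
        unfolding sum_bip_edge[OF True T] by (intro sum.cong) auto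
      also have "\<dots> = \<sigma> i * (of_bool (head G (es ! i) \<in> K) - of_bool (tail G (es ! i) \<in> K))"
        by (rule sum_inc) (use True T K in auto)
      also have "\<dots> = 0" using K(4)[of "es ! i"] True by simp
      finally show ?thesis .
    next
      case False
      then show ?thesis using T by (intro sum.neutral) (auto simp: bip_def urow_def)
    qed
  qed (use j w in auto)
qed

text \<open>
  The signed sum of the rows of a cycle is zero.
\<close>

lemma det_zero_if_cycle:
  fixes \<sigma> :: "nat \<Rightarrow> 'k::field"
  assumes T: "T \<subseteq> {..<N}" and \<sigma>: "\<And>t. \<sigma> t * \<sigma> t = 1" and cyc: "undirected_cycle (sub T) us ps"
  shows "fdet m (bip T {N..<m} (inc \<sigma>)) = 0"
proof -
  define L where "L = length ps"
  have c: "0 < L" "length us = L" "distinct ps" "set ps \<subseteq> (!) es ` T"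
    and jn: "\<And>k. k < L \<Longrightarrow> joins G (ps ! k) (us ! k) (us ! (Suc k mod L))"
    using cyc by (auto simp: undirected_cycle_def L_def joins_def)
  define s where "s k = (if tail G (ps ! k) = us ! k \<and> head G (ps ! k) = us ! (Suc k mod L) then 1 else - 1 :: 'k)" for k
  \<comment> \<open>The signs \<open>s k\<close> compare the orientation of an edge with the direction of the cycle.\<close>
  let ?z = "\<lambda>t. if t \<in> T then \<sigma> t * (\<Sum>k<L. of_bool (ps ! k = es ! t) * s k) else 0"
  have "ps ! 0 \<in> set ps" using c(1) by (simp add: L_def)
  then have "ps ! 0 \<in> (!) es ` T" using c(4) by blast
  then obtain t0 where t0: "t0 \<in> T" "es ! t0 = ps ! 0" by auto
  show ?thesis
  proof (rule fdet_zero_row[of t0 m ?z])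
    have "(\<Sum>k<L. of_bool (ps ! k = es ! t0) * s k) = (\<Sum>k<L. if k = 0 then s k else 0)"
      using c(1,3) by (intro sum.cong refl) (auto simp: t0 nth_eq_iff_index_eq L_def)
    also have "\<dots> = s 0" using c(1) by simp
    finally show "?z t0 \<noteq> 0" using t0(1) \<sigma>[of t0] by (auto simp: s_def)
    show "t0 < m" using t0 T m_N by auto
    fix j assume j: "j < m"
    show "(\<Sum>i<m. ?z i * bip T {N..<m} (inc \<sigma>) i j) = 0"
    proof (cases "j \<in> {N..<m}")
      case False
      then show ?thesis by (intro sum.neutral) (auto simp: bip_def)
    next
      case True
      let ?w = "vs ! (j - N)"
      let ?d = "\<lambda>e. of_bool (head G e = ?w) - of_bool (tail G e = ?w) :: 'k"
      have finT: "finite T" using T finite_subset by blast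
      have "(\<Sum>i<m. ?z i * bip T {N..<m} (inc \<sigma>) i j) = (\<Sum>t\<in>T. \<sigma> t * (\<Sum>k<L. of_bool (ps ! k = es ! t) * s k) * inc \<sigma> t j)"
        using T m_N True by (intro sum.mono_neutral_cong_right) (auto simp: bip_def)
      also have "\<dots> = (\<Sum>t\<in>T. \<Sum>k<L. of_bool (ps ! k = es ! t) * (s k * ?d (ps ! k)))"
      proof (rule sum.cong[OF refl])
        fix t assume "t \<in> T"
        have "\<sigma> t * (\<Sum>k<L. of_bool (ps ! k = es ! t) * s k) * inc \<sigma> t j =
          (\<sigma> t * \<sigma> t) * ((\<Sum>k<L. of_bool (ps ! k = es ! t) * s k) * ?d (es ! t))"
          by (simp add: inc_def mult_ac)
        also have "\<dots> = (\<Sum>k<L. of_bool (ps ! k = es ! t) * (s k * ?d (ps ! k)))"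
          unfolding \<sigma> sum_distrib_right by (simp only: mult_1_left) (intro sum.cong refl, auto)
        finally show "\<sigma> t * (\<Sum>k<L. of_bool (ps ! k = es ! t) * s k) * inc \<sigma> t j = (\<Sum>k<L. of_bool (ps ! k = es ! t) * (s k * ?d (ps ! k)))" .
      qed
      also have "\<dots> = (\<Sum>k<L. \<Sum>t\<in>T. of_bool (ps ! k = es ! t) * (s k * ?d (ps ! k)))" by (rule sum.swap)
      also have "\<dots> = (\<Sum>k<L. of_bool (us ! (Suc k mod L) = ?w) - of_bool (us ! k = ?w))"
      proof (rule sum.cong[OF refl])
        fix k assume k: "k \<in> {..<L}"
        then have "ps ! k \<in> (!) es ` T" using c(4) nth_mem[of k ps] unfolding L_def by blast
        then obtain t where t: "t \<in> T" "ps ! k = es ! t" by auto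
        have "(\<Sum>t'\<in>T. of_bool (ps ! k = es ! t') * (s k * ?d (ps ! k))) = (\<Sum>t'\<in>T. if t' = t then s k * ?d (ps ! k) else 0)"
        proof (rule sum.cong[OF refl])
          fix t' assume "t' \<in> T"
          then have "ps ! k = es ! t' \<longleftrightarrow> t' = t"
            using t T es(1) nth_eq_iff_index_eq[OF es(1), of t t'] by (auto simp: N_def)
          then show "of_bool (ps ! k = es ! t') * (s k * ?d (ps ! k)) = (if t' = t then s k * ?d (ps ! k) else 0)" by simp
        qed
        also have "\<dots> = s k * ?d (ps ! k)" using t(1) finT by simp
        also have "\<dots> = of_bool (us ! (Suc k mod L) = ?w) - of_bool (us ! k = ?w)"
          using jn[of k] k by (auto simp: s_def joins_def)
        finally show "(\<Sum>t'\<in>T. of_bool (ps ! k = es ! t') * (s k * ?d (ps ! k))) = of_bool (us ! (Suc k mod L) = ?w) - of_bool (us ! k = ?w)" .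
      qed
      also have "\<dots> = 0"
        using nth_mod_Suc_telescope[of us "\<lambda>u. of_bool (u = ?w) :: 'k"] c(1,2) by auto
      finally show ?thesis .
    qed
  qed
qed

text \<open>
  An element of the kernel consists of a function on the vertices that is constant along edges and vanishes at
  \<open>base\<close>, and of a flow on the edges. The former is zero by connectedness, and the support of the latter
  has no leaf.
\<close>

lemma det_nonzero_if_tree:
  fixes \<sigma> :: "nat \<Rightarrow> 'k::field"
  assumes T: "T \<subseteq> {..<N}" and \<sigma>: "\<And>t. \<sigma> t * \<sigma> t = 1" and tree: "undirected_tree (sub T)"
  shows "fdet m (bip T {N..<m} (inc \<sigma>)) \<noteq> 0"
proof
  assume "fdet m (bip T {N..<m} (inc \<sigma>)) = 0"
  then obtain x j0 where j0: "j0 < m" "x j0 \<noteq> 0" and ker: "\<And>i. i < m \<Longrightarrow> (\<Sum>j<m. bip T {N..<m} (inc \<sigma>) i j * x j) = 0"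
    unfolding fdet_eq_0_iff_col by blast
  have \<sigma>0: "\<sigma> t \<noteq> 0" for t using \<sigma>[of t] by auto
  have x_other: "x i = 0" if "i < N" "i \<notin> T" for i
  proof -
    have "(\<Sum>j<m. bip T {N..<m} (inc \<sigma>) i j * x j) = (\<Sum>j<m. if j = i then x j else 0)"
      using that by (intro sum.cong refl) (auto simp: bip_def urow_def)
    also have "\<dots> = x i" using that m_N by simp
    finally show ?thesis using ker[of i] that m_N by simp
  qed
  have con: "Digraph_Component.connected (sub T)" and acyc: "\<And>us ps. \<not> undirected_cycle (sub T) us ps"
    using tree by (auto simp: undirected_tree_def)
  define y where "y w = (if w = base then 0 else x (inv_into {N..<m} (\<lambda>j. vs ! (j - N)) w))" for w
  have y: "y (vs ! (j - N)) = x j" if "j \<in> {N..<m}" for j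
  proof -
    have "vs ! (j - N) \<noteq> base" using bij_betwE[OF bij_verts] that by auto
    moreover have "inv_into {N..<m} (\<lambda>j. vs ! (j - N)) (vs ! (j - N)) = j"
      using bij_betw_inv_into_left[OF bij_verts that] .
    ultimately show ?thesis by (simp add: y_def)
  qed
  have "y (tail G e) = y (head G e)" if e: "e \<in> (!) es ` T" for e
  proof -
    obtain t where t: "t \<in> T" "e = es ! t" using e by blast
    have "t < m" using t T m_N by auto
    have "(\<Sum>j\<in>{N..<m}. inc \<sigma> t j * y (vs ! (j - N))) = (\<Sum>j\<in>{N..<m}. inc \<sigma> t j * x j)"
      by (intro sum.cong refl) (simp only: y)
    also have "\<dots> = (\<Sum>j<m. bip T {N..<m} (inc \<sigma>) t j * x j)"
      by (rule sum_bip_edge[OF t(1) T, symmetric])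
    also have "\<dots> = 0" by (rule ker) fact
    finally have "\<sigma> t * (y (head G e) - y (tail G e)) = 0"
      using sum_inc[of t y \<sigma>] t T by (auto simp: y_def)
    then show ?thesis using \<sigma>0[of t] by simp
  qed
  then have "y w = y base" if "w \<in> verts G" for w
    using connected_constant[OF con, of y w base] base that by simp
  then have y0: "y w = 0" if "w \<in> verts G" for w using that by (simp add: y_def)
  have xV: "x j = 0" if "j \<in> {N..<m}" for j
    using y[OF that] y0[of "vs ! (j - N)"] bij_betwE[OF bij_verts] that by auto
  have "\<not> (N \<le> j0)" using xV[of j0] j0 by auto
  then have j0T: "j0 \<in> T" using x_other[of j0] j0 by auto
  define z where "z t = \<sigma> t * x t" for t
  let ?D = "\<lambda>w t. of_bool (head G (es ! t) = w) - of_bool (tail G (es ! t) = w) :: 'k"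
  have finT: "finite T" using T finite_subset by blast
  have flow': "(\<Sum>t\<in>T. z t * ?D w t) = 0" if w: "w \<in> verts G - {base}" for w
  proof -
    obtain j where j: "j \<in> {N..<m}" "vs ! (j - N) = w" using ex_index[OF w] by blast
    have "(\<Sum>t\<in>T. z t * ?D w t) = (\<Sum>i<m. bip T {N..<m} (inc \<sigma>) j i * x i)"
      using T m_N j by (intro sum.mono_neutral_cong_left) (auto simp: bip_def z_def inc_def)
    then show ?thesis using ker[of j] j by simp
  qed
  have flow: "(\<Sum>t\<in>T. z t * ?D w t) = 0" if w: "w \<in> verts G" for w
  proof (cases "w = base")
    case False then show ?thesis using flow' w by blast
  next
    case True
    have "(\<Sum>w\<in>verts G. \<Sum>t\<in>T. z t * ?D w t) = (\<Sum>t\<in>T. z t * (\<Sum>w\<in>verts G. ?D w t))"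
      by (subst sum.swap) (simp add: sum_distrib_left)
    also have "\<dots> = 0"
    proof (intro sum.neutral ballI)
      fix t assume "t \<in> T"
      then have "tail G (es ! t) \<in> verts G" "head G (es ! t) \<in> verts G" using ends es_in T by auto
      then show "z t * (\<Sum>w\<in>verts G. ?D w t) = 0" using finite_verts by (simp add: sum_subtractf of_bool_def)
    qed
    also have "(\<Sum>w\<in>verts G. \<Sum>t\<in>T. z t * ?D w t) = (\<Sum>t\<in>T. z t * ?D base t) + (\<Sum>w\<in>verts G - {base}. \<Sum>t\<in>T. z t * ?D w t)"
      using finite_verts base by (simp add: sum.remove)
    finally show ?thesis using flow' True by simp
  qed
  define P where "P = (!) es ` {t \<in> T. z t \<noteq> 0}"
  have "\<exists>us ps. undirected_cycle (sub T) us ps \<and> set ps \<subseteq> P"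
  proof (rule cycle_if_no_leaf)
    show "fin_digraph (sub T)" using wf_sub T by blast
    show "P \<subseteq> arcs (sub T)" by (auto simp: P_def)
    show "P \<noteq> {}" using j0T j0 \<sigma>0 by (auto simp: P_def z_def)
    fix e u w assume e: "e \<in> P" "joins (sub T) e u w" "u \<noteq> w"
    then obtain t where t: "t \<in> T" "z t \<noteq> 0" "e = es ! t" by (auto simp: P_def)
    have w: "w \<in> verts G" using e(2) t ends es_in T by (auto simp: joins_def)
    have "z t * ?D w t \<noteq> 0" using t(2,3) e(2,3) by (auto simp: joins_def)
    have "\<exists>t'\<in>T - {t}. z t' * ?D w t' \<noteq> 0"
    proof (rule ccontr)
      assume "\<not> ?thesis"
      then have "(\<Sum>t'\<in>T - {t}. z t' * ?D w t') = 0" by (intro sum.neutral) blast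
      then have "(\<Sum>t\<in>T. z t * ?D w t) = z t * ?D w t"
        using sum.remove[OF finT t(1), of "\<lambda>t. z t * ?D w t"] by simp
      with flow[OF w] \<open>z t * ?D w t \<noteq> 0\<close> show False by simp
    qed
    then obtain t' where t': "t' \<in> T" "t' \<noteq> t" "z t' * ?D w t' \<noteq> 0" by blast
    have "es ! t' \<noteq> e" using t t' T nth_eq_iff_index_eq[OF es(1), of t' t] by (auto simp: N_def)
    moreover have "es ! t' \<in> P" using t' by (auto simp: P_def)
    moreover have "\<exists>x. joins (sub T) (es ! t') w x" using t'(3)
      by (cases "head G (es ! t') = w"; cases "tail G (es ! t') = w") (auto simp: joins_def)
    ultimately show "\<exists>e'\<in>P. e' \<noteq> e \<and> (\<exists>x. joins (sub T) e' w x)" by blast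
  qed
  with acyc show False by blast
qed

lemma det_tree:
  fixes \<sigma> :: "nat \<Rightarrow> 'k::field"
  assumes T: "T \<subseteq> {..<N}" and \<sigma>: "\<And>t. \<sigma> t * \<sigma> t = 1"
  shows "fdet m (bip T {N..<m} (inc \<sigma>)) = (- 1) ^ (length vs - 1) * of_bool (undirected_tree (sub T))"
proof (cases "undirected_tree (sub T)")
  case False
  then show ?thesis using det_zero_if_not_connected[OF T] det_zero_if_cycle[OF T \<sigma>] by (auto simp: undirected_tree_def)
next
  case True
  have "fdet m (bip T {N..<m} (inc \<sigma>)) \<in> {0, (- 1) ^ card {N..<m}}"
  proof (rule fdet_bip_unimodular)
    fix t assume "t \<in> T"
    then have tN: "t < N" using T by auto
    have "\<exists>k. \<forall>j\<in>{N..<m}. (u = vs ! (j - N)) = (j = k)" if "u \<in> verts G" for u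
    proof -
      obtain i where i: "i < length vs" "u = vs ! i" using \<open>u \<in> verts G\<close> vs(2) by (metis in_set_conv_nth)
      have "(u = vs ! (j - N)) = (j = N + i)" if "j \<in> {N..<m}" for j
        using i that nth_eq_iff_index_eq[OF vs(1), of i "j - N"] by (auto simp: m_def N_def)
      then show ?thesis by blast
    qed
    then obtain h l where "\<forall>j\<in>{N..<m}. (head G (es ! t) = vs ! (j - N)) = (j = h)" "\<forall>j\<in>{N..<m}. (tail G (es ! t) = vs ! (j - N)) = (j = l)"
      using ends[OF es_in[OF tN]] by metis
    then have "\<forall>v\<in>{N..<m}. inc \<sigma> t v = \<sigma> t * (of_bool (v = h) - of_bool (v = l))" by (simp add: inc_def)
    then show "\<exists>u w c. c * c = 1 \<and> (\<forall>v\<in>{N..<m}. inc \<sigma> t v = c * (of_bool (v = u) - of_bool (v = w)))"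
      using \<sigma> by blast
  qed (use T m_N in auto)
  then show ?thesis using det_nonzero_if_tree[OF T \<sigma> True] True m_N by auto
qed

end

section \<open>Evaluation of polynomials\<close>

text \<open>
  The value of a monomial.
\<close>

definition mono_eval :: "('e \<Rightarrow> 'k::comm_ring_1) \<Rightarrow> ('e \<Rightarrow>\<^sub>0 nat) \<Rightarrow> 'k" where
  "mono_eval a t = (\<Prod>x\<in>Poly_Mapping.keys t. a x ^ Poly_Mapping.lookup t x)"

lemma mono_eval_superset:
  "finite S \<Longrightarrow> Poly_Mapping.keys t \<subseteq> S \<Longrightarrow> mono_eval a t = (\<Prod>x\<in>S. a x ^ Poly_Mapping.lookup t x)"
  unfolding mono_eval_def by (rule prod.mono_neutral_left) (auto simp: in_keys_iff)

lemma mono_eval_add: "mono_eval a (s + t) = mono_eval a s * mono_eval a t"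
proof -
  let ?S = "Poly_Mapping.keys s \<union> Poly_Mapping.keys t"
  have S: "finite ?S" "Poly_Mapping.keys (s + t) \<subseteq> ?S" "Poly_Mapping.keys s \<subseteq> ?S" "Poly_Mapping.keys t \<subseteq> ?S"
    using Poly_Mapping.keys_add[of s t] by auto
  show ?thesis
    by (simp only: mono_eval_superset[OF S(1,2)] mono_eval_superset[OF S(1,3)] mono_eval_superset[OF S(1,4)]
        lookup_add power_add prod.distrib)
qed

lemma eval_poly_superset:
  "finite S \<Longrightarrow> Poly_Mapping.keys p \<subseteq> S \<Longrightarrow> eval_poly a p = (\<Sum>t\<in>S. of_int (Poly_Mapping.lookup p t) * mono_eval a t)"
  unfolding eval_poly_def mono_eval_def[symmetric] by (rule sum.mono_neutral_left) (auto simp: in_keys_iff)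

lemma eval_poly_add: "eval_poly a (p + q) = eval_poly a p + eval_poly a q"
proof -
  let ?S = "Poly_Mapping.keys p \<union> Poly_Mapping.keys q"
  have S: "finite ?S" "Poly_Mapping.keys (p + q) \<subseteq> ?S" "Poly_Mapping.keys p \<subseteq> ?S" "Poly_Mapping.keys q \<subseteq> ?S"
    using Poly_Mapping.keys_add[of p q] by auto
  show ?thesis
    by (simp only: eval_poly_superset[OF S(1,2)] eval_poly_superset[OF S(1,3)] eval_poly_superset[OF S(1,4)]
        lookup_add of_int_add distrib_right sum.distrib)
qed

lemma eval_poly_single: "eval_poly a (Poly_Mapping.single t c) = of_int c * mono_eval a t"
  by (subst eval_poly_superset[of "{t}"]) (auto simp: lookup_single)

lemma eval_poly_0: "eval_poly a 0 = 0"
  by (simp add: eval_poly_def)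

lemma eval_poly_sum: "eval_poly a (\<Sum>x\<in>A. f x) = (\<Sum>x\<in>A. eval_poly a (f x))"
  by (induction A rule: infinite_finite_induct) (simp_all add: eval_poly_0 eval_poly_add)

lemma poly_mapping_sum_single: "p = (\<Sum>t\<in>Poly_Mapping.keys p. Poly_Mapping.single t (Poly_Mapping.lookup p t))"
proof (rule poly_mapping_eqI)
  fix k
  show "Poly_Mapping.lookup p k = Poly_Mapping.lookup (\<Sum>t\<in>Poly_Mapping.keys p. Poly_Mapping.single t (Poly_Mapping.lookup p t)) k"
    by (simp add: lookup_sum lookup_single when_def in_keys_iff)
qed

lemma eval_poly_mult: "eval_poly a (p * q) = eval_poly a p * eval_poly a q"
proof -
  let ?s = "\<lambda>p t. Poly_Mapping.single t (Poly_Mapping.lookup p t)"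
  have "eval_poly a (p * q) = eval_poly a ((\<Sum>s\<in>Poly_Mapping.keys p. ?s p s) * (\<Sum>t\<in>Poly_Mapping.keys q. ?s q t))"
    using poly_mapping_sum_single[of p] poly_mapping_sum_single[of q] by simp
  also have "\<dots> = (\<Sum>s\<in>Poly_Mapping.keys p. \<Sum>t\<in>Poly_Mapping.keys q. eval_poly a (?s p s) * eval_poly a (?s q t))"
    by (simp add: sum_product eval_poly_sum mult_single eval_poly_single mono_eval_add mult_ac)
  also have "\<dots> = eval_poly a p * eval_poly a q"
    by (simp only: eval_poly_single) (simp add: sum_product eval_poly_def mono_eval_def)
  finally show ?thesis .
qed

lemma eval_poly_1: "eval_poly a 1 = 1"
  using eval_poly_single[of a 0 1] by (simp add: mono_eval_def)

lemma comm_ring_hom_eval_poly: "comm_ring_hom (eval_poly a)"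
  by unfold_locales (simp_all add: eval_poly_add eval_poly_mult eval_poly_0 eval_poly_1)

lemma eval_poly_Var: "eval_poly a (Var x) = a x"
  by (simp add: Var_def eval_poly_single mono_eval_def)

lemma eval_poly_prod: "eval_poly a (\<Prod>x\<in>A. f x) = (\<Prod>x\<in>A. eval_poly a (f x))"
  by (induction A rule: infinite_finite_induct) (simp_all add: eval_poly_1 eval_poly_mult)

lemma eval_graph_poly: "eval_poly a (graph_poly G) = (\<Sum>T\<in>spanning_trees G. \<Prod>x\<in>arcs G - T. a x)"
  by (simp add: graph_poly_def eval_poly_sum eval_poly_prod eval_poly_Var)

text \<open>
  Deletion of an edge extracts the coefficient of its variable, as the graph polynomial is affine in it.
\<close>

lemma eval_graph_poly_del_arc:
  assumes "finite (arcs G)" "e \<in> arcs G"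
  shows "eval_poly a (graph_poly (pre_digraph.del_arc G e)) =
    eval_poly (a(e := 1)) (graph_poly G) - eval_poly (a(e := 0)) (graph_poly G)"
proof -
  have st: "spanning_trees (pre_digraph.del_arc G e) = {T \<in> spanning_trees G. e \<notin> T}"
  proof -
    have "(pre_digraph.del_arc G e)\<lparr>arcs := T\<rparr> = G\<lparr>arcs := T\<rparr>" for T
      by (cases G) (simp add: pre_digraph.del_arc_def)
    moreover have "arcs (pre_digraph.del_arc G e) = arcs G - {e}" by (simp add: pre_digraph.del_arc_def)
    ultimately show ?thesis by (auto simp: spanning_trees_def)
  qed
  have fin: "finite (spanning_trees G)"
    by (rule finite_subset[of _ "Pow (arcs G)"]) (use assms in \<open>auto simp: spanning_trees_def\<close>)
  have "(\<Prod>x\<in>arcs G - T. (a(e := 1)) x) - (\<Prod>x\<in>arcs G - T. (a(e := 0)) x) = (if e \<notin> T then \<Prod>x\<in>arcs G - {e} - T. a x else 0)"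
    if "T \<in> spanning_trees G" for T
  proof (cases "e \<in> T")
    case True
    then have "(\<Prod>x\<in>arcs G - T. (a(e := c)) x) = (\<Prod>x\<in>arcs G - T. a x)" for c by (intro prod.cong) auto
    then show ?thesis using True by simp
  next
    case False
    have "arcs G - T = insert e (arcs G - {e} - T)" using False assms(2) by auto
    then have "(\<Prod>x\<in>arcs G - T. (a(e := c)) x) = c * (\<Prod>x\<in>arcs G - {e} - T. (a(e := c)) x)" for c using assms(1) by simp
    moreover have "(\<Prod>x\<in>arcs G - {e} - T. (a(e := c)) x) = (\<Prod>x\<in>arcs G - {e} - T. a x)" for c by (intro prod.cong) auto
    ultimately show ?thesis using False by simp
  qed
  then have "eval_poly (a(e := 1)) (graph_poly G) - eval_poly (a(e := 0)) (graph_poly G) =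
    (\<Sum>T\<in>spanning_trees G. if e \<notin> T then \<Prod>x\<in>arcs G - {e} - T. a x else 0)"
    unfolding eval_graph_poly sum_subtractf[symmetric] by (rule sum.cong[OF refl])
  also have "\<dots> = (\<Sum>T\<in>{T \<in> spanning_trees G. e \<notin> T}. \<Prod>x\<in>arcs G - {e} - T. a x)"
    using fin by (simp add: sum.If_cases Int_def)
  also have "\<dots> = eval_poly a (graph_poly (pre_digraph.del_arc G e))"
    unfolding eval_graph_poly st by (simp add: pre_digraph.del_arc_def)
  finally show ?thesis by simp
qed

section \<open>Minors with two rows and two columns removed\<close>

text \<open>
  The increasing enumeration of the indices different from \<open>i\<close>.
\<close>

definition skip :: "nat \<Rightarrow> nat \<Rightarrow> nat" where
  "skip i a = (if a < i then a else Suc a)"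

lemma fdet_delete:
  assumes "i < n" "j < n" "\<And>b. b < n \<Longrightarrow> f i b = urow j b"
  shows "fdet n f = (- 1) ^ (i + j) * fdet (n - 1) (\<lambda>a b. f (skip i a) (skip j b))"
proof -
  let ?A = "mat n n (\<lambda>(i, j). f i j)"
  have "fdet n f = (\<Sum>b<n. ?A $$ (i, b) * cofactor ?A i b)"
    unfolding fdet_det by (rule laplace_expansion_row) (use assms in auto)
  also have "\<dots> = (\<Sum>b<n. if b = j then cofactor ?A i b else 0)"
    using assms by (intro sum.cong refl) (auto simp: urow_def)
  also have "\<dots> = cofactor ?A i j" using assms by simp
  also have "mat_delete ?A i j = mat (n - 1) (n - 1) (\<lambda>(a, b). f (skip i a) (skip j b))"
    unfolding mat_delete_def by (intro eq_matI) (auto simp: skip_def)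
  then have "cofactor ?A i j = (- 1) ^ (i + j) * fdet (n - 1) (\<lambda>a b. f (skip i a) (skip j b))"
    by (simp add: cofactor_def fdet_det)
  finally show ?thesis .
qed

lemma pick_two:
  assumes "i < k"
  shows "pick (- {i, k}) a = skip k (skip i a)"
proof -
  let ?x = "skip k (skip i a)"
  have x: "?x \<in> - {i, k}" using assms by (auto simp: skip_def)
  have "card {y \<in> - {i, k}. y < ?x} = a"
  proof -
    have e: "{y \<in> - {i, k}. y < ?x} = {..<?x} - {i, k}" by auto
    consider "a < i" | "i \<le> a" "Suc a < k" | "i \<le> a" "k \<le> Suc a" by linarith
    then show ?thesis
    proof cases
      case 1
      then have "{..<?x} - {i, k} = {..<a}" using assms by (auto simp: skip_def)
      then show ?thesis using e by simp
    next
      case 2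
      then have "{..<?x} - {i, k} = {..<Suc a} - {i}" using assms by (auto simp: skip_def)
      then show ?thesis using e 2 by simp
    next
      case 3
      then have "{..<?x} - {i, k} = {..<Suc (Suc a)} - {i, k}" using assms by (auto simp: skip_def)
      moreover have "card ({..<Suc (Suc a)} - {i, k}) = a"
        using 3 assms by (subst card_Diff_subset) auto
      ultimately show ?thesis using e by simp
    qed
  qed
  then show ?thesis using pick_card_in_set[OF x] by simp
qed

lemma det_submatrix_two_ordered:
  assumes "i < k" "k < m" "j < l" "l < m"
  shows "fdet m (g(i := urow j, k := urow l)) =
    (- 1) ^ (k + l) * (- 1) ^ (i + j) * det (submatrix (mat m m (\<lambda>(x, y). g x y)) (- {i, k}) (- {j, l}))"
proof -
  let ?F = "g(i := urow j, k := urow l)"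
  let ?F1 = "\<lambda>a b. ?F (skip k a) (skip l b)"
  have "fdet m ?F = (- 1) ^ (k + l) * fdet (m - 1) ?F1"
    by (rule fdet_delete) (use assms in auto)
  also have "fdet (m - 1) ?F1 = (- 1) ^ (i + j) * fdet (m - 1 - 1) (\<lambda>a b. ?F1 (skip i a) (skip j b))"
    by (rule fdet_delete) (use assms in \<open>auto simp: skip_def urow_def\<close>)
  also have "fdet (m - 1 - 1) (\<lambda>a b. ?F1 (skip i a) (skip j b)) = det (submatrix (mat m m (\<lambda>(x, y). g x y)) (- {i, k}) (- {j, l}))"
  proof -
    have "{x. x < m \<and> x \<in> - {i, k}} = {..<m} - {i, k}" "{x. x < m \<and> x \<in> - {j, l}} = {..<m} - {j, l}" by auto
    moreover have "card ({..<m} - {i, k}) = m - 1 - 1" "card ({..<m} - {j, l}) = m - 1 - 1"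
      using assms by (simp_all add: card_Diff_subset)
    ultimately have "submatrix (mat m m (\<lambda>(x, y). g x y)) (- {i, k}) (- {j, l}) =
      mat (m - 1 - 1) (m - 1 - 1) (\<lambda>(a, b). mat m m (\<lambda>(x, y). g x y) $$ (skip k (skip i a), skip l (skip j b)))"
      unfolding submatrix_def using pick_two[OF assms(1)] pick_two[OF assms(3)] by simp
    also have "\<dots> = mat (m - 1 - 1) (m - 1 - 1) (\<lambda>(a, b). ?F1 (skip i a) (skip j b))"
      by (intro eq_matI) (use assms in \<open>auto simp: skip_def\<close>)
    finally show ?thesis by (simp add: fdet_det)
  qed
  finally show ?thesis by (simp only: mult.assoc)
qed

lemma det_submatrix_two_zero_iff:
  fixes g :: "nat \<Rightarrow> nat \<Rightarrow> 'k::field"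
  assumes "i \<noteq> k" "i < m" "k < m" "j \<noteq> l" "j < m" "l < m"
  shows "det (submatrix (mat m m (\<lambda>(x, y). g x y)) (- {i, k}) (- {j, l})) = 0 \<longleftrightarrow> fdet m (g(i := urow j, k := urow l)) = 0"
proof -
  have *: "det (submatrix (mat m m (\<lambda>(x, y). g x y)) (- {i, k}) (- {j, l})) = 0 \<longleftrightarrow> fdet m (g(i := urow j, k := urow l)) = 0"
    if "i < k" "k < m" "j \<noteq> l" "j < m" "l < m" for i k j l
  proof (cases "j < l")
    case True
    show ?thesis using det_submatrix_two_ordered[OF that(1,2) True that(5), of g] by simp
  next
    case False
    then have "l < j" using that by simp
    then have "det (submatrix (mat m m (\<lambda>(x, y). g x y)) (- {i, k}) (- {l, j})) = 0 \<longleftrightarrow> fdet m (g(i := urow l, k := urow j)) = 0"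
      using det_submatrix_two_ordered[OF that(1,2) _ that(4), of l g] by simp
    moreover have "fdet m (g(i := urow l, k := urow j)) = - fdet m (g(i := urow j, k := urow l))"
      using that by (intro fdet_swap) auto
    ultimately show ?thesis by (simp add: insert_commute)
  qed
  show ?thesis
  proof (cases "i < k")
    case True then show ?thesis using *[of i k j l] assms by simp
  next
    case False
    then have "k < i" using assms by simp
    then have "det (submatrix (mat m m (\<lambda>(x, y). g x y)) (- {k, i}) (- {l, j})) = 0 \<longleftrightarrow> fdet m (g(k := urow l, i := urow j)) = 0"
      using *[of k i l j] assms by simp
    moreover have "g(k := urow l, i := urow j) = g(i := urow j, k := urow l)" using assms by (simp add: fun_upd_twist)
    moreover have "- {k, i} = - {i, k}" "- {l, j} = - {j, l}" by auto
    ultimately show ?thesis by (simp only:)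
  qed
qed

lemma fdet_scale:
  fixes F :: "nat \<Rightarrow> nat \<Rightarrow> 'a::comm_ring_1"
  shows "fdet m (\<lambda>x y. s x * t y * F x y) = (\<Prod>x<m. s x) * (\<Prod>y<m. t y) * fdet m F"
proof -
  have "(\<Prod>x<m. s x * t (p x) * F x (p x)) = (\<Prod>x<m. s x) * (\<Prod>y<m. t y) * (\<Prod>x<m. F x (p x))" if "p permutes {..<m}" for p
    using prod.permute[OF that, of t] by (simp add: prod.distrib comp_def)
  then show ?thesis
    unfolding fdet_def by (simp add: sum_distrib_left mult_ac)
qed

section \<open>The graph matrix and its minors\<close>

context graph_enum
begin

text \<open>
  The symmetric graph matrix without the edge variables.
\<close>

definition bmat :: "(nat \<Rightarrow> 'k::field) \<Rightarrow> nat \<Rightarrow> nat \<Rightarrow> 'k" where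
  "bmat \<sigma> i j = (if i < N \<and> j \<in> {N..<m} then inc \<sigma> i j else if j < N \<and> i \<in> {N..<m} then inc \<sigma> j i else 0)"

lemma bmat_sym: "bmat \<sigma> i j = bmat \<sigma> j i"
  by (auto simp: bmat_def)

lemma bmat_zero: "i < N \<Longrightarrow> j < N \<Longrightarrow> bmat \<sigma> i j = 0" "N \<le> i \<Longrightarrow> N \<le> j \<Longrightarrow> bmat \<sigma> i j = 0"
  by (auto simp: bmat_def)

lemma finite_arcs: "finite (arcs G)" using es(2) by (metis List.finite_set)

lemma fdet_units_bmat:
  fixes \<sigma> :: "nat \<Rightarrow> 'k::field"
  assumes "S \<subseteq> {..<N}" and \<sigma>: "\<And>t. \<sigma> t * \<sigma> t = 1"
  shows "fdet m (units_on S (bmat \<sigma>)) = (- 1) ^ (length vs - 1) * of_bool (undirected_tree (sub ({..<N} - S)))"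
proof -
  have "fdet m (units_on S (bmat \<sigma>)) = fdet m (bip ({..<N} - S) {N..<m} (bmat \<sigma>))"
    by (rule fdet_units_on_bip[OF assms(1) m_N(2)]) (rule bmat_sym bmat_zero; assumption?)+
  also have "bip ({..<N} - S) {N..<m} (bmat \<sigma>) = bip ({..<N} - S) {N..<m} (inc \<sigma>)"
    by (auto simp: bip_def bmat_def fun_eq_iff)
  finally show ?thesis using det_tree[of "{..<N} - S" \<sigma>] \<sigma> by auto
qed

lemma bij_complement: "bij_betw (\<lambda>S. (!) es ` ({..<N} - S)) (Pow {..<N}) (Pow (arcs G))"
proof (rule bij_betw_byWitness[of _ "\<lambda>T. {i. i < N \<and> es ! i \<notin> T}"])
  have inj: "es ! i = es ! j \<longleftrightarrow> i = j" if "i < N" "j < N" for i j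
    using that es(1) by (simp add: N_def nth_eq_iff_index_eq)
  show "\<forall>S\<in>Pow {..<N}. {i. i < N \<and> es ! i \<notin> (!) es ` ({..<N} - S)} = S"
    using inj by auto
  show "\<forall>T\<in>Pow (arcs G). (!) es ` ({..<N} - {i. i < N \<and> es ! i \<notin> T}) = T"
  proof
    fix T assume T: "T \<in> Pow (arcs G)"
    show "(!) es ` ({..<N} - {i. i < N \<and> es ! i \<notin> T}) = T"
    proof
      show "T \<subseteq> (!) es ` ({..<N} - {i. i < N \<and> es ! i \<notin> T})"
      proof
        fix x assume x: "x \<in> T"
        then have "x \<in> (!) es ` {..<N}" using T bij_betw_imp_surj_on[OF bij_arcs] by auto
        then show "x \<in> (!) es ` ({..<N} - {i. i < N \<and> es ! i \<notin> T})" using x by auto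
      qed
    qed auto
  qed
  show "(\<lambda>S. (!) es ` ({..<N} - S)) ` Pow {..<N} \<subseteq> Pow (arcs G)" using es_in by auto
qed auto

lemma eval_graph_poly_fdet:
  fixes \<sigma> :: "nat \<Rightarrow> 'k::field"
  assumes \<sigma>: "\<And>t. \<sigma> t * \<sigma> t = 1"
  shows "eval_poly a (graph_poly G) = (- 1) ^ (length vs - 1) * fdet m (add_diag (bmat \<sigma>) (\<lambda>i. if i < N then a (es ! i) else 0))"
proof -
  let ?s = "(- 1) ^ (length vs - 1) :: 'k"
  have st: "spanning_trees G = {T \<in> Pow (arcs G). undirected_tree (G\<lparr>arcs := T\<rparr>)}" by (auto simp: spanning_trees_def)
  have "eval_poly a (graph_poly G) = (\<Sum>T\<in>Pow (arcs G). of_bool (undirected_tree (G\<lparr>arcs := T\<rparr>)) * (\<Prod>x\<in>arcs G - T. a x))"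
    unfolding eval_graph_poly st using finite_arcs
    by (intro sum.mono_neutral_cong_left) auto
  also have "\<dots> = (\<Sum>S\<in>Pow {..<N}. of_bool (undirected_tree (sub ({..<N} - S))) * (\<Prod>x\<in>arcs G - (!) es ` ({..<N} - S). a x))"
    by (rule sum.reindex_bij_betw[OF bij_complement, symmetric])
  also have "\<dots> = (\<Sum>S\<in>Pow {..<N}. ?s * ((\<Prod>i\<in>S. a (es ! i)) * fdet m (units_on S (bmat \<sigma>))))"
  proof (rule sum.cong[OF refl])
    fix S assume S: "S \<in> Pow {..<N}"
    have inj: "inj_on ((!) es) {..<N}" using bij_arcs by (simp add: bij_betw_def)
    have "arcs G - (!) es ` ({..<N} - S) = (!) es ` {..<N} - (!) es ` ({..<N} - S)"
      using bij_betw_imp_surj_on[OF bij_arcs] by simp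
    also have "\<dots> = (!) es ` ({..<N} - ({..<N} - S))" using S by (intro inj_on_image_set_diff[OF inj, symmetric]) auto
    also have "{..<N} - ({..<N} - S) = S" using S by auto
    finally have "(\<Prod>x\<in>arcs G - (!) es ` ({..<N} - S). a x) = (\<Prod>i\<in>S. a (es ! i))"
      using inj_on_subset[OF inj, of S] S by (simp add: prod.reindex)
    moreover have "?s * ?s = 1" by (simp flip: power_mult_distrib)
    ultimately show "of_bool (undirected_tree (sub ({..<N} - S))) * (\<Prod>x\<in>arcs G - (!) es ` ({..<N} - S). a x) =
      ?s * ((\<Prod>i\<in>S. a (es ! i)) * fdet m (units_on S (bmat \<sigma>)))"
      using fdet_units_bmat[of S \<sigma>] S \<sigma> by auto
  qed
  also have "\<dots> = ?s * fdet m (add_diag (bmat \<sigma>) (\<lambda>i. if i \<in> {..<N} then a (es ! i) else 0))"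
    unfolding sum_distrib_left[symmetric] using m_N by (subst fdet_add_diag_expand) auto
  finally show ?thesis by simp
qed

lemma eval_graph_poly_del_arc_fdet:
  fixes \<sigma> :: "nat \<Rightarrow> 'k::field"
  assumes \<sigma>: "\<And>t. \<sigma> t * \<sigma> t = 1" and l: "l < N"
  shows "eval_poly a (graph_poly (pre_digraph.del_arc G (es ! l))) =
    (- 1) ^ (length vs - 1) * fdet m (add_diag ((bmat \<sigma>)(l := urow l)) (\<lambda>i. if i \<in> {..<N} - {l} then a (es ! i) else 0))"
proof -
  let ?b = "\<lambda>i. if i \<in> {..<N} - {l} then a (es ! i) else 0"
  have b: "(\<lambda>i. if i < N then (a(es ! l := c)) (es ! i) else 0) = ?b(l := c)" for c
    using l es(1) by (auto simp: fun_eq_iff N_def nth_eq_iff_index_eq)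
  have "l < m" using l m_N by simp
  then have "fdet m (add_diag (bmat \<sigma>) (?b(l := c))) = c * fdet m (add_diag ((bmat \<sigma>)(l := urow l)) ?b) + fdet m (add_diag (bmat \<sigma>) ?b)" for c
    by (intro fdet_add_diag_upd) auto
  then show ?thesis
    unfolding eval_graph_poly_del_arc[OF finite_arcs es_in[OF l]] eval_graph_poly_fdet[where \<sigma> = \<sigma>, OF \<sigma>] b
    by (simp only: mult_1_left mult_zero_left add_0_left distrib_left add_diff_cancel_right')
qed

text \<open>
  The position of an edge in the enumeration.
\<close>

definition index :: "'e \<Rightarrow> nat" where
  "index x = inv_into {..<N} ((!) es) x"

lemma index: "x \<in> arcs G \<Longrightarrow> index x < N" "x \<in> arcs G \<Longrightarrow> es ! index x = x" "i < N \<Longrightarrow> index (es ! i) = i"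
proof -
  assume "x \<in> arcs G"
  then have "x \<in> (!) es ` {..<N}" using bij_betw_imp_surj_on[OF bij_arcs] by simp
  then show "index x < N" "es ! index x = x"
    unfolding index_def using inv_into_into[of x "(!) es" "{..<N}"] f_inv_into_f[of x "(!) es" "{..<N}"] by auto
next
  assume "i < N"
  then show "index (es ! i) = i" unfolding index_def using bij_betw_inv_into_left[OF bij_arcs, of i] by simp
qed

lemma zero_count_pts:
  assumes Y: "Y \<subseteq> arcs G" "K = {i. i < N \<and> es ! i \<in> Y}"
    and P: "\<And>a :: 'e \<Rightarrow> 'k::{finite,field}. (\<forall>f\<in>F. eval_poly a f = 0) \<longleftrightarrow> P (\<lambda>i. if i \<in> K then a (es ! i) else 0)"
  shows "zero_count TYPE('k) Y F = card {b \<in> pts K. P b}"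
  unfolding zero_count_def
proof (rule bij_betw_same_card)
  have *: "index x \<in> K" if "x \<in> Y" for x using that Y index(1,2)[of x] by auto
  have **: "(\<lambda>i. if i \<in> K then (\<lambda>x\<in>Y. b (index x)) (es ! i) else 0) = b" if "b \<in> pts K" for b :: "nat \<Rightarrow> 'k"
    using that Y(2) index(3) by (auto simp: fun_eq_iff pts_def)
  show "bij_betw (\<lambda>a i. if i \<in> K then a (es ! i) else 0) {a \<in> Y \<rightarrow>\<^sub>E (UNIV :: 'k set). \<forall>f\<in>F. eval_poly a f = 0} {b \<in> pts K. P b}"
  proof (rule bij_betw_byWitness[of _ "\<lambda>b. \<lambda>x\<in>Y. b (index x)"])
    show "\<forall>a\<in>{a \<in> Y \<rightarrow>\<^sub>E (UNIV :: 'k set). \<forall>f\<in>F. eval_poly a f = 0}. (\<lambda>x\<in>Y. if index x \<in> K then a (es ! index x) else 0) = a"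
    proof
      fix a :: "'e \<Rightarrow> 'k" assume "a \<in> {a \<in> Y \<rightarrow>\<^sub>E (UNIV :: 'k set). \<forall>f\<in>F. eval_poly a f = 0}"
      then have a: "a \<in> Y \<rightarrow>\<^sub>E UNIV" by simp
      show "(\<lambda>x\<in>Y. if index x \<in> K then a (es ! index x) else 0) = a"
      proof (rule ext)
        fix x
        show "(\<lambda>x\<in>Y. if index x \<in> K then a (es ! index x) else 0) x = a x"
        proof (cases "x \<in> Y")
          case True
          then have "es ! index x = x" using index(2) Y(1) by blast
          then show ?thesis using True *[OF True] by simp
        next
          case False
          then show ?thesis using PiE_arb[OF a False] by simp
        qed
      qed
    qed
    show "\<forall>b\<in>{b \<in> pts K. P b}. (\<lambda>i. if i \<in> K then (\<lambda>x\<in>Y. b (index x)) (es ! i) else 0) = b"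
      using ** by blast
    show "(\<lambda>a i. if i \<in> K then a (es ! i) else 0) ` {a \<in> Y \<rightarrow>\<^sub>E (UNIV :: 'k set). \<forall>f\<in>F. eval_poly a f = 0} \<subseteq> {b \<in> pts K. P b}"
      using P by (auto simp: pts_def)
    show "(\<lambda>b. \<lambda>x\<in>Y. b (index x)) ` {b \<in> pts K. P b} \<subseteq> {a \<in> Y \<rightarrow>\<^sub>E (UNIV :: 'k set). \<forall>f\<in>F. eval_poly a f = 0}"
    proof
      fix a assume "a \<in> (\<lambda>b. \<lambda>x\<in>Y. b (index x)) ` {b \<in> pts K. P b}"
      then obtain b where b: "b \<in> pts K" "P b" "a = (\<lambda>x\<in>Y. b (index x))" by blast
      have "P (\<lambda>i. if i \<in> K then a (es ! i) else 0)" unfolding b(3) **[OF b(1)] by (rule b(2))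
      then show "a \<in> {a \<in> Y \<rightarrow>\<^sub>E (UNIV :: 'k set). \<forall>f\<in>F. eval_poly a f = 0}"
        using P[of a] b(3) by auto
    qed
  qed
qed

text \<open>
  The entries of the graph matrix evaluated at \<open>a\<close>. It is not symmetric: the vertex rows carry the
  negative incidence matrix.
\<close>

definition gmat :: "('e \<Rightarrow> 'k::field) \<Rightarrow> nat \<Rightarrow> nat \<Rightarrow> 'k" where
  "gmat a x y = (if x < N then (if y < N then (if x = y then a (es ! x) else 0) else inc (\<lambda>_. 1) x y)
     else (if y < N then - inc (\<lambda>_. 1) y x else 0))"

lemma map_graph_matrix: "map_mat (eval_poly a) (graph_matrix G es vs {}) = mat m m (\<lambda>(x, y). gmat a x y)"
proof -
  interpret h: comm_ring_hom "eval_poly a" by (rule comm_ring_hom_eval_poly)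
  show ?thesis
    by (rule eq_matI)
      (auto simp: graph_matrix_def incidence_matrix_def mat_diag_def gmat_def m_def N_def inc_def
        eval_poly_Var h.hom_minus h.hom_uminus of_bool_def)
qed

text \<open>
  Changing the sign of the vertex rows and of the edge rows and columns with \<open>\<sigma> = -1\<close> turns the graph matrix into
  the symmetric one. The variables of the removed rows or columns do not
  matter and are put to zero on the right.
\<close>

lemma dodgson_zero_iff:
  fixes a :: "'e \<Rightarrow> 'k::{finite,field}"
  assumes \<sigma>: "\<And>t. \<sigma> t * \<sigma> t = 1" and d: "distinct [i, j, k, l]" "{i, j, k, l} \<subseteq> {..<N}"
  shows "eval_poly a (dodgson_poly G es vs {es ! i, es ! k} {es ! j, es ! l} {}) = 0 \<longleftrightarrow>
    star_dodgson m (add_diag (bmat \<sigma>) (\<lambda>x. if x \<in> {..<N} - {i, j, k, l} then a (es ! x) else 0)) i j k l"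
proof -
  interpret h: comm_ring_hom "eval_poly a" by (rule comm_ring_hom_eval_poly)
  let ?b = "\<lambda>x. if x \<in> {..<N} - {i, j, k, l} then a (es ! x) else 0"
  have lt: "i < m" "j < m" "k < m" "l < m" using d(2) m_N by auto
  have inj: "es ! x = es ! y \<longleftrightarrow> x = y" if "x < N" "y < N" for x y
    using that es(1) by (simp add: N_def nth_eq_iff_index_eq)
  have I: "- {x. x < length es \<and> es ! x \<in> {es ! i, es ! k}} = - {i, k}" "- {x. x < length es \<and> es ! x \<in> {es ! j, es ! l}} = - {j, l}"
    using d inj by (auto simp: N_def)
  have sub: "map_mat (eval_poly a) (submatrix A R S) = submatrix (map_mat (eval_poly a) A) R S" for A R S
  proof (rule eq_matI)
    fix x y assume xy: "x < dim_row (submatrix (map_mat (eval_poly a) A) R S)" "y < dim_col (submatrix (map_mat (eval_poly a) A) R S)"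
    have "pick R x < dim_row A" "pick S y < dim_col A"
      using xy by (auto simp: dim_submatrix intro!: pick_le)
    then show "map_mat (eval_poly a) (submatrix A R S) $$ (x, y) = submatrix (map_mat (eval_poly a) A) R S $$ (x, y)"
      using xy by (simp add: submatrix_def)
  qed (simp_all add: dim_submatrix)
  have "eval_poly a (dodgson_poly G es vs {es ! i, es ! k} {es ! j, es ! l} {}) =
    det (submatrix (mat m m (\<lambda>(x, y). gmat a x y)) (- {i, k}) (- {j, l}))"
    unfolding dodgson_poly_def I by (simp only: h.hom_det[symmetric] sub map_graph_matrix)
  then have 1: "eval_poly a (dodgson_poly G es vs {es ! i, es ! k} {es ! j, es ! l} {}) = 0 \<longleftrightarrow>
     fdet m ((gmat a)(i := urow j, k := urow l)) = 0"
    by (simp only:) (rule det_submatrix_two_zero_iff; use d(1) lt in simp)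
  define s where "s x = (if x < N then \<sigma> x else - 1)" for x
  define t where "t x = (if x < N then \<sigma> x else 1)" for x
  have \<sigma>0: "\<sigma> x \<noteq> 0" for x using \<sigma>[of x] by auto
  have st0: "s x \<noteq> 0" "t x \<noteq> 0" for x using \<sigma>0 by (auto simp: s_def t_def)
  let ?F = "(gmat a)(i := urow j, k := urow l)"
  let ?B = "(add_diag (bmat \<sigma>) ?b)"
  have "fdet m (\<lambda>x y. s x * t y * ?F x y) = fdet m (?B(i := smul (s i * t j) (urow j), k := smul (s k * t l) (urow l)))"
    (is "fdet m ?L = fdet m ?R")
  proof (rule fdet_cong_prod)
    fix p assume p: "p permutes {..<m}"
    show "(\<Prod>x<m. ?L x (p x)) = (\<Prod>x<m. ?R x (p x))"
    proof (cases "p i = j \<and> p k = l")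
      case True
      show ?thesis
      proof (rule prod.cong[OF refl])
        fix x assume "x \<in> {..<m}"
        then have x: "x < m" "p x < m" using permutes_lessThan[OF p] by auto
        show "?L x (p x) = ?R x (p x)"
        proof (cases "x = i \<or> x = k")
          case xx: True
          then show ?thesis using d(1) True by (auto simp: smul_def urow_def)
        next
          case xx: False
          have "p x \<noteq> p i" "p x \<noteq> p k" using xx permutes_inj[OF p] by (simp_all add: inj_eq)
          then have "p x \<noteq> j" "p x \<noteq> l" using True by simp_all
          then have "x = p x \<Longrightarrow> x \<notin> {i, j, k, l}" using xx by auto
          then have "s x * t (p x) * gmat a x (p x) = ?B x (p x)"
            using x \<sigma>[of x] unfolding add_diag_def bmat_def gmat_def s_def t_def smul_def urow_def inc_def
            by (cases "x < N"; cases "p x < N"; cases "x = p x") (auto simp: mult_ac)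
          then show ?thesis using xx by simp
        qed
      qed
    next
      case False
      then have "?L i (p i) = 0 \<or> ?L k (p k) = 0" "?R i (p i) = 0 \<or> ?R k (p k) = 0"
        using d(1) by (auto simp: smul_def urow_def)
      then have "\<exists>x\<in>{..<m}. ?L x (p x) = 0" "\<exists>x\<in>{..<m}. ?R x (p x) = 0"
        using lt by blast+
      then have "(\<Prod>x<m. ?L x (p x)) = 0" "(\<Prod>x<m. ?R x (p x)) = 0"
        by (simp_all only: prod_zero_iff[OF finite_lessThan])
      then show ?thesis by (simp only:)
    qed
  qed
  also have "\<dots> = (s k * t l) * (s i * t j) * fdet m (?B(i := urow j, k := urow l))"
  proof -
    have ik: "i \<noteq> k" using d by auto
    have "fdet m ?R = (s k * t l) * fdet m (?B(i := smul (s i * t j) (urow j), k := urow l))"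
      by (rule fdet_row_smul) (rule lt)
    also have "?B(i := smul (s i * t j) (urow j), k := urow l) = ?B(k := urow l, i := smul (s i * t j) (urow j))"
      by (rule fun_upd_twist) (rule ik)
    also have "fdet m \<dots> = (s i * t j) * fdet m (?B(k := urow l, i := urow j))"
      by (rule fdet_row_smul) (rule lt)
    also have "?B(k := urow l, i := urow j) = ?B(i := urow j, k := urow l)"
      by (rule fun_upd_twist[symmetric]) (rule ik)
    finally show ?thesis by (simp only: mult.assoc)
  qed
  finally have eq: "(\<Prod>x<m. s x) * (\<Prod>y<m. t y) * fdet m ?F = (s k * t l) * (s i * t j) * fdet m (?B(i := urow j, k := urow l))"
    unfolding fdet_scale .
  have nz: "(\<Prod>x<m. s x) \<noteq> 0" "(\<Prod>y<m. t y) \<noteq> 0" using st0 by simp_all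
  have "fdet m ?F = 0 \<longleftrightarrow> (\<Prod>x<m. s x) * (\<Prod>y<m. t y) * fdet m ?F = 0"
    by (simp only: mult_eq_0_iff nz simp_thms)
  also have "\<dots> \<longleftrightarrow> fdet m (?B(i := urow j, k := urow l)) = 0"
    unfolding eq by (simp only: mult_eq_0_iff st0 simp_thms)
  finally have "fdet m ?F = 0 \<longleftrightarrow> fdet m (?B(i := urow j, k := urow l)) = 0" .
  then show ?thesis using 1 by (simp only: star_dodgson_def)
qed

end

section \<open>The congruence for the graph polynomial\<close>

text \<open>
  The representative chosen for the \<open>c_2\<close>-invariant is irrelevant modulo \<open>q\<^sup>3\<close>.
\<close>

lemma c2_cong:
  fixes z q :: nat
  assumes "int q ^ 2 dvd int z"
  shows "[int q ^ 2 * int (z div q ^ 2 mod q) = int z] (mod int q ^ 3)"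
proof (cases "q = 0")
  case True
  then show ?thesis using assms by simp
next
  case False
  have "q ^ 2 dvd z" using assms by (simp flip: of_nat_power)
  then obtain w where w: "z = q ^ 2 * w" by blast
  have "int w = int (w mod q) + int q * int (w div q)" by (simp flip: of_nat_mult of_nat_add)
  then have "int z - int q ^ 2 * int (w mod q) = int q ^ 3 * int (w div q)"
    unfolding w by (simp add: algebra_simps power3_eq_cube power2_eq_square)
  then have "int q ^ 3 dvd int z - int q ^ 2 * int (w mod q)" by simp
  then show ?thesis using False w by (simp add: cong_iff_dvd_diff dvd_diff_commute)
qed

theorem theorem17:
  fixes G :: "('v, 'e) pre_digraph"
    and es :: "'e list" and vs :: "'v list"
    and v :: 'v and e1 e2 e3 e4 :: 'e
    and q :: nat
  assumes "fin_digraph G"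
    and "card (verts G) \<ge> 5"
    and "card (arcs G) \<ge> 5"
    and "distinct es" "set es = arcs G"
    and "distinct vs" "set vs = verts G"
    and "v \<in> verts G" "valency G v = 4"
    and "distinct [e1, e2, e3, e4]" "incident_edges G v = {e1, e2, e3, e4}"
    and "q = CARD('k::{finite,field})"
  shows "[int (zero_count TYPE('k) (arcs G) {graph_poly G}) =
          - (int q ^ 2) *
            (int (zero_count TYPE('k) (arcs G - {e1, e2, e3, e4})
                    {dodgson_poly G es vs {e1, e3} {e2, e4} {},
                     dodgson_poly G es vs {e1, e4} {e2, e3} {}}) +
             (\<Sum>e\<in>{e1, e2, e3, e4}.
                int (c2_invariant TYPE('k) (pre_digraph.del_arc G e))))]
         (mod int q ^ 3)"
proof -
  have "vs \<noteq> []" using assms(7,8) by auto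
  then interpret g: graph_enum G es vs
    using assms by (intro graph_enum.intro)
  have sizes: "5 \<le> g.N" "g.N + 4 \<le> g.m"
    using assms(2-7) distinct_card[of es] distinct_card[of vs] by (simp_all add: g.N_def g.m_def)
  have star: "{e1, e2, e3, e4} \<subseteq> arcs G" using assms(11) by (auto simp: incident_edges_def)
  define i1 i2 i3 i4 where "i1 = g.index e1" and "i2 = g.index e2" and "i3 = g.index e3" and "i4 = g.index e4"
  have e: "es ! i1 = e1" "es ! i2 = e2" "es ! i3 = e3" "es ! i4 = e4"
    using g.index(2) star by (simp_all add: i1_def i2_def i3_def i4_def)
  have lt: "i1 < g.N" "i2 < g.N" "i3 < g.N" "i4 < g.N"
    using g.index(1) star by (simp_all add: i1_def i2_def i3_def i4_def)
  have dist: "distinct [i1, i2, i3, i4]" using assms(10) e by auto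
  have idx: "es ! j \<in> {e1, e2, e3, e4} \<longleftrightarrow> j \<in> {i1, i2, i3, i4}" if "j < g.N" for j
    using that lt assms(4) unfolding e[symmetric] by (auto simp: g.N_def nth_eq_iff_index_eq)
  \<comment> \<open>Four distinct edges account for the valency, so there is no loop at \<open>v\<close>.\<close>
  have no_loop: "\<not> (tail G x = v \<and> head G x = v)" if "x \<in> arcs G" for x
  proof
    let ?T = "{x \<in> arcs G. tail G x = v}" and ?H = "{x \<in> arcs G. head G x = v}"
    assume "tail G x = v \<and> head G x = v"
    then have "x \<in> ?T \<inter> ?H" using that by simp
    then have "card (?T \<inter> ?H) \<noteq> 0" using g.finite_arcs by auto
    moreover have "?T \<union> ?H = {e1, e2, e3, e4}" using assms(11) by (auto simp: incident_edges_def)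
    then have "card (?T \<union> ?H) = 4" using assms(10) by simp
    moreover have "card ?T + card ?H = card (?T \<union> ?H) + card (?T \<inter> ?H)"
      by (rule card_Un_Int) (use g.finite_arcs in auto)
    ultimately show False using assms(9) by (simp add: valency_def)
  qed
  \<comment> \<open>All edges of the star are oriented towards \<open>v\<close>.\<close>
  define \<sigma> :: "nat \<Rightarrow> 'k" where "\<sigma> t = (if head G (es ! t) = v then 1 else - 1)" for t
  have \<sigma>: "\<sigma> t * \<sigma> t = 1" for t by (simp add: \<sigma>_def)
  \<comment> \<open>For \<open>v \<noteq> base\<close> the column of \<open>v\<close> is used, for \<open>v = base\<close> minus the sum of all columns.\<close>
  define y :: "'v \<Rightarrow> 'k" where "y w = of_bool (w = v) - of_bool (v = g.base)" for w
  define xi :: "nat \<Rightarrow> 'k" where "xi k = (if k \<in> {g.N..<g.m} then y (vs ! (k - g.N)) else 0)" for k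
  interpret b: bipartite_star g.m g.N "g.bmat \<sigma>" i1 i2 i3 i4 xi
  proof
    fix j assume j: "j < g.m"
    have "(\<Sum>k<g.m. xi k * g.bmat \<sigma> k j) = (\<Sum>k\<in>{g.N..<g.m}. y (vs ! (k - g.N)) * g.bmat \<sigma> k j)"
      by (rule sum.mono_neutral_cong_right) (auto simp: xi_def)
    also have "\<dots> = of_bool (j \<in> {i1, i2, i3, i4})"
    proof (cases "j < g.N")
      case True
      have "(\<Sum>k\<in>{g.N..<g.m}. y (vs ! (k - g.N)) * g.bmat \<sigma> k j) = (\<Sum>k\<in>{g.N..<g.m}. g.inc \<sigma> j k * y (vs ! (k - g.N)))"
        using True by (intro sum.cong refl) (auto simp: g.bmat_def)
      also have "\<dots> = \<sigma> j * (y (head G (es ! j)) - y (tail G (es ! j)))"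
        by (rule g.sum_inc) (use True in \<open>auto simp: y_def\<close>)
      also have "\<dots> = of_bool (es ! j \<in> incident_edges G v)"
        using no_loop[OF g.es_in[OF True]] g.es_in[OF True]
        by (auto simp: \<sigma>_def y_def incident_edges_def)
      also have "\<dots> = of_bool (j \<in> {i1, i2, i3, i4})" using idx[OF True] by (simp only: assms(11))
      finally show ?thesis .
    next
      case False
      then have "j \<notin> {i1, i2, i3, i4}" using lt by auto
      moreover have "(\<Sum>k\<in>{g.N..<g.m}. y (vs ! (k - g.N)) * g.bmat \<sigma> k j) = 0"
        using False by (intro sum.neutral) (auto simp: g.bmat_def)
      ultimately show ?thesis by simp
    qed
    finally show "(\<Sum>k<g.m. xi k * g.bmat \<sigma> k j) = of_bool (j \<in> {i1, i2, i3, i4})" .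
  next
    show "distinct [i1, i2, i3, i4]" by (rule dist)
    show "{i1, i2, i3, i4} \<subseteq> {..<g.N}" using lt by auto
    show "g.bmat \<sigma> i j = g.bmat \<sigma> j i" for i j by (rule g.bmat_sym)
  qed (use sizes in \<open>simp_all add: g.bmat_zero xi_def\<close>)
  let ?z = "\<lambda>x. zero_count TYPE('k) (arcs (pre_digraph.del_arc G x)) {graph_poly (pre_digraph.del_arc G x)}"
  have sgn: "(- 1 :: 'k) ^ n * d = 0 \<longleftrightarrow> d = 0" for n d by simp
  have count_G: "zero_count TYPE('k) (arcs G) {graph_poly G} =
    card {a \<in> pts {..<g.N}. fdet g.m (add_diag (g.bmat \<sigma>) a) = 0}"
  proof (rule g.zero_count_pts)
    show "{..<g.N} = {i. i < g.N \<and> es ! i \<in> arcs G}" using g.es_in by auto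
    show "(\<forall>f\<in>{graph_poly G}. eval_poly a f = 0) \<longleftrightarrow>
        fdet g.m (add_diag (g.bmat \<sigma>) (\<lambda>i. if i \<in> {..<g.N} then a (es ! i) else 0)) = 0" for a :: "'e \<Rightarrow> 'k"
      by (simp only: ball_simps g.eval_graph_poly_fdet[of \<sigma>, OF \<sigma>] sgn lessThan_iff) simp
  qed simp
  have count_del: "?z (es ! l) = card {a \<in> pts ({..<g.N} - {l}). fdet g.m (add_diag ((g.bmat \<sigma>)(l := urow l)) a) = 0}"
    if l: "l < g.N" for l
  proof (rule g.zero_count_pts)
    show "arcs (pre_digraph.del_arc G (es ! l)) \<subseteq> arcs G" by (auto simp: pre_digraph.del_arc_def)
    show "{..<g.N} - {l} = {i. i < g.N \<and> es ! i \<in> arcs (pre_digraph.del_arc G (es ! l))}"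
      using g.es_in l assms(4) by (auto simp: pre_digraph.del_arc_def g.N_def nth_eq_iff_index_eq)
    show "(\<forall>f\<in>{graph_poly (pre_digraph.del_arc G (es ! l))}. eval_poly a f = 0) \<longleftrightarrow>
        fdet g.m (add_diag ((g.bmat \<sigma>)(l := urow l)) (\<lambda>i. if i \<in> {..<g.N} - {l} then a (es ! i) else 0)) = 0" for a :: "'e \<Rightarrow> 'k"
      using g.eval_graph_poly_del_arc_fdet[of \<sigma> l a, OF \<sigma> l] by (simp only: ball_simps sgn) simp
  qed
  have count_D: "zero_count TYPE('k) (arcs G - {e1, e2, e3, e4})
      {dodgson_poly G es vs {e1, e3} {e2, e4} {}, dodgson_poly G es vs {e1, e4} {e2, e3} {}} =
    card {a \<in> pts ({..<g.N} - {i1, i2, i3, i4}). star_dodgson g.m (add_diag (g.bmat \<sigma>) a) i1 i2 i3 i4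
       \<and> star_dodgson g.m (add_diag (g.bmat \<sigma>) a) i1 i2 i4 i3}"
  proof (rule g.zero_count_pts)
    show "{..<g.N} - {i1, i2, i3, i4} = {i. i < g.N \<and> es ! i \<in> arcs G - {e1, e2, e3, e4}}"
      using g.es_in idx by blast
    fix a :: "'e \<Rightarrow> 'k"
    have s: "{i1, i2, i4, i3} = {i1, i2, i3, i4}" by auto
    have "distinct [i1, i2, i4, i3]" "{i1, i2, i3, i4} \<subseteq> {..<g.N}" using dist lt by auto
    note d = g.dodgson_zero_iff[of \<sigma> i1 i2 i3 i4 a, OF \<sigma> dist this(2)]
      g.dodgson_zero_iff[of \<sigma> i1 i2 i4 i3 a, unfolded s, OF \<sigma> this]
    show "(\<forall>f\<in>{dodgson_poly G es vs {e1, e3} {e2, e4} {}, dodgson_poly G es vs {e1, e4} {e2, e3} {}}. eval_poly a f = 0) \<longleftrightarrow>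
      star_dodgson g.m (add_diag (g.bmat \<sigma>) (\<lambda>i. if i \<in> {..<g.N} - {i1, i2, i3, i4} then a (es ! i) else 0)) i1 i2 i3 i4 \<and>
      star_dodgson g.m (add_diag (g.bmat \<sigma>) (\<lambda>i. if i \<in> {..<g.N} - {i1, i2, i3, i4} then a (es ! i) else 0)) i1 i2 i4 i3"
      using d unfolding e by (simp only: ball_simps simp_thms)
  qed auto
  let ?Z = "int (zero_count TYPE('k) (arcs G) {graph_poly G})"
  let ?D = "int (zero_count TYPE('k) (arcs G - {e1, e2, e3, e4})
                    {dodgson_poly G es vs {e1, e3} {e2, e4} {},
                     dodgson_poly G es vs {e1, e4} {e2, e3} {}})"
  have sum_I: "(\<Sum>l\<in>{i1, i2, i3, i4}. h l) = h i1 + h i2 + h i3 + (h i4 :: int)" for h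
    using dist by simp
  have sum_E: "(\<Sum>x\<in>{e1, e2, e3, e4}. h x) = h e1 + h e2 + h e3 + (h e4 :: int)" for h
    using assms(10) by simp
  have "[?Z + (\<Sum>x\<in>{e1, e2, e3, e4}. int (?z x)) + int q ^ 2 * ?D = 0] (mod int q ^ 3)"
    using b.bipartite_star_cong
    unfolding sum_I sum_E count_G count_D assms(12)
      count_del[OF lt(1), unfolded e] count_del[OF lt(2), unfolded e]
      count_del[OF lt(3), unfolded e] count_del[OF lt(4), unfolded e] .
  moreover have "[int q ^ 2 * (\<Sum>x\<in>{e1, e2, e3, e4}. int (c2_invariant TYPE('k) (pre_digraph.del_arc G x))) =
      (\<Sum>x\<in>{e1, e2, e3, e4}. int (?z x))] (mod int q ^ 3)"
    unfolding sum_distrib_left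
  proof (rule cong_sum)
    fix x assume "x \<in> {e1, e2, e3, e4}"
    then obtain l where l: "l \<in> {i1, i2, i3, i4}" "x = es ! l" unfolding e[symmetric] by blast
    then have "l < g.N" using lt by auto
    then have "int q ^ 2 dvd int (?z x)"
      unfolding l(2) assms(12) using b.square_dvd_deleted[OF l(1)] by (simp only: count_del)
    from c2_cong[OF this] show "[int q ^ 2 * int (c2_invariant TYPE('k) (pre_digraph.del_arc G x)) = int (?z x)] (mod int q ^ 3)"
      by (simp only: c2_invariant_def assms(12))
  qed
  ultimately show ?thesis
    unfolding cong_iff_dvd_diff
  proof -
    let ?C = "\<Sum>x\<in>{e1, e2, e3, e4}. int (c2_invariant TYPE('k) (pre_digraph.del_arc G x))"
    let ?S = "\<Sum>x\<in>{e1, e2, e3, e4}. int (?z x)"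
    assume "int q ^ 3 dvd ?Z + ?S + int q ^ 2 * ?D - 0" "int q ^ 3 dvd int q ^ 2 * ?C - ?S"
    then have "int q ^ 3 dvd (?Z + ?S + int q ^ 2 * ?D - 0) + (int q ^ 2 * ?C - ?S)" by (rule dvd_add)
    also have "\<dots> = ?Z - - (int q ^ 2) * (?D + ?C)" by (simp only: distrib_left)
    finally show "int q ^ 3 dvd ?Z - - (int q ^ 2) * (?D + ?C)" .
  qed
qed

end
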